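(* Let $\beta=\frac{1+\sqrt5}2$ and $T_\beta(x)=\beta x\ (\mathrm{mod}\ 1)$ on $[0,1)$. Let $F:[0,1)\times Y\to[0,1)\times Y$ be a skew product endomorphism $$F(x,y)=\Big(\tfrac{1+\sqrt5}2\,x\ (\mathrm{mod}\ 1),\ g(x,y)\Big),$$ where $Y$ is an open bounded set in $\mathbb R^d$ and $g_x=g(x,\cdot):Y\to Y$ is a conformal map for every $x\in[0,1)$. Assume that for any distinct $x_{-1},x_{-1}'\in[0,1)$ with $T_\beta x_{-1}=T_\beta x_{-1}'$ we have $g_{x_{-1}}(Y)\cap g_{x_{-1}'}(Y)=\emptyset$, and that the fiber maps $g_x$ satisfy the conditions (a)–(g) listed in the context. Then for any locally Hölder continuous potential $\phi:[0,1)\times Y\to\mathbb R$, its equilibrium measure $\mu_\phi$ has exact dimensional conditional measures $\mu_\phi^x$ for $\mu_\phi\circ p_1^{-1}$-a.e. $x\in[0,1)$, where $p_1$ is the projection onto the first coordinate.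
   Context: **Coding.** $E_2^+(11)$ (resp. $E_2(11)$) is the set of sequences $\omega=(\omega_n)_{n\ge0}$ (resp. $n\in\mathbb Z$) of digits in $\{0,1\}$ not containing the word $11$; $\sigma$ is the left shift; $\tau|_m^\infty=\tau_m\tau_{m+1}\ldots$. The coding over $T_\beta$ is $\pi(\omega)=\sum_{n\ge1}\omega_{n-1}\beta^{-n}$, which is injective outside a countable set. (Since $\pi(1,0,1,0,\ldots)=1$, a map $g_1$ is understood to be fixed so that $g_{\pi(\omega)}$ makes sense for all $\omega$; this concerns only a countable set of $\omega$.) **Fiber conditions.** For $\omega\in E_2^+(11)$ put $Y_\omega=\overline Y$, $T_\omega=g_{\pi(\omega)}:Y_\omega\to Y_{\sigma(\omega)}$ (extended to $\overline Y$), continuous and injective. For $\tau\in E_2(11)$, $\hat\pi_2(\tau)$ is the unique point of $\bigcap_{n\ge1}\overline{T_{\tau|_{-1}^\infty}\circ\cdots\circ T_{\tau|_{-n}^\infty}(Y_{\tau|_{-n}^\infty})}$, and $J_\omega=\hat\pi_2(\{\tau:\tau|_0^\infty=\omega\})$. The conditions are: (a) $Y_\omega$ is closed, bounded, $\overline{\mathrm{Int}Y_\omega}=Y_\omega$; (b) each $T_\omega$ extends to a $C^1$ conformal embedding $Y_\omega^*\to Y_{\sigma(\omega)}^*$, where $Y_\omega^*\supset Y_\omega$ is bounded connected open in $\mathbb R^d$; (c) there is $\lambda>1$ with $\|T_\omega(y_1)-T_\omega(y_2)\|\le\lambda^{-1}\|y_1-y_2\|$ for all $\omega$, $y_1,y_2\in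 Y_\omega^*$; (d) there are $\alpha,H>0$ with $|\log|T_\omega'(y)|-\log|T_\omega'(z)||\le H\|y-z\|^\alpha$ for all $\omega$, $y,z\in Y_\omega^*$; (e) $E_2(11)\ni\tau\mapsto\log|T'_{\tau|_0^\infty}(\hat\pi_2(\tau))|$ is Hölder continuous; (f) for $\omega\in E_2^+(11)$ and distinct $a,b\in\{0,1\}$ with $a\omega,b\omega$ admissible, $T_{a\omega}(\mathrm{Int}Y_{a\omega})\cap T_{b\omega}(\mathrm{Int}Y_{b\omega})=\emptyset$; (g) there is a measurable $\delta:E_2^+(11)\to(0,\infty)$ with $J_\omega\cap(Y_\omega\setminus\overline B(Y_\omega^c,\delta(\omega)))\ne\emptyset$ for all $\omega$. Hölder continuity on $E_2(11)$ is with respect to a metric $d_\kappa(\omega,\tau)=\exp(-\kappa\max\{n\ge0:\omega_k=\tau_k\text{ for }|k|\le n\})$, $\kappa>0$ (with the distance of sequences differing at coordinate $0$ equal to a positive constant). **Equilibrium measure.** Let $\Pi(\tau)=(\pi(\tau|_0^\infty),\hat\pi_2(\tau))$. The potential $\phi$ is locally Hölder continuous in the sense that $\widehat\phi=\phi\circ\Pi$ is Hölder continuous on $E_2(11)$. $\mu_{\widehat\phi}$ is the unique shift-invariant equilibrium (Gibbs) state of $\widehat\phi$ on $E_2(11)$, and $\mu_\phi:=\mu_{\widehat\phi}\circ\Pi^{-1}$. $\mu_\phi^x$ are the Rokhlin conditional measures of $\mu_\phi$ for the partition into fibers over $x\in[0,1)$, viewed as measures in $\overline Y$. A measure $\mu$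 is exact dimensional if $\lim_{r\to0}\log\mu(B(y,r))/\log r$ exists and is constant $\mu$-a.e. *)

theory Defs
  imports "HOL-Probability.Probability"
begin

section \<open>The golden mean shift and the coding of the beta-transformation\<close>

definition golden :: real where
  "golden = (1 + sqrt 5) / 2"

definition T_beta :: "real \<Rightarrow> real" where
  "T_beta x = frac (golden * x)"

definition E2p :: "(nat \<Rightarrow> nat) set" where
  "E2p = {\<omega>. (\<forall>n. \<omega> n \<in> {0, 1}) \<and> (\<forall>n. \<not> (\<omega> n = 1 \<and> \<omega> (Suc n) = 1))}"

definition E2 :: "(int \<Rightarrow> nat) set" where
  "E2 = {\<tau>. (\<forall>n. \<tau> n \<in> {0, 1}) \<and> (\<forall>n. \<not> (\<tau> n = 1 \<and> \<tau> (n + 1) = 1))}"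

definition shiftp :: "(nat \<Rightarrow> nat) \<Rightarrow> nat \<Rightarrow> nat" where
  "shiftp \<omega> = (\<lambda>n. \<omega> (Suc n))"

definition shift :: "(int \<Rightarrow> nat) \<Rightarrow> int \<Rightarrow> nat" where
  "shift \<tau> = (\<lambda>n. \<tau> (n + 1))"

text \<open>\<open>tail \<tau> m\<close> is the one-sided sequence \<open>\<tau>\<^sub>m \<tau>\<^sub>m\<^sub>+\<^sub>1 \<dots>\<close>.\<close>

definition tail :: "(int \<Rightarrow> nat) \<Rightarrow> int \<Rightarrow> nat \<Rightarrow> nat" where
  "tail \<tau> m = (\<lambda>k. \<tau> (m + int k))"

definition coding :: "(nat \<Rightarrow> nat) \<Rightarrow> real" where
  "coding \<omega> = (\<Sum>n. real (\<omega> n) / golden ^ Suc n)"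

text \<open>The Borel structures are those of the product topology on sequences of (discrete) digits.\<close>

abbreviation borel_E2 :: "(int \<Rightarrow> nat) measure" where
  "borel_E2 \<equiv> restrict_space borel E2"

abbreviation borel_E2p :: "(nat \<Rightarrow> nat) measure" where
  "borel_E2p \<equiv> restrict_space borel E2p"

text \<open>Sequences differing at coordinate \<open>0\<close> get distance \<open>1\<close>; any other positive constant
  gives the same class of Hoelder functions.\<close>

definition dist_E2 :: "real \<Rightarrow> (int \<Rightarrow> nat) \<Rightarrow> (int \<Rightarrow> nat) \<Rightarrow> real" where
  "dist_E2 \<kappa> \<omega> \<tau> =
    (if \<omega> = \<tau> then 0
     else if \<omega> 0 \<noteq> \<tau> 0 then 1
     else exp (- \<kappa> * real (Max {n::nat. \<forall>k::int. \<bar>k\<bar> \<le> int n \<longrightarrow> \<omega> k = \<tau> k})))"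

definition hoelder_E2 :: "((int \<Rightarrow> nat) \<Rightarrow> real) \<Rightarrow> bool" where
  "hoelder_E2 f \<longleftrightarrow>
    (\<exists>\<kappa>>0. \<exists>a>0. \<exists>L. \<forall>\<omega>\<in>E2. \<forall>\<tau>\<in>E2. \<bar>f \<omega> - f \<tau>\<bar> \<le> L * dist_E2 \<kappa> \<omega> \<tau> powr a)"


section \<open>Equilibrium (Gibbs) states on the golden mean shift\<close>

definition measure_preserving_map :: "'b measure \<Rightarrow> ('b \<Rightarrow> 'b) \<Rightarrow> bool" where
  "measure_preserving_map M f \<longleftrightarrow> f \<in> measurable M M \<and> distr M M f = M"

definition finite_partition :: "'b measure \<Rightarrow> 'b set set \<Rightarrow> bool" where
  "finite_partition M P \<longleftrightarrow> finite P \<and> P \<subseteq> sets M \<and> disjoint P \<and> \<Union>P = space M"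

definition partition_entropy :: "'b measure \<Rightarrow> 'b set set \<Rightarrow> real" where
  "partition_entropy M P = - (\<Sum>A\<in>P. measure M A * ln (measure M A))"

text \<open>The refinement \<open>P \<or> f\<^sup>-\<^sup>1 P \<or> \<dots> \<or> f\<^sup>-\<^sup>(\<^sup>n\<^sup>-\<^sup>1\<^sup>) P\<close>.\<close>

primrec refined_partition :: "'b measure \<Rightarrow> ('b \<Rightarrow> 'b) \<Rightarrow> 'b set set \<Rightarrow> nat \<Rightarrow> 'b set set" where
  "refined_partition M f P 0 = {space M}"
| "refined_partition M f P (Suc n) =
    {A \<inter> ((f ^^ n) -` B \<inter> space M) | A B. A \<in> refined_partition M f P n \<and> B \<in> P}"

definition KS_entropy :: "'b measure \<Rightarrow> ('b \<Rightarrow> 'b) \<Rightarrow> ereal" where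
  "KS_entropy M f =
    (SUP P\<in>{P. finite_partition M P}.
       ereal (lim (\<lambda>n. partition_entropy M (refined_partition M f P n) / real n)))"

definition invariant_prob_E2 :: "(int \<Rightarrow> nat) measure \<Rightarrow> bool" where
  "invariant_prob_E2 \<mu> \<longleftrightarrow>
    prob_space \<mu> \<and> sets \<mu> = sets borel_E2 \<and> measure_preserving_map \<mu> shift"

definition equilibrium_state :: "((int \<Rightarrow> nat) \<Rightarrow> real) \<Rightarrow> (int \<Rightarrow> nat) measure \<Rightarrow> bool" where
  "equilibrium_state \<psi> \<mu> \<longleftrightarrow> invariant_prob_E2 \<mu> \<and>
    (\<forall>\<nu>. invariant_prob_E2 \<nu> \<longrightarrow>
      KS_entropy \<nu> shift + ereal (integral\<^sup>L \<nu> \<psi>) \<le> KS_entropy \<mu> shift + ereal (integral\<^sup>L \<mu> \<psi>))"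

definition gibbs_state :: "((int \<Rightarrow> nat) \<Rightarrow> real) \<Rightarrow> (int \<Rightarrow> nat) measure \<Rightarrow> bool" where
  "gibbs_state \<psi> \<mu> \<longleftrightarrow> invariant_prob_E2 \<mu> \<and>
    (\<exists>C\<ge>1. \<exists>P. \<forall>\<tau>\<in>E2. \<forall>n\<ge>1.
      (let q = measure \<mu> {\<omega>\<in>E2. \<forall>k<n. \<omega> (int k) = \<tau> (int k)}
               / exp ((\<Sum>k<n. \<psi> ((shift ^^ k) \<tau>)) - real n * P)
       in inverse C \<le> q \<and> q \<le> C))"


section \<open>Conformal maps\<close>

text \<open>Orientation-reversing conformal maps are allowed.\<close>

definition C1_conformal_on :: "('a::euclidean_space \<Rightarrow> 'a) \<Rightarrow> 'a set \<Rightarrow> bool" where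
  "C1_conformal_on f U \<longleftrightarrow>
    (\<exists>D :: 'a \<Rightarrow> 'a \<Rightarrow>\<^sub>L 'a.
       continuous_on U D \<and>
       (\<forall>y\<in>U. (f has_derivative blinfun_apply (D y)) (at y) \<and>
          (\<exists>c>0. \<exists>Q. orthogonal_transformation Q \<and> blinfun_apply (D y) = (\<lambda>v. c *\<^sub>R Q v))))"

definition C1_conformal_embedding ::
    "('a::euclidean_space \<Rightarrow> 'a) \<Rightarrow> 'a set \<Rightarrow> 'a set \<Rightarrow> bool" where
  "C1_conformal_embedding f U V \<longleftrightarrow>
    f ` U \<subseteq> V \<and> (\<exists>h. homeomorphism U (f ` U) f h) \<and> C1_conformal_on f U"

definition deriv_norm :: "('a::euclidean_space \<Rightarrow> 'a) \<Rightarrow> 'a \<Rightarrow> real" where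
  "deriv_norm f y = onorm (frechet_derivative f (at y))"


section \<open>Fiber maps over the shift\<close>

text \<open>Throughout, \<open>Y \<omega>\<close> is the fiber over \<open>\<omega>\<close>, \<open>Ys \<omega>\<close> its neighborhood \<open>Y\<^sub>\<omega>\<^sup>*\<close>, and \<open>T \<omega>\<close> is the fiber
  map together with its extension to \<open>Ys \<omega>\<close>; the values of \<open>T \<omega>\<close> outside \<open>Ys \<omega>\<close> play no role.\<close>

definition fiber_maps ::
    "((nat \<Rightarrow> nat) \<Rightarrow> 'a::euclidean_space set) \<Rightarrow> ((nat \<Rightarrow> nat) \<Rightarrow> 'a \<Rightarrow> 'a) \<Rightarrow> bool" where
  "fiber_maps Y T \<longleftrightarrow>
    (\<forall>\<omega>\<in>E2p. T \<omega> ` Y \<omega> \<subseteq> Y (shiftp \<omega>) \<and> continuous_on (Y \<omega>) (T \<omega>) \<and> inj_on (T \<omega>) (Y \<omega>))"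

text \<open>\<open>past_comp T \<tau> n\<close> is the composition of \<open>T (tail \<tau> (-1))\<close>, ..., \<open>T (tail \<tau> (-n))\<close>,
  the last one being applied first.\<close>

primrec past_comp :: "((nat \<Rightarrow> nat) \<Rightarrow> 'a \<Rightarrow> 'a) \<Rightarrow> (int \<Rightarrow> nat) \<Rightarrow> nat \<Rightarrow> 'a \<Rightarrow> 'a" where
  "past_comp T \<tau> 0 = id"
| "past_comp T \<tau> (Suc n) = past_comp T \<tau> n \<circ> T (tail \<tau> (- int (Suc n)))"

definition fiber_point ::
    "((nat \<Rightarrow> nat) \<Rightarrow> 'a::euclidean_space set) \<Rightarrow> ((nat \<Rightarrow> nat) \<Rightarrow> 'a \<Rightarrow> 'a) \<Rightarrow> (int \<Rightarrow> nat) \<Rightarrow> 'a" where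
  "fiber_point Y T \<tau> =
    (THE y. y \<in> (\<Inter>n\<in>{1..}. closure (past_comp T \<tau> n ` Y (tail \<tau> (- int n)))))"

definition fiber_limit_set ::
    "((nat \<Rightarrow> nat) \<Rightarrow> 'a::euclidean_space set) \<Rightarrow> ((nat \<Rightarrow> nat) \<Rightarrow> 'a \<Rightarrow> 'a) \<Rightarrow> (nat \<Rightarrow> nat) \<Rightarrow> 'a set" where
  "fiber_limit_set Y T \<omega> = fiber_point Y T ` {\<tau>\<in>E2. tail \<tau> 0 = \<omega>}"

definition closed_nbhd :: "'a::metric_space set \<Rightarrow> real \<Rightarrow> 'a set" where
  "closed_nbhd A r = {y. infdist y A \<le> r}"

definition cond_a :: "((nat \<Rightarrow> nat) \<Rightarrow> 'a::euclidean_space set) \<Rightarrow> bool" where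
  "cond_a Y \<longleftrightarrow>
    (\<forall>\<omega>\<in>E2p. closed (Y \<omega>) \<and> bounded (Y \<omega>) \<and> closure (interior (Y \<omega>)) = Y \<omega>)"

definition cond_b ::
    "((nat \<Rightarrow> nat) \<Rightarrow> 'a::euclidean_space set) \<Rightarrow> ((nat \<Rightarrow> nat) \<Rightarrow> 'a set) \<Rightarrow>
     ((nat \<Rightarrow> nat) \<Rightarrow> 'a \<Rightarrow> 'a) \<Rightarrow> bool" where
  "cond_b Y Ys T \<longleftrightarrow>
    (\<forall>\<omega>\<in>E2p. bounded (Ys \<omega>) \<and> connected (Ys \<omega>) \<and> open (Ys \<omega>) \<and> Y \<omega> \<subseteq> Ys \<omega> \<and>
       C1_conformal_embedding (T \<omega>) (Ys \<omega>) (Ys (shiftp \<omega>)))"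

definition cond_c ::
    "((nat \<Rightarrow> nat) \<Rightarrow> 'a::euclidean_space set) \<Rightarrow> ((nat \<Rightarrow> nat) \<Rightarrow> 'a \<Rightarrow> 'a) \<Rightarrow> bool" where
  "cond_c Ys T \<longleftrightarrow>
    (\<exists>l>1. \<forall>\<omega>\<in>E2p. \<forall>y\<in>Ys \<omega>. \<forall>z\<in>Ys \<omega>. norm (T \<omega> y - T \<omega> z) \<le> inverse l * norm (y - z))"

definition cond_d ::
    "((nat \<Rightarrow> nat) \<Rightarrow> 'a::euclidean_space set) \<Rightarrow> ((nat \<Rightarrow> nat) \<Rightarrow> 'a \<Rightarrow> 'a) \<Rightarrow> bool" where
  "cond_d Ys T \<longleftrightarrow>
    (\<exists>a>0. \<exists>H>0. \<forall>\<omega>\<in>E2p. \<forall>y\<in>Ys \<omega>. \<forall>z\<in>Ys \<omega>.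
       \<bar>ln (deriv_norm (T \<omega>) y) - ln (deriv_norm (T \<omega>) z)\<bar> \<le> H * norm (y - z) powr a)"

definition cond_e ::
    "((nat \<Rightarrow> nat) \<Rightarrow> 'a::euclidean_space set) \<Rightarrow> ((nat \<Rightarrow> nat) \<Rightarrow> 'a \<Rightarrow> 'a) \<Rightarrow> bool" where
  "cond_e Y T \<longleftrightarrow> hoelder_E2 (\<lambda>\<tau>. ln (deriv_norm (T (tail \<tau> 0)) (fiber_point Y T \<tau>)))"

definition cond_f ::
    "((nat \<Rightarrow> nat) \<Rightarrow> 'a::euclidean_space set) \<Rightarrow> ((nat \<Rightarrow> nat) \<Rightarrow> 'a \<Rightarrow> 'a) \<Rightarrow> bool" where
  "cond_f Y T \<longleftrightarrow>
    (\<forall>\<omega>\<in>E2p. \<forall>a\<in>{0, 1}. \<forall>b\<in>{0, 1}.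
       a \<noteq> b \<and> case_nat a \<omega> \<in> E2p \<and> case_nat b \<omega> \<in> E2p \<longrightarrow>
       T (case_nat a \<omega>) ` interior (Y (case_nat a \<omega>)) \<inter>
       T (case_nat b \<omega>) ` interior (Y (case_nat b \<omega>)) = {})"

definition cond_g ::
    "((nat \<Rightarrow> nat) \<Rightarrow> 'a::euclidean_space set) \<Rightarrow> ((nat \<Rightarrow> nat) \<Rightarrow> 'a \<Rightarrow> 'a) \<Rightarrow> bool" where
  "cond_g Y T \<longleftrightarrow>
    (\<exists>\<delta>\<in>borel_measurable borel_E2p. \<forall>\<omega>\<in>E2p.
       \<delta> \<omega> > 0 \<and> fiber_limit_set Y T \<omega> \<inter> (Y \<omega> - closed_nbhd (- Y \<omega>) (\<delta> \<omega>)) \<noteq> {})"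


section \<open>Projection to the skew product, conditional measures, dimension\<close>

definition skew_coding ::
    "((nat \<Rightarrow> nat) \<Rightarrow> 'a::euclidean_space set) \<Rightarrow> ((nat \<Rightarrow> nat) \<Rightarrow> 'a \<Rightarrow> 'a) \<Rightarrow>
     (int \<Rightarrow> nat) \<Rightarrow> real \<times> 'a" where
  "skew_coding Y T \<tau> = (coding (tail \<tau> 0), fiber_point Y T \<tau>)"

text \<open>\<open>K x\<close> is the conditional measure on the fiber over \<open>x\<close>, identified with a measure on the
  second factor.\<close>

definition fiber_conditionals ::
    "(real \<times> 'a::euclidean_space) measure \<Rightarrow> (real \<Rightarrow> 'a measure) \<Rightarrow> bool" where
  "fiber_conditionals \<mu> K \<longleftrightarrow>
    K \<in> measurable borel (prob_algebra borel) \<and>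
    (\<forall>A\<in>sets borel.
       emeasure \<mu> A = (\<integral>\<^sup>+ x. emeasure (K x) (Pair x -` A) \<partial>(distr \<mu> borel fst)))"

definition exact_dimensional :: "'a::euclidean_space measure \<Rightarrow> bool" where
  "exact_dimensional \<mu> \<longleftrightarrow>
    (\<exists>D. AE y in \<mu>. ((\<lambda>r. ln (measure \<mu> (ball y r)) / ln r) \<longlongrightarrow> D) (at_right 0))"

end

theory Submission
  imports Defs
begin

text \<open>
Write \<open>\<sigma>\<close> for the shift of two-sided sequences. A sequence \<open>\<tau>\<close> has a future, which is the base
point \<open>x\<close> in digits, and a past, which selects a point \<open>fp \<tau>\<close> of the fiber: the images of
\<open>Z = closure Y\<close> under the compositions of the fiber maps along \<open>\<tau>\<^sub>-\<^sub>n, \<dots>, \<tau>\<^sub>-\<^sub>1\<close> are nested and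
shrink to \<open>fp \<tau>\<close>. The conditional measure over \<open>x\<close> is the law of \<open>fp \<tau>\<close> given the future, and
its local dimension at \<open>fp \<tau>\<close> is found by comparing the mass of the \<open>n\<close>-th of these pieces
with its size.

Mass. By the Gibbs inequalities the measure is quasi-Bernoulli: independent up to a constant factor
across any cut of an admissible sequence (\<open>quasi_bernoulli_upper\<close>, \<open>quasi_bernoulli_lower\<close>). Hence,
given the future, the past word \<open>\<tau>\<^sub>-\<^sub>n \<dots> \<tau>\<^sub>-\<^sub>1\<close> has conditional probability comparable to its
unconditional probability \<open>p\<^sub>n\<close> (\<open>cyl_future_upper\<close>, \<open>cyl_future_lower\<close>). To speak of the
conditional measures over \<open>x\<close> instead of those over the future, one decodes \<open>x\<close> by its greedy
expansion, which recovers the future almost surely (\<open>AE_greedy_digits\<close>).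

Size. Let \<open>s\<^sub>n\<close> be the scaling factor of the \<open>n\<close>-fold composition at the point \<open>fp (\<sigma>\<^sup>-\<^sup>n \<tau>)\<close> that
it sends to \<open>fp \<tau>\<close>; bounded distortion makes it comparable to the scaling factor everywhere on \<open>Z\<close>.
The set \<open>Z\<close> may be disconnected and have an irregular boundary, so \<open>s\<^sub>n\<close> controls the piece only at
good times \<open>n\<close>, when \<open>fp (\<sigma>\<^sup>-\<^sup>n \<tau>)\<close> has distance at least \<open>\<delta>\<close> from the complement of \<open>Z\<close>.
At such a time a ball about \<open>fp \<tau>\<close> of radius comparable to \<open>s\<^sub>n\<close> lies in the image of the
interior of \<open>Z\<close>, and by the open set condition no other past reaches that image
(\<open>fp_in_open_image_agree\<close>), so the ball has mass at most a constant times \<open>p\<^sub>n\<close> (\<open>mass_upper\<close>).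
Conversely a ball of radius comparable to \<open>s\<^sub>n\<close> contains a piece of order \<open>n + k\<close> with fixed
\<open>k\<close>, so it has mass at least a constant times \<open>p\<^sub>n\<^sub>+\<^sub>k\<close> (\<open>mass_lower\<close>).

Statistics. Quasi-independence across a gap gives ergodicity (\<open>invariant_0_1\<close>), and Birkhoff's
theorem shows that \<open>- ln p\<^sub>n / n\<close> and \<open>- ln s\<^sub>n / n\<close> converge to constants \<open>h \<ge> 0\<close> and
\<open>\<gamma> > 0\<close>. Condition (g) makes the good event have positive probability for some \<open>\<delta>\<close>
(\<open>deep_positive\<close>), so good times have positive density and the ratios of consecutive good times
tend to \<open>1\<close>. Interpolating between them shows that the local dimension is \<open>h / \<gamma>\<close> almost everywhere
(\<open>exponential_scaling_limit\<close>).
\<close>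

section \<open>Birkhoff's theorem for bounded functions\<close>

locale ergodic_system = prob_space M for M :: "'b measure" +
  fixes S :: "'b \<Rightarrow> 'b"
  assumes S_measurable[measurable]: "S \<in> measurable M M"
    and S_preserves: "distr M M S = M"
    and S_ergodic: "\<And>A. A \<in> sets M \<Longrightarrow> S -` A \<inter> space M = A \<Longrightarrow> prob A = 0 \<or> prob A = 1"
begin

definition birkhoff_sum :: "('b \<Rightarrow> real) \<Rightarrow> nat \<Rightarrow> 'b \<Rightarrow> real" where
  "birkhoff_sum f n x = (\<Sum>k<n. f ((S ^^ k) x))"

lemma birkhoff_sum_Suc: "birkhoff_sum f (Suc n) x = f x + birkhoff_sum f n (S x)"
  unfolding birkhoff_sum_def by (subst sum.lessThan_Suc_shift) (simp add: funpow_swap1)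

lemma funpow_measurable[measurable]: "S ^^ k \<in> measurable M M"
  by (induction k) auto

lemma birkhoff_sum_measurable[measurable]:
  assumes [measurable]: "f \<in> borel_measurable M"
  shows "birkhoff_sum f n \<in> borel_measurable M"
  unfolding birkhoff_sum_def[abs_def] by measurable

lemma integral_comp_S:
  assumes [measurable]: "f \<in> borel_measurable M"
  shows "(\<integral>x. f (S x) \<partial>M) = (\<integral>x. f x \<partial>M :: real)"
  using integral_distr[of S M M f] S_preserves by simp

text \<open>Garsia's maximal sums: \<open>maxsum f n\<close> is the largest of the Birkhoff sums of orders \<open>0, \<dots>, n\<close>,
written so that its recursion along the orbit is visible.\<close>

primrec maxsum :: "('b \<Rightarrow> real) \<Rightarrow> nat \<Rightarrow> 'b \<Rightarrow> real" where
  "maxsum f 0 x = 0"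
| "maxsum f (Suc n) x = max 0 (f x + maxsum f n (S x))"

lemma maxsum_measurable[measurable]:
  assumes [measurable]: "f \<in> borel_measurable M"
  shows "maxsum f n \<in> borel_measurable M"
proof (induction n)
  case (Suc n)
  have [measurable]: "maxsum f n \<in> borel_measurable M" by fact
  show ?case by simp
qed simp

lemma maxsum_nonneg: "0 \<le> maxsum f n x"
  by (cases n) auto

lemma maxsum_mono: "maxsum f n x \<le> maxsum f (Suc n) x"
proof (induction n arbitrary: x)
  case 0 then show ?case by simp
next
  case (Suc n)
  have "f x + maxsum f n (S x) \<le> f x + maxsum f (Suc n) (S x)" using Suc by simp
  then show ?case by (simp only: maxsum.simps(2)[of f _ x])
qed

lemma maxsum_bound:
  assumes "\<And>x. \<bar>f x\<bar> \<le> B"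
  shows "maxsum f n x \<le> n * B"
proof (induction n arbitrary: x)
  case 0 then show ?case by simp
next
  case (Suc n)
  have "f x \<le> B" "0 \<le> B" using assms[of x] by linarith+
  then have "0 \<le> real n * B" by simp
  with Suc[of "S x"] \<open>f x \<le> B\<close> \<open>0 \<le> B\<close> show ?case by (simp add: algebra_simps)
qed

lemma birkhoff_sum_le_maxsum: "birkhoff_sum f n x \<le> maxsum f n x"
proof (induction n arbitrary: x)
  case 0 then show ?case by (simp add: birkhoff_sum_def)
next
  case (Suc n)
  show ?case using Suc[of "S x"] by (simp add: birkhoff_sum_Suc le_max_iff_disj)
qed

text \<open>Where the maximal sum is positive, the term \<open>0\<close> is not the maximal one, so \<open>f\<close> dominates the
coboundary \<open>maxsum f n - maxsum f n \<circ> S\<close>; elsewhere the coboundary is nonpositive. A coboundary has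
integral \<open>0\<close>.\<close>

lemma maximal_ergodic_finite:
  assumes [measurable]: "f \<in> borel_measurable M" and B: "\<And>x. \<bar>f x\<bar> \<le> B"
  shows "0 \<le> (\<integral>x. f x * indicator {x. maxsum f n x > 0} x \<partial>M)"
proof (cases n)
  case 0 then show ?thesis by simp
next
  case (Suc m)
  have B0: "0 \<le> B" using B[of undefined] by linarith
  have int_f: "integrable M (\<lambda>x. f x * indicator {x. maxsum f n x > 0} x)"
    by (rule integrable_const_bound[of _ B]) (use B B0 in \<open>auto split: split_indicator\<close>)
  have int_m: "integrable M (maxsum f k)" for k
    by (rule integrable_const_bound[of _ "k * B"])
       (use maxsum_bound[of f B, OF B] maxsum_nonneg in \<open>auto simp: abs_of_nonneg\<close>)
  have int_S: "integrable M (\<lambda>x. maxsum f n (S x))"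
    by (rule integrable_const_bound[of _ "n * B"])
       (use maxsum_bound[of f B, OF B] maxsum_nonneg in \<open>auto simp: abs_of_nonneg\<close>)
  have le: "maxsum f n x - maxsum f n (S x) \<le> f x * indicator {x. maxsum f n x > 0} x" for x
  proof (cases "maxsum f n x > 0")
    case True
    then have "maxsum f n x = f x + maxsum f m (S x)" using Suc by auto
    also have "\<dots> \<le> f x + maxsum f n (S x)" using maxsum_mono[of f m "S x"] Suc by simp
    finally show ?thesis using True by simp
  next
    case False
    then have "maxsum f n x = 0" using maxsum_nonneg[of f n x] by simp
    then show ?thesis using False maxsum_nonneg[of f n "S x"] by simp
  qed
  have "0 = (\<integral>x. maxsum f n x - maxsum f n (S x) \<partial>M)"
    using int_m int_S integral_comp_S[of "maxsum f n"] by simp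
  also have "\<dots> \<le> (\<integral>x. f x * indicator {x. maxsum f n x > 0} x \<partial>M)"
    by (rule integral_mono) (use int_f int_S int_m le in auto)
  finally show ?thesis .
qed

text \<open>The points whose Birkhoff sums are unbounded above form an exactly invariant set. If it had full
measure, the maximal inequality would make the integral nonnegative in the limit. Working with
unbounded sums rather than with a limit superior of averages avoids all division.\<close>

lemma birkhoff_upper:
  assumes [measurable]: "f \<in> borel_measurable M" and B: "\<And>x. \<bar>f x\<bar> \<le> B"
    and neg: "(\<integral>x. f x \<partial>M) < 0"
  shows "AE x in M. \<exists>K. \<forall>n. birkhoff_sum f n x \<le> K"
proof -
  have B0: "0 \<le> B" using B[of undefined] by linarith
  define A where "A = {x\<in>space M. \<forall>j::nat. \<exists>n. birkhoff_sum f n x > real j}"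
  have A[measurable]: "A \<in> sets M" unfolding A_def by measurable
  have step: "x \<in> A \<longleftrightarrow> S x \<in> A" if x: "x \<in> space M" for x
  proof
    assume a: "x \<in> A"
    show "S x \<in> A" unfolding A_def
    proof (intro CollectI conjI allI)
      show "S x \<in> space M" using S_measurable x by (rule measurable_space)
      fix j :: nat
      obtain j' :: nat where j': "real j + B < real j'" using reals_Archimedean2 by blast
      obtain n where n: "birkhoff_sum f n x > real j'" using a unfolding A_def by blast
      then obtain m where m: "n = Suc m" using B0 j' by (cases n) (auto simp: birkhoff_sum_def)
      show "\<exists>n. birkhoff_sum f n (S x) > real j"
        using n j' B[of x] unfolding m birkhoff_sum_Suc by (intro exI[of _ m]) linarith
    qed
  next
    assume a: "S x \<in> A"
    show "x \<in> A" unfolding A_def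
    proof (intro CollectI conjI allI x)
      fix j :: nat
      obtain j' :: nat where j': "real j + B < real j'" using reals_Archimedean2 by blast
      obtain n where n: "birkhoff_sum f n (S x) > real j'" using a unfolding A_def by blast
      show "\<exists>n. birkhoff_sum f n x > real j"
        using n j' B[of x] by (intro exI[of _ "Suc n"]) (auto simp: birkhoff_sum_Suc abs_le_iff)
    qed
  qed
  have "S -` A \<inter> space M = A"
    using step sets.sets_into_space[OF A] by auto
  from S_ergodic[OF A this] have "prob A = 0"
  proof
    assume 1: "prob A = 1"
    then have AE: "AE x in M. x \<in> A" using prob_eq_1[OF A] by simp
    have lim: "(\<lambda>n. \<integral>x. f x * indicator {x. maxsum f n x > 0} x \<partial>M) \<longlonglongrightarrow> (\<integral>x. f x \<partial>M)"
    proof (rule integral_dominated_convergence[where w = "\<lambda>_. B"])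
      show "AE x in M. (\<lambda>n. f x * indicator {x. maxsum f n x > 0} x) \<longlonglongrightarrow> f x"
        using AE
      proof eventually_elim
        case (elim x)
        then obtain n0 where "birkhoff_sum f n0 x > 0" unfolding A_def by (auto dest: spec[of _ 0])
        then have "maxsum f n0 x > 0" using birkhoff_sum_le_maxsum[of f n0 x] by linarith
        moreover have "maxsum f n0 x \<le> maxsum f n x" if "n0 \<le> n" for n
          using that lift_Suc_mono_le[of "\<lambda>n. maxsum f n x"] maxsum_mono by blast
        ultimately have "\<forall>n\<ge>n0. maxsum f n x > 0" by fastforce
        then have "\<forall>\<^sub>F n in sequentially. f x * indicator {x. maxsum f n x > 0} x = f x"
          unfolding eventually_sequentially by (intro exI[of _ n0]) simp
        then show ?case by (rule tendsto_eventually)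
      qed
    qed (use B B0 in \<open>auto split: split_indicator\<close>)
    have "0 \<le> (\<integral>x. f x \<partial>M)"
      by (rule LIMSEQ_le_const[OF lim]) (use maximal_ergodic_finite[of f B] B in auto)
    with neg show ?thesis by simp
  qed
  then have "AE x in M. x \<notin> A" using prob_eq_0[OF A] by simp
  then show ?thesis
  proof (rule AE_mp, intro AE_I2 impI)
    fix x assume "x \<in> space M" "x \<notin> A"
    then obtain j :: nat where "\<forall>n. birkhoff_sum f n x \<le> real j" unfolding A_def by (auto simp: not_less)
    then show "\<exists>K. \<forall>n. birkhoff_sum f n x \<le> K" by blast
  qed
qed

text \<open>\<open>birkhoff_upper\<close>, applied to \<open>f\<close> and \<open>- f\<close> recentred by the mean and lowered by \<open>1 / (j + 1)\<close>, bounds the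
deviation of the \<open>n\<close>-th sum by \<open>n / (j + 1)\<close> plus a constant.\<close>

theorem birkhoff_bounded:
  assumes [measurable]: "f \<in> borel_measurable M" and B: "\<And>x. \<bar>f x\<bar> \<le> B"
  shows "AE x in M. (\<lambda>n. birkhoff_sum f n x / n) \<longlonglongrightarrow> (\<integral>x. f x \<partial>M)"
proof -
  define I where "I = (\<integral>x. f x \<partial>M)"
  have B0: "0 \<le> B" using B[of undefined] by linarith
  have int: "integrable M f"
    by (rule integrable_const_bound[of _ B]) (use B in auto)
  have one_sided: "AE x in M. \<forall>j::nat. \<exists>K. \<forall>n. s * (birkhoff_sum f n x - n * I) \<le> n * (1 / Suc j) + K"
    if s: "s = 1 \<or> s = -1" for s :: real
  proof (subst AE_all_countable, intro allI)
    fix j :: nat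
    let ?g = "\<lambda>x. s * (f x - I) - 1 / Suc j"
    have "AE x in M. \<exists>K. \<forall>n. birkhoff_sum ?g n x \<le> K"
    proof (rule birkhoff_upper[where B = "B + \<bar>I\<bar> + 1"])
      show "\<bar>?g x\<bar> \<le> B + \<bar>I\<bar> + 1" for x
      proof -
        have "\<bar>1 / real (Suc j)\<bar> \<le> 1" by simp
        then show ?thesis using B[of x] s unfolding abs_le_iff by (elim disjE) (simp only: mult_1_left mult_minus1, linarith)+
      qed
      have "(\<integral>x. ?g x \<partial>M) = s * (I - I) - 1 / Suc j"
        using int unfolding I_def by (simp add: prob_space)
      then show "(\<integral>x. ?g x \<partial>M) < 0" by simp
    qed measurable
    moreover have "birkhoff_sum ?g n x = s * (birkhoff_sum f n x - n * I) - n * (1 / Suc j)" for n x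
      by (simp add: birkhoff_sum_def sum_subtractf flip: sum_distrib_left)
    ultimately have "AE x in M. \<exists>K. \<forall>n. s * (birkhoff_sum f n x - n * I) - n * (1 / Suc j) \<le> K"
      by simp
    then show "AE x in M. \<exists>K. \<forall>n. s * (birkhoff_sum f n x - n * I) \<le> n * (1 / Suc j) + K"
      by (simp only: diff_le_eq add.commute)
  qed
  show ?thesis using one_sided[of 1, simplified] one_sided[of "-1", simplified]
  proof eventually_elim
    case (elim x)
    show ?case unfolding I_def[symmetric]
    proof (rule LIMSEQ_I)
      fix r :: real assume r: "0 < r"
      obtain j :: nat where j: "2 / r < Suc j" using reals_Archimedean2 less_Suc_eq
        by (metis of_nat_Suc add.commute less_add_one order.strict_trans)
      have jr: "1 / Suc j < r / 2" using j r by (simp add: field_simps)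
      obtain K1 K2 where K1: "\<And>n. birkhoff_sum f n x - n * I \<le> n * (1 / Suc j) + K1"
        and K2: "\<And>n. n * I - birkhoff_sum f n x \<le> n * (1 / Suc j) + K2"
        using elim by (simp) metis
      define K where "K = max K1 K2"
      obtain N :: nat where N: "2 * K / r < N" using reals_Archimedean2 by blast
      show "\<exists>no. \<forall>n\<ge>no. norm (birkhoff_sum f n x / n - I) < r"
      proof (intro exI[of _ "Suc N"] allI impI)
        fix n assume n: "Suc N \<le> n"
        then have n0: "0 < real n" by simp
        have "K < r / 2 * real N" using N r by (simp add: field_simps)
        also have "\<dots> \<le> r / 2 * real n" using n r by simp
        finally have k: "K < r / 2 * n" .
        have a: "\<bar>birkhoff_sum f n x - n * I\<bar> \<le> n * (1 / Suc j) + K"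
          using K1[of n] K2[of n] unfolding K_def by linarith
        have "n * (1 / Suc j) \<le> n * (r / 2)" using jr n0 by (intro mult_left_mono) auto
        moreover have "n * (r / 2) + r / 2 * n = r * n" by (simp add: field_simps)
        ultimately have "\<bar>birkhoff_sum f n x - n * I\<bar> < r * n" using a k by linarith
        moreover have "birkhoff_sum f n x / n - I = (birkhoff_sum f n x - n * I) / n" using n0 by (simp add: field_simps)
        ultimately show "norm (birkhoff_sum f n x / n - I) < r" using n0 by (simp add: field_simps abs_divide)
      qed
    qed
  qed
qed

end

section \<open>Approximation by sets that depend on finitely many coordinates\<close>

text \<open>The clopen cylinder algebra when there are finitely many digits. With infinitely many digits, a
finitary set is a countable union of agreement sets, which is enough below.\<close>

definition finitary :: "('i \<Rightarrow> nat) set \<Rightarrow> bool" where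
  "finitary D \<longleftrightarrow> (\<exists>I. finite I \<and> (\<forall>\<omega> \<tau>. (\<forall>i\<in>I. \<omega> i = \<tau> i) \<longrightarrow> (\<omega> \<in> D \<longleftrightarrow> \<tau> \<in> D)))"

lemma finitary_Compl: "finitary D \<Longrightarrow> finitary (- D)"
  unfolding finitary_def by simp

lemma finitary_Un: assumes "finitary D" "finitary E" shows "finitary (D \<union> E)"
proof -
  obtain I where I: "finite I" "\<And>\<omega> \<tau>. (\<forall>i\<in>I. \<omega> i = \<tau> i) \<Longrightarrow> \<omega> \<in> D \<longleftrightarrow> \<tau> \<in> D"
    using assms(1) unfolding finitary_def by blast
  obtain J where J: "finite J" "\<And>\<omega> \<tau>. (\<forall>i\<in>J. \<omega> i = \<tau> i) \<Longrightarrow> \<omega> \<in> E \<longleftrightarrow> \<tau> \<in> E"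
    using assms(2) unfolding finitary_def by blast
  show ?thesis unfolding finitary_def
  proof (intro exI[of _ "I \<union> J"] conjI allI impI)
    show "finite (I \<union> J)" using I(1) J(1) by simp
    fix \<omega> \<tau> :: "'a \<Rightarrow> nat" assume a: "\<forall>i\<in>I \<union> J. \<omega> i = \<tau> i"
    show "\<omega> \<in> D \<union> E \<longleftrightarrow> \<tau> \<in> D \<union> E" using I(2)[of \<omega> \<tau>] J(2)[of \<omega> \<tau>] a by simp
  qed
qed

lemma finitary_UN:
  assumes "finite X" "\<And>x. x \<in> X \<Longrightarrow> finitary (D x)"
  shows "finitary (\<Union>x\<in>X. D x)"
  using assms
proof (induction X)
  case empty
  then show ?case by (auto simp: finitary_def)
qed (simp add: finitary_Un)

definition agree_set :: "'i set \<Rightarrow> ('i \<Rightarrow> nat) \<Rightarrow> ('i \<Rightarrow> nat) set" where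
  "agree_set I \<tau> = {\<omega>. \<forall>i\<in>I. \<omega> i = \<tau> i}"

lemma coordinate_measurable[measurable]: "(\<lambda>\<omega>::'i::countable \<Rightarrow> nat. \<omega> i) \<in> borel_measurable borel"
  by (rule borel_measurable_continuous_onI) simp

lemma coordinate_count_space[measurable]:
  "(\<lambda>\<omega>::'i::countable \<Rightarrow> nat. \<omega> i) \<in> measurable borel (count_space UNIV)"
  using coordinate_measurable[of i] measurable_cong_sets[OF refl sets_borel_eq_count_space] by blast

lemma agree_set_measurable[measurable]:
  fixes \<tau> :: "'i::countable \<Rightarrow> nat"
  shows "agree_set I \<tau> \<in> sets borel"
proof -
  have "{\<omega>\<in>space borel. \<forall>i. i \<in> I \<longrightarrow> \<omega> i = \<tau> i} \<in> sets borel" by measurable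
  then show ?thesis by (simp add: agree_set_def Ball_def)
qed

lemma finitary_eq_Union_agree:
  assumes "finite I" "\<And>\<omega> \<tau>. (\<forall>i\<in>I. \<omega> i = \<tau> i) \<Longrightarrow> \<omega> \<in> D \<longleftrightarrow> \<tau> \<in> D"
  shows "D = (\<Union>\<tau>\<in>{\<tau>\<in>D. \<forall>i. i \<notin> I \<longrightarrow> \<tau> i = 0}. agree_set I \<tau>)"
proof (rule set_eqI, rule iffI)
  fix \<omega> assume w: "\<omega> \<in> D"
  let ?t = "\<lambda>i. if i \<in> I then \<omega> i else 0"
  have "?t \<in> D" using assms(2)[of \<omega> ?t] w by simp
  then show "\<omega> \<in> (\<Union>\<tau>\<in>{\<tau>\<in>D. \<forall>i. i \<notin> I \<longrightarrow> \<tau> i = 0}. agree_set I \<tau>)"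
    by (intro UN_I[of ?t]) (auto simp: agree_set_def)
next
  fix \<omega> assume "\<omega> \<in> (\<Union>\<tau>\<in>{\<tau>\<in>D. \<forall>i. i \<notin> I \<longrightarrow> \<tau> i = 0}. agree_set I \<tau>)"
  then obtain \<tau> where "\<tau> \<in> D" "\<forall>i\<in>I. \<omega> i = \<tau> i" unfolding agree_set_def by blast
  then show "\<omega> \<in> D" using assms(2)[of \<omega> \<tau>] by simp
qed

lemma countable_finsupp:
  assumes "finite I"
  shows "countable {\<tau> :: 'i \<Rightarrow> nat. \<forall>i. i \<notin> I \<longrightarrow> \<tau> i = 0}"
proof -
  have "countable (PiE I (\<lambda>_. UNIV :: nat set))" by (rule countable_PiE) (use assms in auto)
  then have c: "countable ((\<lambda>f i. if i \<in> I then f i else 0) ` (PiE I (\<lambda>_. UNIV :: nat set)))" by simp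
  show ?thesis
  proof (rule countable_subset[OF subsetI c])
    fix \<tau> :: "'i \<Rightarrow> nat" assume "\<tau> \<in> {\<tau>. \<forall>i. i \<notin> I \<longrightarrow> \<tau> i = 0}"
    then show "\<tau> \<in> (\<lambda>f i. if i \<in> I then f i else 0) ` (PiE I (\<lambda>_. UNIV :: nat set))"
      by (intro image_eqI[of _ _ "restrict \<tau> I"]) (auto simp: fun_eq_iff)
  qed
qed

lemma finitary_measurable:
  assumes "finitary (D :: ('i::countable \<Rightarrow> nat) set)"
  shows "D \<in> sets borel"
proof -
  obtain I where I: "finite I" "\<And>\<omega> \<tau>. (\<forall>i\<in>I. \<omega> i = \<tau> i) \<Longrightarrow> \<omega> \<in> D \<longleftrightarrow> \<tau> \<in> D"
    using assms unfolding finitary_def by blast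
  have "countable {\<tau>\<in>D. \<forall>i. i \<notin> I \<longrightarrow> \<tau> i = 0}"
    by (rule countable_subset[OF _ countable_finsupp[OF I(1)]]) auto
  then have "(\<Union>\<tau>\<in>{\<tau>\<in>D. \<forall>i. i \<notin> I \<longrightarrow> \<tau> i = 0}. agree_set I \<tau>) \<in> sets borel"
    by (intro sets.countable_UN') auto
  with finitary_eq_Union_agree[OF I] show ?thesis by simp
qed

text \<open>The approximable sets form a sigma-algebra that contains the generators: for a countable union, cut
off the tail and spend half of the error there, the rest geometrically.\<close>

lemma approx_finitary:
  fixes M :: "('i::countable \<Rightarrow> nat) measure"
  assumes "finite_measure M" and sets_M: "sets M = sets borel" and "A \<in> sets borel" and "0 < e"
  shows "\<exists>D. finitary D \<and> measure M (sym_diff A D) < e"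
proof -
  interpret finite_measure M by fact
  note [measurable_cong] = sets_M
  have gen: "sets (borel :: ('i \<Rightarrow> nat) measure) =
      sigma_sets UNIV {{f. f i \<in> X} | i X. True}" (is "_ = sigma_sets UNIV ?G")
  proof -
    have "sets (borel :: ('i \<Rightarrow> nat) measure) = sets (Pi\<^sub>M UNIV (\<lambda>_. borel))"
      by (simp add: sets_PiM_equal_borel)
    also have "\<dots> = sigma_sets UNIV {{f\<in>\<Pi>\<^sub>E i\<in>UNIV. UNIV. f i \<in> X} | i X. i \<in> UNIV \<and> X \<in> sets (borel :: nat measure)}"
      by (subst sets_PiM_single) simp
    finally show ?thesis by (simp add: sets_borel_eq_count_space)
  qed
  have "A \<in> sigma_sets UNIV ?G" using assms(3) gen by simp
  then have "\<forall>e>0. \<exists>D. finitary D \<and> measure M (sym_diff A D) < e"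
  proof induction
    case (Basic a)
    then obtain i X where "a = {f. f i \<in> X}" by blast
    then have "finitary a" unfolding finitary_def by (intro exI[of _ "{i}"]) auto
    then show ?case by (intro allI impI exI[of _ a]) auto
  next
    case Empty
    have "finitary ({} :: ('i \<Rightarrow> nat) set)" by (auto simp: finitary_def)
    then show ?case by (intro allI impI exI[of _ "{}"]) auto
  next
    case (Compl a)
    show ?case
    proof (intro allI impI)
      fix e :: real assume "0 < e"
      then obtain D where "finitary D" "measure M (sym_diff a D) < e" using Compl by blast
      moreover have "sym_diff (UNIV - a) (- D) = sym_diff a D" by auto
      ultimately show "\<exists>D. finitary D \<and> measure M (sym_diff (UNIV - a) D) < e"
        by (intro exI[of _ "- D"] conjI finitary_Compl) simp_all
    qed
  next
    case (Union a)
    have am[measurable]: "a n \<in> sets borel" for n using Union(1) gen by simp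
    show ?case
    proof (intro allI impI)
      fix e :: real assume e: "0 < e"
      have "\<forall>n. \<exists>D. finitary D \<and> measure M (sym_diff (a n) D) < e / 2 * (1/2)^Suc n"
      proof
        fix n
        have "0 < e / 2 * (1/2)^Suc n" using e by simp
        then show "\<exists>D. finitary D \<and> measure M (sym_diff (a n) D) < e / 2 * (1/2)^Suc n"
          using Union(2) by blast
      qed
      then obtain D where D: "\<And>n. finitary (D n)"
        "\<And>n. measure M (sym_diff (a n) (D n)) < e / 2 * (1/2)^Suc n" by metis
      have Dm[measurable]: "D n \<in> sets borel" for n using finitary_measurable[OF D(1)] .
      define U where "U N = (\<Union>n<N. a n)" for N :: nat
      have Um[measurable]: "U N \<in> sets borel" for N unfolding U_def by measurable
      have "(\<lambda>N. measure M (U N)) \<longlonglongrightarrow> measure M (\<Union>N. U N)"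
      proof (rule finite_Lim_measure_incseq)
        show "incseq U" unfolding incseq_def U_def by (intro allI impI UN_mono) auto
      qed auto
      moreover have "(\<Union>N. U N) = (\<Union>n. a n)" unfolding U_def by auto
      ultimately have "(\<lambda>N. measure M (U N)) \<longlonglongrightarrow> measure M (\<Union>n. a n)" by simp
      from LIMSEQ_D[OF this, of "e/2"] e obtain N where
        N: "\<bar>measure M (U N) - measure M (\<Union>n. a n)\<bar> < e / 2" by auto
      have "measure M ((\<Union>n. a n) - U N) = measure M (\<Union>n. a n) - measure M (U N)"
        by (rule finite_measure_Diff) (auto simp: U_def)
      with N have N': "measure M ((\<Union>n. a n) - U N) < e / 2" by linarith
      have s: "(\<Sum>n<N. e / 2 * (1/2)^Suc n) \<le> e / 2"
      proof -
        have "(\<Sum>n<N. (1/2::real)^Suc n) = 1 - (1/2)^N" by (induction N) auto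
        then show ?thesis using e unfolding sum_distrib_left[symmetric] by simp
      qed
      have "measure M (\<Union>n<N. sym_diff (a n) (D n)) \<le> (\<Sum>n<N. measure M (sym_diff (a n) (D n)))"
        by (rule finite_measure_subadditive_finite) auto
      also have "\<dots> \<le> (\<Sum>n<N. e / 2 * (1/2)^Suc n)" by (intro sum_mono less_imp_le D(2))
      finally have b: "measure M (\<Union>n<N. sym_diff (a n) (D n)) \<le> e / 2" using s by linarith
      have "measure M (sym_diff (\<Union>n. a n) (\<Union>n<N. D n))
          \<le> measure M (((\<Union>n. a n) - U N) \<union> (\<Union>n<N. sym_diff (a n) (D n)))"
        by (rule finite_measure_mono) (auto simp: U_def)
      also have "\<dots> \<le> measure M ((\<Union>n. a n) - U N) + measure M (\<Union>n<N. sym_diff (a n) (D n))"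
        by (rule measure_Un_le) auto
      also have "\<dots> < e" using b N' by linarith
      finally have "measure M (sym_diff (\<Union>n. a n) (\<Union>n<N. D n)) < e" .
      moreover have "finitary (\<Union>n<N. D n)" by (rule finitary_UN) (use D in auto)
      ultimately show "\<exists>E. finitary E \<and> measure M (sym_diff (\<Union>n. a n) E) < e" by blast
    qed
  qed
  then show ?thesis using assms(4) by blast
qed

lemma measure_le_of_agree_le_finitary:
  fixes M N :: "('i::countable \<Rightarrow> nat) measure"
  assumes "finite_measure M" "finite_measure N"
    and sM: "sets M = sets borel" and sN: "sets N = sets borel"
    and I: "finite I" "\<And>\<tau>. measure M (agree_set I \<tau>) \<le> c * measure N (agree_set I \<tau>)"
    and D: "\<And>\<omega> \<tau>. (\<forall>i\<in>I. \<omega> i = \<tau> i) \<Longrightarrow> \<omega> \<in> D \<longleftrightarrow> \<tau> \<in> D" and c0: "0 \<le> c"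
  shows "measure M D \<le> c * measure N D"
proof -
  interpret M: finite_measure M by fact
  interpret N: finite_measure N by fact
  note [measurable_cong] = sM sN
  let ?X = "{\<tau>\<in>D. \<forall>i. i \<notin> I \<longrightarrow> \<tau> i = 0}"
  have eq: "D = (\<Union>\<tau>\<in>?X. agree_set I \<tau>)"
    by (rule finitary_eq_Union_agree[OF I(1) D])
  have c: "countable ?X"
    by (rule countable_subset[OF _ countable_finsupp[OF I(1)]]) auto
  have d: "disjoint_family_on (agree_set I) ?X"
  proof (unfold disjoint_family_on_def, intro ballI impI)
    fix a b assume ab: "a \<in> ?X" "b \<in> ?X" "a \<noteq> b"
    then obtain i where "a i \<noteq> b i" by blast
    moreover from this ab have "i \<in> I" by (cases "i \<in> I") auto
    ultimately show "agree_set I a \<inter> agree_set I b = {}" unfolding agree_set_def by auto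
  qed
  have "emeasure M D = (\<integral>\<^sup>+\<tau>. emeasure M (agree_set I \<tau>) \<partial>count_space ?X)"
    by (subst eq, rule emeasure_UN_countable[OF _ c d]) (simp add: sM)
  also have "\<dots> \<le> (\<integral>\<^sup>+\<tau>. ennreal c * emeasure N (agree_set I \<tau>) \<partial>count_space ?X)"
    by (intro nn_integral_mono)
       (simp add: M.emeasure_eq_measure N.emeasure_eq_measure I(2) c0 flip: ennreal_mult)
  also have "\<dots> = ennreal c * (\<integral>\<^sup>+\<tau>. emeasure N (agree_set I \<tau>) \<partial>count_space ?X)"
    by (rule nn_integral_cmult) simp
  also have "(\<integral>\<^sup>+\<tau>. emeasure N (agree_set I \<tau>) \<partial>count_space ?X) = emeasure N D"
    by (subst (2) eq, rule emeasure_UN_countable[OF _ c d, symmetric]) (simp add: sN)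
  finally show ?thesis
    by (simp add: M.emeasure_eq_measure N.emeasure_eq_measure c0 flip: ennreal_mult)
qed

text \<open>Comparison of two measures on agreement sets passes to all Borel sets by approximation. One
finitary set has to serve both measures, hence the use of their sum.\<close>

lemma measure_le_of_agree_le:
  fixes M N :: "('i::countable \<Rightarrow> nat) measure"
  assumes "finite_measure M" "finite_measure N"
    and sM: "sets M = sets borel" and sN: "sets N = sets borel"
    and agree_le: "\<And>J. finite J \<Longrightarrow> \<exists>I. J \<subseteq> I \<and> finite I \<and> (\<forall>\<tau>. measure M (agree_set I \<tau>) \<le> c * measure N (agree_set I \<tau>))"
    and A: "A \<in> sets borel" and c0: "0 \<le> c"
  shows "measure M A \<le> c * measure N A"
proof -
  interpret M: finite_measure M by fact
  interpret N: finite_measure N by fact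
  note [measurable_cong] = sM sN
  have fin: "measure M D \<le> c * measure N D" if D: "finitary D" for D
  proof -
    obtain J where J: "finite J" "\<And>\<omega> \<tau>. (\<forall>i\<in>J. \<omega> i = \<tau> i) \<Longrightarrow> \<omega> \<in> D \<longleftrightarrow> \<tau> \<in> D"
      using D unfolding finitary_def by blast
    obtain I where I: "J \<subseteq> I" "finite I" "\<And>\<tau>. measure M (agree_set I \<tau>) \<le> c * measure N (agree_set I \<tau>)"
      using agree_le[OF J(1)] by blast
    show ?thesis
      by (rule measure_le_of_agree_le_finitary[OF assms(1,2) sM sN I(2,3) _ c0]) (use J(2) I(1) in blast)+
  qed
  show ?thesis
  proof (rule field_le_epsilon)
    fix e :: real assume e: "0 < e"
    (* the sum of the two measures: a set that is small for it is small for both *)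
    define P where "P = measure_of UNIV (sets borel) (\<lambda>X. emeasure M X + emeasure N X)"
    have P: "emeasure P X = emeasure M X + emeasure N X" if "X \<in> sets borel" for X
      unfolding P_def
    proof (rule emeasure_measure_of_sigma[OF _ _ _ that])
      show "sigma_algebra UNIV (sets (borel :: ('i \<Rightarrow> nat) measure))"
        using sets.sigma_algebra_axioms[of "borel :: ('i \<Rightarrow> nat) measure"] by simp
      show "positive (sets borel) (\<lambda>X. emeasure M X + emeasure N X)"
        by (simp add: positive_def)
      show "countably_additive (sets borel) (\<lambda>X. emeasure M X + emeasure N X)"
      proof (rule countably_additiveI)
        fix F :: "nat \<Rightarrow> _" assume "range F \<subseteq> sets (borel :: ('i \<Rightarrow> nat) measure)" "disjoint_family F"
        then show "(\<Sum>i. emeasure M (F i) + emeasure N (F i)) = emeasure M (\<Union>i. F i) + emeasure N (\<Union>i. F i)"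
          by (subst suminf_add[symmetric]) (auto simp: suminf_emeasure sM sN)
      qed
    qed
    have sP: "sets P = sets borel"
      using sets.sigma_sets_eq[of "borel :: ('i \<Rightarrow> nat) measure"] by (simp add: P_def)
    have spP: "space P = UNIV" using sets_eq_imp_space_eq[OF sP] by simp
    have "finite_measure P"
      by (rule finite_measureI) (simp add: P spP M.emeasure_eq_measure N.emeasure_eq_measure)
    from approx_finitary[OF this sP A, of "e / (1 + c)"] e c0 obtain D
      where D: "finitary D" "measure P (sym_diff A D) < e / (1 + c)" by auto
    have Dm[measurable]: "D \<in> sets borel" by (rule finitary_measurable[OF D(1)])
    note [measurable] = A
    have "measure P (sym_diff A D) = measure M (sym_diff A D) + measure N (sym_diff A D)"
      unfolding measure_def by (subst P) (auto simp: M.emeasure_eq_measure N.emeasure_eq_measure simp flip: ennreal_plus)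
    then have s: "measure M (sym_diff A D) \<le> e / (1 + c)" "measure N (sym_diff A D) \<le> e / (1 + c)"
      using D(2) measure_nonneg[of M "sym_diff A D"] measure_nonneg[of N "sym_diff A D"] by linarith+
    have "measure M A \<le> measure M (D \<union> sym_diff A D)" by (rule M.finite_measure_mono) auto
    also have "\<dots> \<le> measure M D + measure M (sym_diff A D)" by (rule measure_Un_le) auto
    finally have 1: "measure M A \<le> measure M D + measure M (sym_diff A D)" .
    have "measure N D \<le> measure N (A \<union> sym_diff A D)" by (rule N.finite_measure_mono) auto
    also have "\<dots> \<le> measure N A + measure N (sym_diff A D)" by (rule measure_Un_le) auto
    finally have 2: "measure N D \<le> measure N A + measure N (sym_diff A D)" .
    have "c * measure N D \<le> c * (measure N A + e / (1 + c))"
      by (rule mult_left_mono) (use 2 s c0 in auto)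
    with 1 s fin[OF D(1)]
    have "measure M A \<le> c * measure N A + (c * (e / (1 + c)) + e / (1 + c))"
      by (simp add: distrib_left)
    also have "c * (e / (1 + c)) + e / (1 + c) = (1 + c) * (e / (1 + c))" by (simp only: distrib_right mult_1_left add.commute)
    also have "\<dots> = e" using c0 by simp
    finally show "measure M A \<le> c * measure N A + e" .
  qed
qed

section \<open>Shifts, tails and cylinders of the golden mean shift\<close>

definition shift_by :: "int \<Rightarrow> (int \<Rightarrow> nat) \<Rightarrow> int \<Rightarrow> nat" where
  "shift_by a \<tau> = (\<lambda>n. \<tau> (n + a))"

lemma shift_by_apply[simp]: "shift_by a \<tau> n = \<tau> (n + a)"
  by (simp add: shift_by_def)

lemma shift_by_shift_by[simp]: "shift_by a (shift_by b \<tau>) = shift_by (a + b) \<tau>"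
  by (simp add: shift_by_def algebra_simps)

lemma shift_by_0[simp]: "shift_by 0 \<tau> = \<tau>"
  by (simp add: shift_by_def)

lemma shift_eq: "shift = shift_by 1"
  by (simp add: shift_def shift_by_def fun_eq_iff)

lemma funpow_shift_by: "(shift_by a ^^ k) \<tau> = shift_by (int k * a) \<tau>"
  by (induction k) (simp_all add: algebra_simps)

lemma shift_by_E2[simp]: "shift_by a \<tau> \<in> E2 \<longleftrightarrow> \<tau> \<in> E2"
proof -
  have "shift_by b \<rho> \<in> E2" if "\<rho> \<in> E2" for b \<rho>
    using that unfolding E2_def by (auto simp: algebra_simps)
  from this[of \<tau> a] this[of "shift_by a \<tau>" "-a"] show ?thesis by auto
qed

lemma tail_E2p: "\<tau> \<in> E2 \<Longrightarrow> tail \<tau> m \<in> E2p"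
  unfolding E2_def E2p_def tail_def by (auto simp: algebra_simps)

lemma tail_shift_by[simp]: "tail (shift_by a \<tau>) m = tail \<tau> (m + a)"
  by (simp add: tail_def fun_eq_iff algebra_simps)

lemma shift_by_measurable[measurable]: "shift_by a \<in> borel_measurable borel"
  unfolding shift_by_def by (rule measurable_coordinatewise_then_product) measurable

lemma tail_measurable[measurable]: "(\<lambda>\<tau>. tail \<tau> m) \<in> borel_measurable borel"
  unfolding tail_def by (rule measurable_coordinatewise_then_product) measurable

lemma E2_measurable[measurable]: "E2 \<in> sets borel"
proof -
  have "{\<tau>\<in>space borel. (\<forall>n::int. \<tau> n \<in> {0, 1::nat}) \<and> (\<forall>n. \<not> (\<tau> n = 1 \<and> \<tau> (n + 1) = 1))} \<in> sets borel"
    by measurable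
  then show ?thesis by (simp add: E2_def)
qed

lemma zero_E2: "(\<lambda>_. 0) \<in> E2"
  by (simp add: E2_def)

text \<open>Only the joint can create the forbidden word \<open>11\<close>.\<close>

lemma glue_E2:
  assumes "\<sigma> \<in> E2" "\<rho> \<in> E2" "\<not> (\<sigma> (b - 1) = 1 \<and> \<rho> b = 1)"
  shows "(\<lambda>k. if k < b then \<sigma> k else \<rho> k) \<in> E2"
  unfolding E2_def
proof (intro CollectI conjI allI)
  fix n
  show "(if n < b then \<sigma> n else \<rho> n) \<in> {0, 1}" using assms unfolding E2_def by auto
  have s: "\<not> (\<sigma> n = 1 \<and> \<sigma> (n + 1) = 1)" and r: "\<not> (\<rho> n = 1 \<and> \<rho> (n + 1) = 1)"
    using assms unfolding E2_def by blast+
  consider "n + 1 < b" | "n = b - 1" | "b \<le> n" by linarith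
  then show "\<not> ((if n < b then \<sigma> n else \<rho> n) = 1 \<and> (if n + 1 < b then \<sigma> (n + 1) else \<rho> (n + 1)) = 1)"
  proof cases
    case 1
    then have "n < b" by simp
    with 1 s show ?thesis by simp
  next
    case 2
    then show ?thesis using assms(3) by simp
  next
    case 3
    then show ?thesis using r by simp
  qed
qed

definition cyl :: "int \<Rightarrow> int \<Rightarrow> (int \<Rightarrow> nat) \<Rightarrow> (int \<Rightarrow> nat) set" where
  "cyl a b \<tau> = {\<omega>\<in>E2. \<forall>k. a \<le> k \<and> k < b \<longrightarrow> \<omega> k = \<tau> k}"

lemma cyl_eq_agree: "cyl a b \<tau> = E2 \<inter> agree_set {a..<b} \<tau>"
  by (auto simp: cyl_def agree_set_def)

lemma cyl_measurable[measurable]: "cyl a b \<tau> \<in> sets borel"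
  unfolding cyl_eq_agree by measurable

lemma cyl_cong: "(\<And>k. a \<le> k \<Longrightarrow> k < b \<Longrightarrow> \<sigma> k = \<tau> k) \<Longrightarrow> cyl a b \<sigma> = cyl a b \<tau>"
  by (auto simp: cyl_def)

lemma cyl_shift_by: "cyl (a + s) (b + s) \<tau> = shift_by s -` cyl a b (shift_by s \<tau>)"
proof -
  have "(\<forall>k. a + s \<le> k \<and> k < b + s \<longrightarrow> \<omega> k = \<tau> k) \<longleftrightarrow> (\<forall>k. a \<le> k \<and> k < b \<longrightarrow> \<omega> (k + s) = \<tau> (k + s))"
    for \<omega> :: "int \<Rightarrow> nat"
  proof (intro iffI allI impI)
    fix k assume *: "\<forall>k. a \<le> k \<and> k < b \<longrightarrow> \<omega> (k + s) = \<tau> (k + s)" "a + s \<le> k \<and> k < b + s"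
    then show "\<omega> k = \<tau> k" using *(1)[rule_format, of "k - s"] by auto
  qed auto
  then show ?thesis unfolding cyl_def by auto
qed

section \<open>Gibbs measures are quasi-Bernoulli\<close>

text \<open>It is convenient to let the measure live on all sequences and to ask that almost every sequence be
admissible.\<close>

locale gibbs_measure = prob_space M for M :: "(int \<Rightarrow> nat) measure" +
  fixes \<psi> :: "(int \<Rightarrow> nat) \<Rightarrow> real" and C P :: real
  assumes sets_M: "sets M = sets borel"
    and E2_full: "AE \<tau> in M. \<tau> \<in> E2"
    and shift_inv: "distr M M shift = M"
    and C_ge_1: "1 \<le> C"
    and gibbs: "\<And>\<tau> n. \<tau> \<in> E2 \<Longrightarrow> 1 \<le> n \<Longrightarrow>
      inverse C \<le> measure M (cyl 0 (int n) \<tau>) / exp ((\<Sum>k<n. \<psi> ((shift ^^ k) \<tau>)) - real n * P) \<and>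
      measure M (cyl 0 (int n) \<tau>) / exp ((\<Sum>k<n. \<psi> ((shift ^^ k) \<tau>)) - real n * P) \<le> C"
begin

declare sets_M[measurable_cong]

lemma space_M[simp]: "space M = UNIV"
  using sets_eq_imp_space_eq[OF sets_M] by simp

lemma measure_E2_Int: "A \<in> sets borel \<Longrightarrow> prob (E2 \<inter> A) = prob A"
  by (rule measure_eq_AE) (use E2_full in auto)

lemma distr_shift_by: "distr M M (shift_by a) = M"
proof -
  have nat: "distr M M (shift_by (int k)) = M" for k
  proof (induction k)
    case 0
    show ?case by (simp add: shift_by_def[abs_def] distr_id2)
  next
    case (Suc k)
    have "distr M M (shift_by (int (Suc k))) = distr M M (shift_by 1 \<circ> shift_by (int k))"
      by (simp add: comp_def)
    also have "\<dots> = distr (distr M M (shift_by (int k))) M (shift_by 1)"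
      by (subst distr_distr) measurable
    finally show ?case unfolding Suc.IH shift_inv[unfolded shift_eq] .
  qed
  show ?thesis
  proof (cases "0 \<le> a")
    case True then show ?thesis using nat[of "nat a"] by simp
  next
    case False
    have "distr M M (shift_by a) = distr (distr M M (shift_by (- a))) M (shift_by a)"
      using nat[of "nat (-a)"] False by simp
    also have "\<dots> = distr M M (shift_by a \<circ> shift_by (- a))"
      by (subst distr_distr) measurable
    also have "\<dots> = M" by (simp add: comp_def distr_id2)
    finally show ?thesis .
  qed
qed

lemma prob_shift_by: "A \<in> sets borel \<Longrightarrow> prob (shift_by a -` A) = prob A"
  using measure_distr[of "shift_by a" M M A] distr_shift_by[of a] by (simp add: sets_M)

text \<open>The value that the Gibbs property assigns to a cylinder, up to the factor \<open>C\<close>.\<close>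

definition weight :: "int \<Rightarrow> int \<Rightarrow> (int \<Rightarrow> nat) \<Rightarrow> real" where
  "weight a b \<tau> = exp ((\<Sum>k\<in>{a..<b}. \<psi> (shift_by k \<tau>)) - (b - a) * P)"

text \<open>Quasi-independence starts here: the weights of consecutive intervals multiply without any error.\<close>

lemma weight_concat:
  assumes "a \<le> b" "b \<le> c"
  shows "weight a c \<tau> = weight a b \<tau> * weight b c \<tau>"
proof -
  have "{a..<c} = {a..<b} \<union> {b..<c}" using assms by auto
  then have "(\<Sum>k\<in>{a..<c}. \<psi> (shift_by k \<tau>)) = (\<Sum>k\<in>{a..<b}. \<psi> (shift_by k \<tau>)) + (\<Sum>k\<in>{b..<c}. \<psi> (shift_by k \<tau>))"
    by (simp add: sum.union_disjoint)
  then show ?thesis unfolding weight_def by (simp add: algebra_simps flip: exp_add)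
qed

lemma weight_pos: "0 < weight a b \<tau>"
  by (simp add: weight_def)

lemma cyl_weight:
  assumes "\<tau> \<in> E2" "a < b"
  shows "weight a b \<tau> \<le> C * prob (cyl a b \<tau>)" "prob (cyl a b \<tau>) \<le> C * weight a b \<tau>"
proof -
  define n where "n = nat (b - a)"
  have n: "1 \<le> n" "int n = b - a" using assms(2) by (auto simp: n_def)
  have p: "prob (cyl a b \<tau>) = prob (cyl 0 (int n) (shift_by a \<tau>))"
    using cyl_shift_by[of 0 a "int n" \<tau>] prob_shift_by[of "cyl 0 (int n) (shift_by a \<tau>)" a] n(2) by simp
  have "(\<Sum>k<n. \<psi> ((shift ^^ k) (shift_by a \<tau>))) = (\<Sum>k\<in>{a..<b}. \<psi> (shift_by k \<tau>))"
    by (rule sum.reindex_bij_witness[of _ "\<lambda>k. nat (k - a)" "\<lambda>k. int k + a"])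
       (use n in \<open>auto simp: shift_eq funpow_shift_by\<close>)
  then have w: "exp ((\<Sum>k<n. \<psi> ((shift ^^ k) (shift_by a \<tau>))) - real n * P) = weight a b \<tau>"
    using n(2) unfolding weight_def by (metis of_int_diff of_int_of_nat_eq)
  from gibbs[of "shift_by a \<tau>" n] assms(1) n(1) have
    "inverse C \<le> prob (cyl a b \<tau>) / weight a b \<tau>" "prob (cyl a b \<tau>) / weight a b \<tau> \<le> C"
    unfolding p w by auto
  then show "weight a b \<tau> \<le> C * prob (cyl a b \<tau>)" "prob (cyl a b \<tau>) \<le> C * weight a b \<tau>"
    using C_ge_1 weight_pos[of a b \<tau>] by (auto simp: field_simps)
qed

lemma cyl_pos: "\<tau> \<in> E2 \<Longrightarrow> a < b \<Longrightarrow> 0 < prob (cyl a b \<tau>)"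
  using cyl_weight(1)[of \<tau> a b] weight_pos[of a b \<tau>] C_ge_1
  by (metis less_le_trans mult_zero_right zero_less_measure_iff)

lemma quasi_bernoulli_upper:
  assumes "\<tau> \<in> E2" "a < b" "b < c"
  shows "prob (cyl a c \<tau>) \<le> C^3 * (prob (cyl a b \<tau>) * prob (cyl b c \<tau>))"
proof -
  have "prob (cyl a c \<tau>) \<le> C * (weight a b \<tau> * weight b c \<tau>)"
    using cyl_weight(2)[of \<tau> a c] weight_concat[of a b c \<tau>] assms by simp
  also have "\<dots> \<le> C * ((C * prob (cyl a b \<tau>)) * (C * prob (cyl b c \<tau>)))"
    using C_ge_1 assms weight_pos by (intro mult_left_mono mult_mono cyl_weight less_imp_le[OF weight_pos]) auto
  finally show ?thesis by (simp add: power3_eq_cube algebra_simps)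
qed

lemma quasi_bernoulli_lower:
  assumes "\<tau> \<in> E2" "a < b" "b < c"
  shows "prob (cyl a b \<tau>) * prob (cyl b c \<tau>) \<le> C^3 * prob (cyl a c \<tau>)"
proof -
  have "prob (cyl a b \<tau>) * prob (cyl b c \<tau>) \<le> (C * weight a b \<tau>) * (C * weight b c \<tau>)"
    using C_ge_1 assms weight_pos by (intro mult_mono cyl_weight mult_nonneg_nonneg less_imp_le[OF weight_pos]) auto
  also have "\<dots> = C^2 * weight a c \<tau>"
    using weight_concat[of a b c \<tau>] assms by (simp add: power2_eq_square)
  also have "\<dots> \<le> C^2 * (C * prob (cyl a c \<tau>))"
    using C_ge_1 assms by (intro mult_left_mono cyl_weight) auto
  finally show ?thesis by (simp add: power3_eq_cube power2_eq_square algebra_simps)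
qed

definition tail_law :: "int \<Rightarrow> (int \<Rightarrow> nat) set \<Rightarrow> (nat \<Rightarrow> nat) measure" where
  "tail_law b X = distr (density M (indicator X)) borel (\<lambda>\<tau>. tail \<tau> b)"

lemma tail_law_properties:
  assumes [measurable]: "X \<in> sets borel"
  shows "finite_measure (tail_law b X)" "sets (tail_law b X) = sets borel"
    "\<And>B. B \<in> sets borel \<Longrightarrow> measure (tail_law b X) B = prob (X \<inter> {\<tau>. tail \<tau> b \<in> B})"
proof -
  let ?N = "tail_law b X"
  have e: "emeasure ?N B = emeasure M (X \<inter> {\<tau>. tail \<tau> b \<in> B})"
    if [measurable]: "B \<in> sets borel" for B
  proof -
    have "emeasure ?N B = emeasure (density M (indicator X)) {\<tau>. tail \<tau> b \<in> B}"
      unfolding tail_law_def by (subst emeasure_distr) (auto simp: vimage_def)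
    also have "\<dots> = (\<integral>\<^sup>+\<tau>. indicator X \<tau> * indicator {\<tau>. tail \<tau> b \<in> B} \<tau> \<partial>M)"
      by (rule emeasure_density) measurable
    also have "\<dots> = (\<integral>\<^sup>+\<tau>. indicator (X \<inter> {\<tau>. tail \<tau> b \<in> B}) \<tau> \<partial>M)"
      by (simp add: indicator_inter_arith)
    finally show ?thesis by (simp add: nn_integral_indicator)
  qed
  show "sets ?N = sets borel" by (simp add: tail_law_def)
  show "finite_measure ?N"
    by (rule finite_measureI) (use e[of UNIV] in \<open>simp add: tail_law_def emeasure_eq_measure\<close>)
  show "measure ?N B = prob (X \<inter> {\<tau>. tail \<tau> b \<in> B})" if "B \<in> sets borel" for B
    using e[of B] that by (simp add: measure_def)
qed

lemma agree_tail_eq_cyl: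
  "E2 \<inter> {\<omega>. tail \<omega> b \<in> agree_set {..<n} (tail \<rho> b)} = cyl b (b + int n) \<rho>"
proof -
  have "(\<forall>i<n. \<omega> (b + int i) = \<rho> (b + int i)) \<longleftrightarrow> (\<forall>k. b \<le> k \<and> k < b + int n \<longrightarrow> \<omega> k = \<rho> k)" for \<omega> :: "int \<Rightarrow> nat"
  proof (intro iffI allI impI)
    fix k assume *: "\<forall>i<n. \<omega> (b + int i) = \<rho> (b + int i)" "b \<le> k \<and> k < b + int n"
    then show "\<omega> k = \<rho> k" using *(1)[rule_format, of "nat (k - b)"] by auto
  qed auto
  then show ?thesis by (auto simp: cyl_def agree_set_def tail_def)
qed

lemma finite_initial: "finite (J :: nat set) \<Longrightarrow> \<exists>n\<ge>1. J \<subseteq> {..<n}"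
  by (metis finite_nat_iff_bounded lessThan_subset_iff order_trans nat_le_linear)

text \<open>Quasi-independence from every cylinder in the future, extended to an arbitrary event in the future.\<close>

proposition cyl_future_upper:
  assumes \<tau>: "\<tau> \<in> E2" "a < b" and B[measurable]: "B \<in> sets borel"
  shows "prob (cyl a b \<tau> \<inter> {\<omega>. tail \<omega> b \<in> B}) \<le> C^3 * prob (cyl a b \<tau>) * prob {\<omega>. tail \<omega> b \<in> B}"
proof -
  have "measure (tail_law b (cyl a b \<tau>)) B \<le> (C^3 * prob (cyl a b \<tau>)) * measure (tail_law b UNIV) B"
  proof (rule measure_le_of_agree_le[OF tail_law_properties(1) tail_law_properties(1) tail_law_properties(2) tail_law_properties(2) _ B])
    fix J :: "nat set" assume "finite J"
    then obtain n where n: "1 \<le> n" "J \<subseteq> {..<n}" using finite_initial by blast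
    have "prob (cyl a b \<tau> \<inter> {\<omega>. tail \<omega> b \<in> agree_set {..<n} v})
      \<le> (C^3 * prob (cyl a b \<tau>)) * prob (UNIV \<inter> {\<omega>. tail \<omega> b \<in> agree_set {..<n} v})" for v
    proof (cases "cyl a b \<tau> \<inter> {\<omega>. tail \<omega> b \<in> agree_set {..<n} v} = {}")
      case True
      then show ?thesis using C_ge_1 by simp
    next
      case False
      then obtain \<rho> where \<rho>: "\<rho> \<in> cyl a b \<tau>" "tail \<rho> b \<in> agree_set {..<n} v" by blast
      then have v: "agree_set {..<n} v = agree_set {..<n} (tail \<rho> b)" by (auto simp: agree_set_def)
      have \<rho>E: "\<rho> \<in> E2" using \<rho>(1) by (simp add: cyl_def)
      have c: "cyl a b \<tau> = cyl a b \<rho>" using \<rho>(1) by (intro cyl_cong) (auto simp: cyl_def)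
      have "cyl a b \<rho> \<inter> {\<omega>. tail \<omega> b \<in> agree_set {..<n} v}
          = cyl a b \<rho> \<inter> (E2 \<inter> {\<omega>. tail \<omega> b \<in> agree_set {..<n} (tail \<rho> b)})"
        unfolding v by (auto simp: cyl_def)
      also have "\<dots> = cyl a (b + int n) \<rho>"
        unfolding agree_tail_eq_cyl using assms(2) by (auto simp: cyl_def) (meson not_less)
      finally have 1: "cyl a b \<rho> \<inter> {\<omega>. tail \<omega> b \<in> agree_set {..<n} v} = cyl a (b + int n) \<rho>" .
      have 2: "prob (UNIV \<inter> {\<omega>. tail \<omega> b \<in> agree_set {..<n} v}) = prob (cyl b (b + int n) \<rho>)"
        unfolding v agree_tail_eq_cyl[symmetric] by (subst measure_E2_Int) auto
      show ?thesis using quasi_bernoulli_upper[OF \<rho>E, of a b "b + int n"] assms(2) n(1)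
        unfolding c 1 2 by (simp add: mult.assoc)
    qed
    then show "\<exists>I. J \<subseteq> I \<and> finite I \<and> (\<forall>v. measure (tail_law b (cyl a b \<tau>)) (agree_set I v)
        \<le> (C^3 * prob (cyl a b \<tau>)) * measure (tail_law b UNIV) (agree_set I v))"
      using n(2) by (intro exI[of _ "{..<n}"]) (simp add: tail_law_properties(3))
  qed (use C_ge_1 in auto)
  then show ?thesis by (simp add: tail_law_properties(3))
qed

text \<open>The corresponding lower bound holds only for futures that may follow \<open>\<tau>\<close> at the cut.\<close>

proposition cyl_future_lower:
  assumes \<tau>: "\<tau> \<in> E2" "a < b" and B[measurable]: "B \<in> sets borel"
  shows "prob (cyl a b \<tau>) * prob {\<omega>. tail \<omega> b \<in> B \<and> \<not> (\<tau> (b - 1) = 1 \<and> \<omega> b = 1)}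
    \<le> C^3 * prob (cyl a b \<tau> \<inter> {\<omega>. tail \<omega> b \<in> B})"
proof -
  let ?A = "{\<omega> :: int \<Rightarrow> nat. \<not> (\<tau> (b - 1) = 1 \<and> \<omega> b = 1)}"
  let ?c = "C^3 / prob (cyl a b \<tau>)"
  have p: "0 < prob (cyl a b \<tau>)" by (rule cyl_pos[OF \<tau>])
  have A[measurable]: "?A \<in> sets borel"
  proof -
    have "{\<omega>\<in>space borel. \<omega> b \<noteq> (1::nat)} \<in> sets borel" by measurable
    then show ?thesis by (cases "\<tau> (b - 1) = 1") auto
  qed
  have "measure (tail_law b ?A) B \<le> ?c * measure (tail_law b (cyl a b \<tau>)) B"
  proof (rule measure_le_of_agree_le[OF tail_law_properties(1) tail_law_properties(1) tail_law_properties(2) tail_law_properties(2) _ B])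
    fix J :: "nat set" assume "finite J"
    then obtain n where n: "1 \<le> n" "J \<subseteq> {..<n}" using finite_initial by blast
    have "prob (?A \<inter> {\<omega>. tail \<omega> b \<in> agree_set {..<n} v})
      \<le> ?c * prob (cyl a b \<tau> \<inter> {\<omega>. tail \<omega> b \<in> agree_set {..<n} v})" for v
    proof -
      let ?X = "?A \<inter> {\<omega>. tail \<omega> b \<in> agree_set {..<n} v}"
      have X: "?X \<in> sets borel" by measurable
      show ?thesis
      proof (cases "E2 \<inter> ?X = {}")
        case True
        then have "prob ?X = 0" using measure_E2_Int[OF X] by simp
        then show ?thesis using C_ge_1 p by simp
      next
        case False
        then obtain \<sigma> where \<sigma>: "\<sigma> \<in> E2" "\<sigma> \<in> ?A" "tail \<sigma> b \<in> agree_set {..<n} v" by blast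
        define \<rho> where "\<rho> = (\<lambda>k. if k < b then \<tau> k else \<sigma> k)"
        have \<rho>E: "\<rho> \<in> E2" unfolding \<rho>_def by (rule glue_E2) (use \<tau> \<sigma> in auto)
        have "tail \<rho> b = tail \<sigma> b" by (simp add: tail_def \<rho>_def fun_eq_iff)
        with \<sigma>(3) have v: "agree_set {..<n} v = agree_set {..<n} (tail \<rho> b)" by (auto simp: agree_set_def)
        have c: "cyl a b \<tau> = cyl a b \<rho>" by (intro cyl_cong) (auto simp: \<rho>_def)
        have "cyl a b \<rho> \<inter> {\<omega>. tail \<omega> b \<in> agree_set {..<n} v}
            = cyl a b \<rho> \<inter> (E2 \<inter> {\<omega>. tail \<omega> b \<in> agree_set {..<n} (tail \<rho> b)})"
          unfolding v by (auto simp: cyl_def)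
        also have "\<dots> = cyl a (b + int n) \<rho>"
          unfolding agree_tail_eq_cyl using assms(2) by (auto simp: cyl_def) (meson not_less)
        finally have 1: "cyl a b \<rho> \<inter> {\<omega>. tail \<omega> b \<in> agree_set {..<n} v} = cyl a (b + int n) \<rho>" .
        have "prob ?X = prob (E2 \<inter> ?X)" by (rule measure_E2_Int[OF X, symmetric])
        also have "\<dots> \<le> prob (E2 \<inter> {\<omega>. tail \<omega> b \<in> agree_set {..<n} v})"
          by (rule finite_measure_mono) auto
        also have "\<dots> = prob (cyl b (b + int n) \<rho>)" unfolding v agree_tail_eq_cyl ..
        finally have 2: "prob ?X \<le> prob (cyl b (b + int n) \<rho>)" .
        have "prob (cyl a b \<tau>) * prob ?X \<le> prob (cyl a b \<tau>) * prob (cyl b (b + int n) \<rho>)"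
          using 2 by (intro mult_left_mono) auto
        also have "\<dots> \<le> C^3 * prob (cyl a b \<tau> \<inter> {\<omega>. tail \<omega> b \<in> agree_set {..<n} v})"
          using quasi_bernoulli_lower[OF \<rho>E, of a b "b + int n"] assms(2) n(1) unfolding c 1 by simp
        finally show ?thesis using p by (simp add: field_simps)
      qed
    qed
    then show "\<exists>I. J \<subseteq> I \<and> finite I \<and> (\<forall>v. measure (tail_law b ?A) (agree_set I v)
        \<le> ?c * measure (tail_law b (cyl a b \<tau>)) (agree_set I v))"
      using n(2) by (intro exI[of _ "{..<n}"]) (simp add: tail_law_properties(3))
  qed (use C_ge_1 in auto)
  then have "prob (?A \<inter> {\<omega>. tail \<omega> b \<in> B}) \<le> ?c * prob (cyl a b \<tau> \<inter> {\<omega>. tail \<omega> b \<in> B})"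
    by (simp add: tail_law_properties(3))
  moreover have "?A \<inter> {\<omega>. tail \<omega> b \<in> B} = {\<omega>. tail \<omega> b \<in> B \<and> \<not> (\<tau> (b - 1) = 1 \<and> \<omega> b = 1)}" by auto
  ultimately show ?thesis using p by (simp add: field_simps)
qed

end

section \<open>Ergodicity of Gibbs measures\<close>

context gibbs_measure
begin

definition zero_mass :: real where
  "zero_mass = prob (cyl 0 1 (\<lambda>_. 0))"

lemma zero_mass_pos: "0 < zero_mass"
  unfolding zero_mass_def by (rule cyl_pos[OF zero_E2]) simp

lemma cyl_zero_mass:
  assumes "\<rho> b = 0"
  shows "prob (cyl b (b + 1) \<rho>) = zero_mass"
proof -
  have "cyl b (b + 1) \<rho> = cyl (0 + b) (1 + b) (\<lambda>_. 0)"
    using assms by (auto simp: cyl_def algebra_simps) (metis add.commute order_antisym zless_add1_eq le_less)+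
  also have "\<dots> = shift_by b -` cyl 0 1 (\<lambda>_. 0)"
    by (subst cyl_shift_by) (simp add: shift_by_def)
  finally show ?thesis unfolding zero_mass_def by (simp add: prob_shift_by)
qed

text \<open>A digit \<open>0\<close> in the gap makes every future admissible after every past, and it costs only the
constant factor \<open>zero_mass\<close>.\<close>

proposition gap_mixing:
  assumes \<tau>: "\<tau> \<in> E2" "a < b" and B[measurable]: "B \<in> sets borel"
  shows "zero_mass * prob (cyl a b \<tau>) * prob {\<omega>. tail \<omega> (b + 1) \<in> B}
    \<le> C^6 * prob (cyl a b \<tau> \<inter> {\<omega>. tail \<omega> (b + 1) \<in> B})"
proof -
  define \<rho> where "\<rho> = (\<lambda>k. if k < b then \<tau> k else 0)"
  have \<rho>: "\<rho> \<in> E2" unfolding \<rho>_def using glue_E2[OF \<tau>(1) zero_E2, of b] by simp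
  have c: "cyl a b \<tau> = cyl a b \<rho>" by (intro cyl_cong) (auto simp: \<rho>_def)
  have b0: "\<rho> b = 0" by (simp add: \<rho>_def)
  have 1: "zero_mass * prob (cyl a b \<tau>) \<le> C^3 * prob (cyl a (b + 1) \<rho>)"
    using quasi_bernoulli_lower[OF \<rho>, of a b "b + 1"] \<tau>(2) cyl_zero_mass[of \<rho> b, OF b0] unfolding c
    by (simp add: mult.commute)
  have 2: "prob (cyl a (b + 1) \<rho>) * prob {\<omega>. tail \<omega> (b + 1) \<in> B}
      \<le> C^3 * prob (cyl a (b + 1) \<rho> \<inter> {\<omega>. tail \<omega> (b + 1) \<in> B})"
    using cyl_future_lower[OF \<rho>, of a "b + 1" B] \<tau>(2) b0 by simp
  have "prob (cyl a (b + 1) \<rho> \<inter> {\<omega>. tail \<omega> (b + 1) \<in> B}) \<le> prob (cyl a b \<tau> \<inter> {\<omega>. tail \<omega> (b + 1) \<in> B})"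
    unfolding c by (rule finite_measure_mono) (auto simp: cyl_def)
  then have 3: "C^3 * prob (cyl a (b + 1) \<rho> \<inter> {\<omega>. tail \<omega> (b + 1) \<in> B})
      \<le> C^3 * prob (cyl a b \<tau> \<inter> {\<omega>. tail \<omega> (b + 1) \<in> B})"
    using C_ge_1 by (intro mult_left_mono) auto
  have "zero_mass * prob (cyl a b \<tau>) * prob {\<omega>. tail \<omega> (b + 1) \<in> B}
      \<le> C^3 * prob (cyl a (b + 1) \<rho>) * prob {\<omega>. tail \<omega> (b + 1) \<in> B}"
    using 1 by (intro mult_right_mono) auto
  also have "\<dots> \<le> C^3 * (C^3 * prob (cyl a b \<tau> \<inter> {\<omega>. tail \<omega> (b + 1) \<in> B}))"
    unfolding mult.assoc using order_trans[OF 2 3] C_ge_1 by (intro mult_left_mono) auto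
  also have "\<dots> = C^6 * prob (cyl a b \<tau> \<inter> {\<omega>. tail \<omega> (b + 1) \<in> B})"
    by (simp add: mult.assoc[symmetric] flip: power_add)
  finally show ?thesis .
qed

text \<open>Sum \<open>gap_mixing\<close> over the cylinders that make up \<open>D\<close>.\<close>

lemma finitary_mixing:
  assumes D: "\<And>\<omega> \<tau>. (\<forall>i\<in>{-m..<m}. \<omega> i = \<tau> i) \<Longrightarrow> \<omega> \<in> D \<longleftrightarrow> \<tau> \<in> D" and m: "0 < m"
    and B[measurable]: "B \<in> sets borel"
  shows "zero_mass * prob D * prob {\<omega>. tail \<omega> (m + 1) \<in> B} \<le> C^6 * prob (D \<inter> {\<omega>. tail \<omega> (m + 1) \<in> B})"
proof (cases "prob {\<omega>. tail \<omega> (m + 1) \<in> B} = 0")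
  case True
  then show ?thesis using C_ge_1 by simp
next
  case False
  let ?V = "{\<omega>. tail \<omega> (m + 1) \<in> B}"
  let ?c = "C^6 / (zero_mass * prob ?V)"
  have V: "0 < prob ?V" using False by (simp add: zero_less_measure_iff)
  have Vm[measurable]: "?V \<in> sets borel" by measurable
  define N where "N = density M (indicator ?V)"
  have sN: "sets N = sets borel" by (simp add: N_def sets_M)
  have eN: "emeasure N X = emeasure M (X \<inter> ?V)" if [measurable]: "X \<in> sets borel" for X
  proof -
    have "emeasure N X = (\<integral>\<^sup>+\<tau>. indicator ?V \<tau> * indicator X \<tau> \<partial>M)"
      unfolding N_def by (rule emeasure_density) measurable
    also have "\<dots> = (\<integral>\<^sup>+\<tau>. indicator (X \<inter> ?V) \<tau> \<partial>M)"
      by (simp add: indicator_inter_arith mult.commute)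
    finally show ?thesis by (simp add: nn_integral_indicator)
  qed
  have fN: "finite_measure N"
    using eN[of UNIV] sets_eq_imp_space_eq[OF sN] by (intro finite_measureI) (simp add: emeasure_eq_measure)
  have mN: "measure N X = prob (X \<inter> ?V)" if "X \<in> sets borel" for X
    using eN[OF that] by (simp add: measure_def)
  have Db: "D \<in> sets borel"
    by (rule finitary_measurable) (unfold finitary_def, intro exI[of _ "{-m..<m}"], use D in auto)
  have "prob D \<le> ?c * measure N D"
  proof (rule measure_le_of_agree_le_finitary[OF finite_measure_axioms fN sets_M sN _ _ D])
    fix \<tau> :: "int \<Rightarrow> nat"
    show "prob (agree_set {-m..<m} \<tau>) \<le> ?c * measure N (agree_set {-m..<m} \<tau>)"
    proof (cases "cyl (-m) m \<tau> = {}")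
      case True
      then have "prob (agree_set {-m..<m} \<tau>) = 0"
        using measure_E2_Int[of "agree_set {-m..<m} \<tau>"] by (simp add: cyl_eq_agree)
      then show ?thesis using C_ge_1 zero_mass_pos by simp
    next
      case False
      then obtain \<sigma> where s: "\<sigma> \<in> cyl (-m) m \<tau>" by blast
      then have c: "cyl (-m) m \<tau> = cyl (-m) m \<sigma>" by (intro cyl_cong) (auto simp: cyl_def)
      have "prob (agree_set {-m..<m} \<tau>) = prob (cyl (-m) m \<tau>)"
        using measure_E2_Int[of "agree_set {-m..<m} \<tau>"] by (simp add: cyl_eq_agree)
      moreover have "measure N (agree_set {-m..<m} \<tau>) = prob (cyl (-m) m \<tau> \<inter> ?V)"
        using measure_E2_Int[of "agree_set {-m..<m} \<tau> \<inter> ?V"] by (simp add: cyl_eq_agree mN Int_assoc)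
      moreover have "zero_mass * prob (cyl (-m) m \<sigma>) * prob ?V \<le> C^6 * prob (cyl (-m) m \<sigma> \<inter> ?V)"
        by (rule gap_mixing) (use s m in \<open>auto simp: cyl_def\<close>)
      ultimately show ?thesis using V zero_mass_pos unfolding c by (simp add: field_simps)
    qed
  qed (use C_ge_1 zero_mass_pos in auto)
  then show ?thesis using V zero_mass_pos by (simp add: mN[OF Db] field_simps)
qed

lemma shift_by_vimage_invariant:
  assumes "shift_by (-1) -` A = A"
  shows "shift_by (int n) -` A = A"
proof (induction n)
  case 0
  show ?case by (auto simp: vimage_def)
next
  case (Suc n)
  have "shift_by 1 -` A = shift_by 1 -` shift_by (-1) -` A" using assms by simp
  also have "\<dots> = A" by (auto simp: vimage_def)
  finally have 1: "shift_by 1 -` A = A" .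
  have "shift_by (int (Suc n)) -` A = shift_by (int n) -` shift_by 1 -` A"
    by (auto simp: vimage_def algebra_simps)
  then show ?case by (simp only: 1 Suc)
qed

text \<open>An invariant set and its complement are approximated by events that depend on a window; after
shifting one of them past the other, they would be nearly disjoint although \<open>finitary_mixing\<close> bounds the
probability of their intersection from below.\<close>

proposition invariant_0_1:
  assumes A[measurable]: "A \<in> sets borel" and inv: "shift_by (-1) -` A = A"
  shows "prob A = 0 \<or> prob A = 1"
proof (rule ccontr)
  assume "\<not> (prob A = 0 \<or> prob A = 1)"
  then have a: "0 < prob A" "prob A < 1" by (simp_all add: zero_less_measure_iff less_le)
  define c where "c = zero_mass / C^6"
  have c: "0 < c" using zero_mass_pos C_ge_1 by (simp add: c_def)
  (* small enough that c (P(A) P(-A) - e) > 2 e, which is the contradiction at the end *)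
  define e where "e = c * (prob A * (1 - prob A)) / (3 + c)"
  have e: "0 < e" using a c by (simp add: e_def)
  have e3: "e * (3 + c) = c * (prob A * (1 - prob A))" using c by (simp add: e_def)
  obtain D where D: "finitary D" "prob (sym_diff A D) < e"
    using approx_finitary[OF finite_measure_axioms sets_M A e] by blast
  have [measurable]: "D \<in> sets borel" by (rule finitary_measurable[OF D(1)])
  obtain I where I: "finite I" "\<And>\<omega> \<tau>. (\<forall>i\<in>I. \<omega> i = \<tau> i) \<Longrightarrow> \<omega> \<in> D \<longleftrightarrow> \<tau> \<in> D"
    using D(1) unfolding finitary_def by blast
  define m where "m = Max (insert 0 ((\<lambda>i. \<bar>i\<bar>) ` I)) + 1"
  have m0: "0 < m"
    using I(1) unfolding m_def by (metis Max_ge finite_imageI finite_insert insertI1 zle_add1_eq_le zless_add1_eq less_add_one le_less_trans)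
  have mI: "i \<in> {-m..<m}" if "i \<in> I" for i
  proof -
    have "\<bar>i\<bar> \<le> Max (insert 0 ((\<lambda>i. \<bar>i\<bar>) ` I))" using I(1) that by (intro Max_ge) auto
    then show ?thesis unfolding m_def by auto
  qed
  have dep: "\<omega> \<in> D \<longleftrightarrow> \<tau> \<in> D" if "\<forall>i\<in>{-m..<m}. \<omega> i = \<tau> i" for \<omega> \<tau>
    using I(2)[of \<omega> \<tau>] mI that by blast
  define B where "B = {x. (\<lambda>i. x (nat (i + m))) \<in> D}"
  have B[measurable]: "B \<in> sets borel"
  proof -
    have "(\<lambda>x::nat \<Rightarrow> nat. (\<lambda>i. x (nat (i + m)))) \<in> borel_measurable borel"
      by (rule measurable_coordinatewise_then_product) measurable
    from measurable_sets[OF this, of D] show ?thesis by (simp add: B_def vimage_def)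
  qed
  have V: "{\<omega>. tail \<omega> (m + 1) \<in> B} = shift_by (2 * m + 1) -` D"
  proof -
    have "(\<lambda>i. tail \<omega> (m + 1) (nat (i + m))) \<in> D \<longleftrightarrow> shift_by (2 * m + 1) \<omega> \<in> D" for \<omega>
      by (rule dep) (auto simp: tail_def algebra_simps)
    then show ?thesis by (auto simp: B_def)
  qed
  have invm: "shift_by (2 * m + 1) -` A = A"
    using shift_by_vimage_invariant[OF inv, of "nat (2 * m + 1)"] m0 by simp
  let ?V = "shift_by (2 * m + 1) -` D"
  have Vm[measurable]: "?V \<in> sets borel"
    using measurable_sets[OF shift_by_measurable, of D "2 * m + 1"] by simp
  have mix: "zero_mass * prob (- D) * prob ?V \<le> C^6 * prob (- D \<inter> ?V)"
    unfolding V[symmetric] by (rule finitary_mixing[OF _ m0 B]) (use dep in auto)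
  have dA: "prob A \<le> prob D + e"
  proof -
    have "prob A \<le> prob (D \<union> sym_diff A D)" by (rule finite_measure_mono) auto
    also have "\<dots> \<le> prob D + prob (sym_diff A D)" by (rule measure_Un_le) auto
    finally show ?thesis using D(2) by linarith
  qed
  have dA': "1 - prob A \<le> prob (- D) + e"
  proof -
    have "1 - prob A = prob (- A)" using prob_compl[of A] by (simp add: Compl_eq_Diff_UNIV)
    also have "\<dots> \<le> prob (- D \<union> sym_diff A D)" by (rule finite_measure_mono) auto
    also have "\<dots> \<le> prob (- D) + prob (sym_diff A D)" by (rule measure_Un_le) auto
    finally show ?thesis using D(2) by linarith
  qed
  have "sym_diff A ?V = shift_by (2 * m + 1) -` (sym_diff A D)"
    using invm by auto
  moreover have "prob (shift_by (2 * m + 1) -` (sym_diff A D)) = prob (sym_diff A D)"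
    by (rule prob_shift_by) measurable
  ultimately have dV: "prob (sym_diff A ?V) < e" using D(2) by (simp only:)
  have "prob (- D \<inter> ?V) \<le> prob (sym_diff A D \<union> sym_diff A ?V)"
    by (rule finite_measure_mono) auto
  also have "\<dots> \<le> prob (sym_diff A D) + prob (sym_diff A ?V)" by (rule measure_Un_le) auto
  finally have small: "prob (- D \<inter> ?V) < 2 * e" using D(2) dV by linarith
  have pV: "prob ?V = prob D" by (simp add: prob_shift_by)
  have "c * (prob (- D) * prob D) \<le> prob (- D \<inter> ?V)"
    using mix C_ge_1 unfolding pV c_def by (simp add: field_simps)
  with small have s2: "c * (prob (- D) * prob D) < 2 * e" by linarith
  have "prob A * (1 - prob A) - e \<le> prob (- D) * prob D"
  proof -
    have "prob A * (1 - prob A) \<le> (prob D + e) * (1 - prob A)"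
      using dA a by (intro mult_right_mono) auto
    also have "\<dots> = prob D * (1 - prob A) + e * (1 - prob A)" by (simp add: distrib_right)
    also have "\<dots> \<le> prob D * (prob (- D) + e) + e * (1 - prob A)"
      using dA' e by (intro add_mono mult_left_mono) auto
    also have "\<dots> = prob (- D) * prob D + e * (prob D + (1 - prob A))" by (simp add: algebra_simps)
    finally have 1: "prob A * (1 - prob A) \<le> prob (- D) * prob D + e * (prob D + (1 - prob A))" .
    show ?thesis
    proof (cases "prob D \<le> prob A")
      case True
      then have "e * (prob D + (1 - prob A)) \<le> e * 1" using e by (intro mult_left_mono) auto
      with 1 show ?thesis by simp
    next
      case False
      have D1: "prob (- D) = 1 - prob D" using prob_compl[of D] by (simp add: Compl_eq_Diff_UNIV)
      have "prob A * (1 - prob A) \<le> prob D * (prob (- D) + e)"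
        using False dA' a e by (intro mult_mono) auto
      also have "\<dots> \<le> prob (- D) * prob D + e * 1"
        using mult_right_mono[of "prob D" 1 e] e by (simp add: algebra_simps)
      finally show ?thesis by simp
    qed
  qed
  then have "c * (prob A * (1 - prob A) - e) \<le> c * (prob (- D) * prob D)"
    using c by (intro mult_left_mono) auto
  with s2 have "c * (prob A * (1 - prob A)) < (2 + c) * e" by (simp add: algebra_simps)
  with e3 e show False by (simp add: algebra_simps)
qed

sublocale ergodic_system M "shift_by (-1)"
proof
  show "shift_by (-1) \<in> measurable M M" by measurable
  show "distr M M (shift_by (-1)) = M" by (rule distr_shift_by)
  show "prob A = 0 \<or> prob A = 1" if "A \<in> sets M" "shift_by (-1) -` A \<inter> space M = A" for A
    using invariant_0_1[of A] that by (simp add: sets_M)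
qed

lemma birkhoff_sum_shift_by: "birkhoff_sum f n \<tau> = (\<Sum>k<n. f (shift_by (- int k) \<tau>))"
  unfolding birkhoff_sum_def by (simp add: funpow_shift_by)

text \<open>The logarithm of the probability of a past cylinder is a Birkhoff sum along the inverse shift, up
to the constant from the Gibbs property. The limit is minus the entropy.\<close>

lemma cyl_decay:
  assumes [measurable]: "f \<in> borel_measurable borel" and f: "\<And>\<tau>. \<tau> \<in> E2 \<Longrightarrow> f \<tau> = \<psi> \<tau>"
    and B: "\<And>\<tau>. \<bar>f \<tau>\<bar> \<le> B"
  shows "AE \<tau> in M. (\<lambda>n. ln (prob (cyl (- int n) 0 \<tau>)) / n) \<longlonglongrightarrow> (\<integral>\<tau>. f (shift_by (-1) \<tau>) \<partial>M) - P"
proof -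
  let ?f = "\<lambda>\<tau>. f (shift_by (-1) \<tau>)"
  have "AE \<tau> in M. (\<lambda>n. birkhoff_sum ?f n \<tau> / n) \<longlonglongrightarrow> (\<integral>\<tau>. ?f \<tau> \<partial>M)"
    by (rule birkhoff_bounded[of _ B]) (use B in auto)
  then show ?thesis using E2_full
  proof eventually_elim
    case (elim \<tau>)
    have eq: "ln (weight (- int n) 0 \<tau>) = birkhoff_sum ?f n \<tau> - n * P" for n
    proof -
      have "(\<Sum>k\<in>{- int n..<0}. \<psi> (shift_by k \<tau>)) = birkhoff_sum ?f n \<tau>"
        unfolding birkhoff_sum_shift_by
        by (rule sum.reindex_bij_witness[of _ "\<lambda>k. - int k - 1" "\<lambda>k. nat (- k - 1)"])
           (use elim(2) f in auto)
      then show ?thesis by (simp add: weight_def)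
    qed
    have bd: "\<bar>ln (prob (cyl (- int n) 0 \<tau>)) - ln (weight (- int n) 0 \<tau>)\<bar> \<le> ln C" if "1 \<le> n" for n
    proof -
      have w: "0 < weight (- int n) 0 \<tau>" by (rule weight_pos)
      have p: "0 < prob (cyl (- int n) 0 \<tau>)" by (rule cyl_pos) (use elim that in auto)
      have "ln (weight (- int n) 0 \<tau>) \<le> ln (C * prob (cyl (- int n) 0 \<tau>))"
        using cyl_weight(1)[of \<tau> "- int n" 0] elim that w p C_ge_1 by (subst ln_le_cancel_iff) auto
      moreover have "ln (prob (cyl (- int n) 0 \<tau>)) \<le> ln (C * weight (- int n) 0 \<tau>)"
        using cyl_weight(2)[of \<tau> "- int n" 0] elim that w p C_ge_1 by (subst ln_le_cancel_iff) auto
      ultimately show ?thesis using w p C_ge_1 by (simp add: ln_mult)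
    qed
    have l1: "(\<lambda>n. ln (weight (- int n) 0 \<tau>) / n) \<longlonglongrightarrow> (\<integral>\<tau>. ?f \<tau> \<partial>M) - P"
    proof -
      have "(\<lambda>n. birkhoff_sum ?f n \<tau> / n - P) \<longlonglongrightarrow> (\<integral>\<tau>. ?f \<tau> \<partial>M) - P"
        using elim(1) by (intro tendsto_intros)
      moreover have "\<forall>\<^sub>F n in sequentially. birkhoff_sum ?f n \<tau> / n - P = ln (weight (- int n) 0 \<tau>) / n"
        using eventually_gt_at_top[of 0] by eventually_elim (simp add: eq field_simps)
      ultimately show ?thesis by (rule Lim_transform_eventually)
    qed
    have l2: "(\<lambda>n. (ln (prob (cyl (- int n) 0 \<tau>)) - ln (weight (- int n) 0 \<tau>)) / n) \<longlonglongrightarrow> 0"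
    proof (rule tendsto_0_le[of "\<lambda>n. 1 / real n" _ _ "ln C"])
      show "(\<lambda>n. 1 / real n) \<longlonglongrightarrow> 0" by (rule lim_1_over_n)
      show "\<forall>\<^sub>F n in sequentially. norm ((ln (prob (cyl (- int n) 0 \<tau>)) - ln (weight (- int n) 0 \<tau>)) / n)
          \<le> norm (1 / real n) * ln C"
        using eventually_ge_at_top[of 1]
      proof eventually_elim
        case (elim n)
        then show ?case using bd[of n] by (simp add: field_simps)
      qed
    qed
    from tendsto_add[OF l1 l2] show ?case by (simp add: diff_divide_distrib)
  qed
qed

text \<open>The eventually alternating sequences form an invariant set. If it had full measure, then by
invariance so would the sequences that alternate from coordinate \<open>0\<close> on, but the cylinder \<open>00\<close> has
positive measure.\<close>

lemma AE_not_alternating: "AE \<tau> in M. \<forall>n::int. \<exists>k\<ge>n. \<tau> k = \<tau> (k + 1)"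
proof -
  define Q where "Q n = {\<tau>::int \<Rightarrow> nat. \<forall>k. n \<le> k \<longrightarrow> \<tau> k \<noteq> \<tau> (k + 1)}" for n :: int
  have Q[measurable]: "Q n \<in> sets borel" for n
  proof -
    have "{\<tau>\<in>space borel. \<forall>k. n \<le> k \<longrightarrow> \<tau> k \<noteq> (\<tau> (k + 1) :: nat)} \<in> sets borel" by measurable
    then show ?thesis by (simp add: Q_def)
  qed
  have sh: "shift_by a -` Q n = Q (n + a)" for a n
  proof -
    have "(\<forall>k. n \<le> k \<longrightarrow> \<tau> (k + a) \<noteq> \<tau> (k + 1 + a)) \<longleftrightarrow> (\<forall>k. n + a \<le> k \<longrightarrow> \<tau> k \<noteq> \<tau> (k + 1))" for \<tau> :: "int \<Rightarrow> nat"
    proof (intro iffI allI impI)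
      fix k assume *: "\<forall>k. n \<le> k \<longrightarrow> \<tau> (k + a) \<noteq> \<tau> (k + 1 + a)" "n + a \<le> k"
      show "\<tau> k \<noteq> \<tau> (k + 1)" using *(1)[rule_format, of "k - a"] *(2) by (simp add: algebra_simps)
    next
      fix k assume *: "\<forall>k. n + a \<le> k \<longrightarrow> \<tau> k \<noteq> \<tau> (k + 1)" "n \<le> k"
      show "\<tau> (k + a) \<noteq> \<tau> (k + 1 + a)" using *(1)[rule_format, of "k + a"] *(2) by (simp add: algebra_simps)
    qed
    then show ?thesis by (auto simp: Q_def)
  qed
  have pQ: "prob (Q n) = prob (Q 0)" for n
    using prob_shift_by[OF Q, of n 0] by (simp add: sh)
  have mono: "Q n \<subseteq> Q n'" if "n \<le> n'" for n n' using that by (auto simp: Q_def)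
  have inc: "(\<Union>n. Q n) = (\<Union>n. Q (int n))"
  proof -
    have "Q n \<subseteq> Q (int (nat n))" for n by (rule mono) simp
    then show ?thesis by blast
  qed
  have "(\<lambda>n. prob (Q (int n))) \<longlonglongrightarrow> prob (\<Union>n. Q (int n))"
    by (rule finite_Lim_measure_incseq) (auto simp: incseq_def intro!: mono)
  moreover have "(\<lambda>n. prob (Q (int n))) = (\<lambda>_. prob (Q 0))" by (rule ext) (rule pQ)
  ultimately have "(\<lambda>_::nat. prob (Q 0)) \<longlonglongrightarrow> prob (\<Union>n. Q (int n))" by (simp only:)
  then have pU: "prob (\<Union>n. Q n) = prob (Q 0)"
    unfolding inc by (simp add: LIMSEQ_const_iff)
  have up: "Q n \<subseteq> (\<Union>n. Q (n - 1))" for n using UN_upper[of "n + 1" UNIV "\<lambda>n. Q (n - 1)"] by simp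
  have "shift_by (-1) -` (\<Union>n. Q n) = (\<Union>n. Q (n - 1))" unfolding vimage_UN sh by simp
  also have "\<dots> = (\<Union>n. Q n)" using up by blast
  finally have "prob (\<Union>n. Q n) = 0 \<or> prob (\<Union>n. Q n) = 1"
    by (intro invariant_0_1) auto
  moreover have "prob (Q 0) \<noteq> 1"
  proof
    assume "prob (Q 0) = 1"
    then have "prob (- Q 0) = 0" using prob_compl[of "Q 0"] by (simp add: Compl_eq_Diff_UNIV)
    moreover have "prob (cyl 0 2 (\<lambda>_. 0)) \<le> prob (- Q 0)"
      by (rule finite_measure_mono) (auto simp: cyl_def Q_def)
    ultimately show False using cyl_pos[OF zero_E2, of 0 2] by simp
  qed
  ultimately have "prob (\<Union>n. Q n) = 0" using pU by simp
  then have "AE \<tau> in M. \<tau> \<notin> (\<Union>n. Q n)" using prob_eq_0[of "\<Union>n. Q n"] by (simp add: sets_M)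
  then show ?thesis
  proof eventually_elim
    case (elim \<tau>)
    then have "\<tau> \<notin> Q n" for n by blast
    then show ?case by (auto simp: Q_def)
  qed
qed

end

section \<open>Greedy digits of the beta-transformation\<close>

lemma golden_gt_1: "1 < golden"
proof -
  have "1 < sqrt 5" by simp
  then show ?thesis unfolding golden_def by simp
qed

lemma golden_square: "golden * golden = golden + 1"
  by (simp add: golden_def field_simps)

lemma golden_inverse: "1 / golden + 1 / golden / golden = 1"
proof -
  have "golden \<noteq> 0" using golden_gt_1 by simp
  then have "1 / golden + 1 / golden / golden = (golden + 1) / (golden * golden)" by (simp add: field_simps)
  also have "\<dots> = 1" using golden_square golden_gt_1 by simp
  finally show ?thesis .
qed

lemma shiftp_E2p: "\<omega> \<in> E2p \<Longrightarrow> shiftp \<omega> \<in> E2p"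
  unfolding E2p_def shiftp_def by auto

lemma E2p_digit: "\<omega> \<in> E2p \<Longrightarrow> \<omega> n = 0 \<or> \<omega> n = 1"
  unfolding E2p_def by auto

lemma E2p_next: "\<omega> \<in> E2p \<Longrightarrow> \<omega> n = 1 \<Longrightarrow> \<omega> (Suc n) = 0"
  unfolding E2p_def by auto

lemma coding_summable:
  assumes "\<omega> \<in> E2p"
  shows "summable (\<lambda>n. real (\<omega> n) / golden ^ Suc n)"
proof (rule summable_comparison_test')
  show "summable (\<lambda>n. (1 / golden) ^ Suc n)"
    using golden_gt_1 by (subst summable_Suc_iff) (simp add: summable_geometric)
  show "norm (real (\<omega> n) / golden ^ Suc n) \<le> (1 / golden) ^ Suc n" for n
    using E2p_digit[OF assms, of n] golden_gt_1 by (auto simp: power_one_over field_simps)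
qed

lemma coding_rec:
  assumes "\<omega> \<in> E2p"
  shows "coding \<omega> = (real (\<omega> 0) + coding (shiftp \<omega>)) / golden"
proof -
  have "coding \<omega> = real (\<omega> 0) / golden + (\<Sum>n. real (\<omega> (Suc n)) / golden ^ Suc (Suc n))"
    unfolding coding_def using suminf_split_head[OF coding_summable[OF assms]] by simp
  also have "(\<Sum>n. real (\<omega> (Suc n)) / golden ^ Suc (Suc n)) = (\<Sum>n. real (shiftp \<omega> n) / golden ^ Suc n / golden)"
    by (simp add: shiftp_def field_simps)
  also have "\<dots> = coding (shiftp \<omega>) / golden"
    unfolding coding_def by (rule suminf_divide[OF coding_summable[OF shiftp_E2p[OF assms]]])
  finally show ?thesis by (simp add: add_divide_distrib)
qed

lemma coding_nonneg: "\<omega> \<in> E2p \<Longrightarrow> 0 \<le> coding \<omega>"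
  unfolding coding_def using golden_gt_1 by (intro suminf_nonneg coding_summable) auto

text \<open>A leading digit \<open>1\<close> is followed by \<open>0\<close>, and \<open>1 / golden + 1 / golden\<^sup>2 = 1\<close>.\<close>

lemma coding_partial_le_1:
  assumes "\<omega> \<in> E2p"
  shows "(\<Sum>n<N. real (\<omega> n) / golden ^ Suc n) \<le> 1"
  using assms
proof (induction N arbitrary: \<omega> rule: less_induct)
  case (less N)
  have g: "0 < golden" "1 < golden" using golden_gt_1 by auto
  have split: "(\<Sum>n<Suc k. real (\<omega> n) / golden ^ Suc n) = real (\<omega> 0) / golden + (\<Sum>n<k. real (shiftp \<omega> n) / golden ^ Suc n) / golden"
    for k and \<omega> :: "nat \<Rightarrow> nat"
    by (subst sum.lessThan_Suc_shift) (simp add: shiftp_def sum_divide_distrib field_simps)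
  show ?case
  proof (cases N)
    case 0
    then show ?thesis by simp
  next
    case (Suc k)
    have IH: "(\<Sum>n<k. real (shiftp \<omega> n) / golden ^ Suc n) \<le> 1"
      using less Suc shiftp_E2p by blast
    show ?thesis
    proof (cases "\<omega> 0 = 0")
      case True
      have "(\<Sum>n<N. real (\<omega> n) / golden ^ Suc n) \<le> 1 / golden"
        unfolding Suc split using True IH g by (simp add: divide_right_mono)
      also have "\<dots> \<le> 1" using g by simp
      finally show ?thesis .
    next
      case False
      then have w: "\<omega> 0 = 1" "shiftp \<omega> 0 = 0"
        using E2p_digit[OF less(2), of 0] E2p_next[OF less(2), of 0] by (auto simp: shiftp_def)
      show ?thesis
      proof (cases k)
        case 0
        then show ?thesis using w g Suc by (simp add: field_simps)
      next
        case (Suc j)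
        have "(\<Sum>n<j. real (shiftp (shiftp \<omega>) n) / golden ^ Suc n) \<le> 1"
          using less \<open>N = Suc k\<close> Suc shiftp_E2p by (metis lessI less_SucI)
        then have "(\<Sum>n<j. real (shiftp (shiftp \<omega>) n) / golden ^ Suc n) / golden / golden \<le> 1 / golden / golden"
          using g by (intro divide_right_mono) auto
        then show ?thesis
          unfolding \<open>N = Suc k\<close> Suc split using w golden_inverse by (simp add: add_divide_distrib del: power_Suc)
      qed
    qed
  qed
qed

lemma coding_le_1: "\<omega> \<in> E2p \<Longrightarrow> coding \<omega> \<le> 1"
  unfolding coding_def by (rule suminf_le_const[OF coding_summable coding_partial_le_1])

text \<open>Only the alternating sequence that starts with \<open>1\<close> is coded by \<open>1\<close>, which is not a point of
\<open>[0, 1)\<close>. This is why eventually alternating sequences are excluded in the decoding.\<close>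

lemma coding_eq_1_step:
  assumes w: "\<omega> \<in> E2p" and "coding \<omega> = 1"
  shows "\<omega> 0 = 1" "\<omega> 1 = 0" "coding (shiftp (shiftp \<omega>)) = 1"
proof -
  have g: "0 < golden" "1 < golden" using golden_gt_1 by auto
  have 1: "golden = real (\<omega> 0) + coding (shiftp \<omega>)" using coding_rec[OF w] assms(2) g by (simp add: field_simps)
  show w0: "\<omega> 0 = 1"
    using E2p_digit[OF w, of 0] 1 coding_le_1[OF shiftp_E2p[OF w]] g by auto
  then show w1: "\<omega> 1 = 0" using E2p_next[OF w, of 0] by simp
  have "golden * coding (shiftp \<omega>) = coding (shiftp (shiftp \<omega>))"
    using coding_rec[OF shiftp_E2p[OF w]] w1 g by (simp add: shiftp_def field_simps)
  moreover have "coding (shiftp \<omega>) = golden - 1" using 1 w0 by simp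
  ultimately show "coding (shiftp (shiftp \<omega>)) = 1" using golden_square by (simp add: algebra_simps)
qed

lemma shiftp_funpow: "(shiftp ^^ n) \<omega> k = \<omega> (k + n)"
  by (induction n arbitrary: k) (auto simp: shiftp_def)

lemma shiftp_funpow_E2p: "\<omega> \<in> E2p \<Longrightarrow> (shiftp ^^ n) \<omega> \<in> E2p"
  by (induction n) (auto simp: shiftp_E2p)

lemma coding_eq_1_alternating:
  assumes w: "\<omega> \<in> E2p" and "coding \<omega> = 1"
  shows "\<omega> k \<noteq> \<omega> (Suc k)"
proof -
  have c: "coding ((shiftp ^^ (2 * j)) \<omega>) = 1" for j
  proof (induction j)
    case 0
    show ?case using assms by simp
  next
    case (Suc j)
    show ?case using coding_eq_1_step(3)[OF shiftp_funpow_E2p[OF w] Suc] by simp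
  qed
  have d: "\<omega> (2 * j) = 1" "\<omega> (Suc (2 * j)) = 0" for j
    using coding_eq_1_step(1,2)[OF shiftp_funpow_E2p[OF w] c, of j] by (simp_all add: shiftp_funpow)
  have "k = 2 * (k div 2) \<or> k = Suc (2 * (k div 2))" by presburger
  then show ?thesis
  proof
    assume "k = 2 * (k div 2)" then show ?thesis using d[of "k div 2"] by simp
  next
    assume k: "k = Suc (2 * (k div 2))"
    then have "Suc k = 2 * Suc (k div 2)" by simp
    then show ?thesis using d(2)[of "k div 2"] d(1)[of "Suc (k div 2)"] k by (metis zero_neq_one)
  qed
qed

text \<open>The digits of the greedy expansion in base \<open>golden\<close>. They decode \<open>coding\<close> in a Borel way.\<close>

definition greedy_digits :: "real \<Rightarrow> nat \<Rightarrow> nat" where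
  "greedy_digits x n = nat \<lfloor>golden * (T_beta ^^ n) x\<rfloor>"

lemma greedy_digits_coding:
  assumes w: "\<omega> \<in> E2p" and lt: "\<And>n. coding ((shiftp ^^ n) \<omega>) < 1"
  shows "greedy_digits (coding \<omega>) = \<omega>"
proof
  fix n
  have step: "golden * coding ((shiftp ^^ n) \<omega>) = real (\<omega> n) + coding ((shiftp ^^ Suc n) \<omega>)" for n
    using coding_rec[OF shiftp_funpow_E2p[OF w], of n] golden_gt_1
    by (simp add: shiftp_funpow field_simps)
  have fl: "\<lfloor>golden * coding ((shiftp ^^ n) \<omega>)\<rfloor> = int (\<omega> n)" for n
    unfolding step using lt[of "Suc n"] coding_nonneg[OF shiftp_funpow_E2p[OF w], of "Suc n"]
    by (intro floor_unique) auto
  have "(T_beta ^^ n) (coding \<omega>) = coding ((shiftp ^^ n) \<omega>)" for n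
  proof (induction n)
    case 0
    show ?case by simp
  next
    case (Suc n)
    have "(T_beta ^^ Suc n) (coding \<omega>) = T_beta (coding ((shiftp ^^ n) \<omega>))" using Suc by simp
    also have "\<dots> = golden * coding ((shiftp ^^ n) \<omega>) - of_int \<lfloor>golden * coding ((shiftp ^^ n) \<omega>)\<rfloor>"
      by (simp add: T_beta_def frac_def)
    also have "\<dots> = coding ((shiftp ^^ Suc n) \<omega>)" using fl[of n] step[of n] by simp
    finally show ?case .
  qed
  then show "greedy_digits (coding \<omega>) n = \<omega> n" unfolding greedy_digits_def using fl[of n] by simp
qed

lemma T_beta_measurable[measurable]: "T_beta \<in> borel_measurable borel"
  unfolding T_beta_def[abs_def] frac_def by measurable

lemma greedy_digits_measurable[measurable]: "greedy_digits \<in> borel_measurable borel"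
proof (rule measurable_coordinatewise_then_product)
  fix n
  have [measurable]: "T_beta ^^ n \<in> borel_measurable borel" for n
    by (induction n) auto
  show "(\<lambda>x. greedy_digits x n) \<in> borel_measurable borel"
    unfolding greedy_digits_def by measurable
qed

lemma coding_measurable[measurable]: "coding \<in> borel_measurable borel"
  unfolding coding_def[abs_def] by measurable

lemma funpow_shiftp_tail: "(shiftp ^^ n) (tail \<tau> m) = tail \<tau> (m + int n)"
  by (simp add: fun_eq_iff shiftp_funpow tail_def algebra_simps)

lemma (in gibbs_measure) AE_greedy_digits: "AE \<tau> in M. greedy_digits (coding (tail \<tau> 0)) = tail \<tau> 0"
  using AE_not_alternating E2_full
proof eventually_elim
  case (elim \<tau>)
  have "coding (tail \<tau> m) < 1" for m
  proof (rule ccontr)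
    assume "\<not> coding (tail \<tau> m) < 1"
    then have 1: "coding (tail \<tau> m) = 1" using coding_le_1[OF tail_E2p[OF elim(2), of m]] by simp
    obtain k where k: "m \<le> k" "\<tau> k = \<tau> (k + 1)" using elim(1) by blast
    show False using coding_eq_1_alternating[OF tail_E2p[OF elim(2)] 1, of "nat (k - m)"] k
      by (simp add: tail_def algebra_simps)
  qed
  then show ?case by (intro greedy_digits_coding tail_E2p elim(2)) (simp add: funpow_shiftp_tail)
qed

section \<open>Conformal derivatives\<close>

text \<open>Lift the segment from \<open>f p\<close> to \<open>q\<close>. The lift moves with speed at most \<open>dist (f p) q / c\<close>, so it
stays in the ball of radius \<open>\<rho>\<close> until it reaches a preimage of \<open>q\<close>.\<close>

lemma ball_subset_image:
  fixes f :: "'a::euclidean_space \<Rightarrow> 'a"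
  assumes cont: "continuous_on (ball p \<rho>) f" and inj: "inj_on f (ball p \<rho>)" and c: "0 < c"
    and D: "\<And>z. z \<in> ball p \<rho> \<Longrightarrow> \<exists>D. (f has_derivative D) (at z) \<and> (\<forall>v. c * norm v \<le> norm (D v))"
  shows "ball (f p) (c * \<rho>) \<subseteq> f ` ball p \<rho>"
proof
  fix q assume q: "q \<in> ball (f p) (c * \<rho>)"
  define L0 where "L0 = dist (f p) q"
  have L0: "0 \<le> L0" "L0 < c * \<rho>" using q by (auto simp: L0_def)
  have \<rho>: "0 < \<rho>" using L0 c by (metis le_less_trans zero_less_mult_pos)
  define b where "b = L0 / \<rho>"
  have b: "0 \<le> b" "b < c" using L0 \<rho> by (auto simp: b_def field_simps)
  (* a rate slightly below c, so that a first-order estimate of the lift suffices *)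
  define c' where "c' = (b + c) / 2"
  have c': "0 < c'" "c' < c" "b < c'" using b by (auto simp: c'_def)
  define L where "L = L0 / c'"
  have L: "0 \<le> L" "L < \<rho>" using c' L0 \<rho> by (auto simp: L_def b_def field_simps)
  define \<gamma> where "\<gamma> t = f p + t *\<^sub>R (q - f p)" for t :: real
  have cont\<gamma>: "continuous_on A \<gamma>" for A unfolding \<gamma>_def by (intro continuous_intros)
  have dist\<gamma>: "dist (\<gamma> s) (\<gamma> t) = \<bar>t - s\<bar> * L0" for s t
  proof -
    have "\<gamma> s - \<gamma> t = (s - t) *\<^sub>R (q - f p)" by (simp add: \<gamma>_def algebra_simps)
    then show ?thesis by (simp add: dist_norm L0_def norm_minus_commute abs_minus_commute)
  qed
  have cb: "cball p L \<subseteq> ball p \<rho>" using L by auto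
  let ?K0 = "({0..1} \<times> cball p L) \<inter> {x. dist p (snd x) \<le> L * fst x}"
  (* pairs (t, z) where z lies over the point at time t and has moved at most at speed L;
     this set is compact, so there is a last such time s *)
  define K where "K = {x\<in>?K0. f (snd x) - \<gamma> (fst x) = 0}"
  have K0: "compact ?K0"
    by (intro compact_Int_closed compact_Times closed_Collect_le continuous_intros) auto
  have "closed K" unfolding K_def
  proof (rule continuous_closed_preimage_constant)
    show "closed ?K0" using K0 by (rule compact_imp_closed)
    have "snd ` ?K0 \<subseteq> ball p \<rho>" using cb by auto
    then have "continuous_on ?K0 (\<lambda>x. f (snd x))"
      by (intro continuous_on_compose2[OF cont]) (auto intro!: continuous_intros)
    moreover have "continuous_on ?K0 (\<lambda>x. \<gamma> (fst x))"
      by (rule continuous_on_compose2[OF cont\<gamma>[of UNIV]]) (auto intro!: continuous_intros)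
    ultimately show "continuous_on ?K0 (\<lambda>x. f (snd x) - \<gamma> (fst x))" by (rule continuous_on_diff)
  qed
  moreover have "K \<subseteq> ?K0" by (auto simp: K_def)
  ultimately have "compact K" using K0 by (metis compact_Int_closed inf.absorb2)
  then have cS: "compact (fst ` K)" by (intro compact_continuous_image continuous_intros)
  have "(0, p) \<in> K" using L by (auto simp: K_def \<gamma>_def)
  then have ne: "fst ` K \<noteq> {}" by blast
  obtain s where s: "s \<in> fst ` K" "\<And>t. t \<in> fst ` K \<Longrightarrow> t \<le> s"
    using compact_attains_sup[OF cS ne] by blast
  obtain z where z: "(s, z) \<in> K" using s(1) by force
  have z': "0 \<le> s" "s \<le> 1" "dist p z \<le> L * s" "f z = \<gamma> s" "z \<in> ball p \<rho>"
    using z cb by (auto simp: K_def)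
  have "s = 1"
  proof (rule ccontr)
    assume "s \<noteq> 1"
    then have s1: "s < 1" using z' by simp
    let ?U = "f ` ball p \<rho>"
    have U: "open ?U" by (rule invariance_of_domain[OF cont _ inj]) simp
    obtain h where h: "homeomorphism (ball p \<rho>) ?U f h"
      using invariance_of_domain_homeomorphism[OF _ cont _ inj] by auto
    have hf: "h (f x) = x" if "x \<in> ball p \<rho>" for x using h that by (auto simp: homeomorphism_def)
    have fh: "f (h x) = x" "h x \<in> ball p \<rho>" if "x \<in> ?U" for x using h that by (auto simp: homeomorphism_def)
    have gsU: "\<gamma> s \<in> ?U" using z' by (metis imageI)
    have "isCont h (\<gamma> s)"
      using h U gsU by (auto simp: homeomorphism_def continuous_on_eq_continuous_at)
    moreover have "isCont \<gamma> s" using cont\<gamma>[of UNIV] by (simp add: continuous_on_eq_continuous_at)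
    ultimately have hc: "isCont (\<lambda>t. h (\<gamma> t)) s" by (rule isCont_o2[rotated])
    obtain D where D': "(f has_derivative D) (at z)" "\<And>v. c * norm v \<le> norm (D v)"
      using D[OF z'(5)] by blast
    obtain d where d: "0 < d" "\<And>y. norm (y - z) < d \<Longrightarrow> norm (f y - f z - D (y - z)) \<le> (c - c') * norm (y - z)"
      using D'(1) c' unfolding has_derivative_at_alt by (metis diff_gt_0_iff_gt)
    obtain d1 where d1: "0 < d1" "\<And>t. dist t s < d1 \<Longrightarrow> dist (h (\<gamma> t)) (h (\<gamma> s)) < d"
      using hc d(1) unfolding continuous_at_eps_delta by (metis dist_commute)
    have "open (\<gamma> -` ?U)" using cont\<gamma>[of UNIV] U by (simp add: continuous_on_open_vimage)
    then obtain d2 where d2: "0 < d2" "\<And>t. dist t s < d2 \<Longrightarrow> \<gamma> t \<in> ?U"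
      using gsU unfolding open_dist by (metis vimage_eq)
    (* a slightly later time that still belongs to K, contradicting the choice of s *)
    define t where "t = min 1 (s + min d1 d2 / 2)"
    have t: "s < t" "t \<le> 1" "dist t s < d1" "dist t s < d2"
      using s1 d1(1) d2(1) by (auto simp: t_def dist_real_def min_def)
    let ?z = "h (\<gamma> t)"
    have fz: "f ?z = \<gamma> t" using fh(1)[OF d2(2)[OF t(4)]] .
    have hs: "h (\<gamma> s) = z" using hf[OF z'(5)] z'(4) by simp
    have "norm (?z - z) < d" using d1(2)[OF t(3)] hs by (simp add: dist_norm)
    from d(2)[OF this] have "norm (D (?z - z)) \<le> norm (f ?z - f z) + (c - c') * norm (?z - z)"
      by (smt (verit) norm_triangle_sub norm_minus_commute)
    with D'(2)[of "?z - z"] have "c' * norm (?z - z) \<le> norm (f ?z - f z)" by (simp add: algebra_simps)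
    also have "norm (f ?z - f z) = (t - s) * L0"
      using dist\<gamma>[of t s] t z'(4) fz by (simp add: dist_norm)
    finally have "norm (?z - z) \<le> L * (t - s)" using c' by (simp add: L_def field_simps)
    then have "dist p ?z \<le> L * t"
      using z'(3) dist_triangle[of p ?z z] by (simp add: dist_norm norm_minus_commute algebra_simps)
    moreover have "L * t \<le> L * 1" using t L by (intro mult_left_mono) auto
    ultimately have "(t, ?z) \<in> K" using t z' fz by (auto simp: K_def)
    then have "t \<le> s" using s(2) by force
    then show False using t by simp
  qed
  then have "f z = q" using z' by (simp add: \<gamma>_def)
  then show "q \<in> f ` ball p \<rho>" using z' by blast
qed

definition conformal_at :: "('a::euclidean_space \<Rightarrow> 'a) \<Rightarrow> 'a \<Rightarrow> real \<Rightarrow> bool" where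
  "conformal_at f y c \<longleftrightarrow> 0 < c \<and> (\<exists>Q. orthogonal_transformation Q \<and> (f has_derivative (\<lambda>v. c *\<^sub>R Q v)) (at y))"

lemma conformal_at_id: "conformal_at id y 1"
  unfolding conformal_at_def
  by (intro conjI exI[of _ id]) (auto simp: orthogonal_transformation_id id_def)

lemma conformal_at_comp:
  assumes "conformal_at f y c" "conformal_at g (f y) d"
  shows "conformal_at (g \<circ> f) y (c * d)"
proof -
  obtain Q where Q: "orthogonal_transformation Q" "(f has_derivative (\<lambda>v. c *\<^sub>R Q v)) (at y)"
    using assms(1) unfolding conformal_at_def by blast
  obtain R where R: "orthogonal_transformation R" "(g has_derivative (\<lambda>v. d *\<^sub>R R v)) (at (f y))"
    using assms(2) unfolding conformal_at_def by blast
  have lin: "linear R" using R(1) by (simp add: orthogonal_transformation_def)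
  have "((g \<circ> f) has_derivative ((\<lambda>v. d *\<^sub>R R v) \<circ> (\<lambda>v. c *\<^sub>R Q v))) (at y)"
    by (rule diff_chain_at[OF Q(2) R(2)])
  moreover have "(\<lambda>v. d *\<^sub>R R v) \<circ> (\<lambda>v. c *\<^sub>R Q v) = (\<lambda>v. (c * d) *\<^sub>R (R \<circ> Q) v)"
    using linear_cmul[OF lin] by (auto simp: fun_eq_iff mult.commute)
  ultimately show ?thesis unfolding conformal_at_def
    using assms orthogonal_transformation_compose[OF R(1) Q(1)] by (auto simp: conformal_at_def)
qed

lemma conformal_at_deriv_norm:
  assumes "conformal_at f y c"
  shows "deriv_norm f y = c"
proof -
  obtain Q where Q: "orthogonal_transformation Q" "(f has_derivative (\<lambda>v. c *\<^sub>R Q v)) (at y)" and c: "0 < c"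
    using assms unfolding conformal_at_def by blast
  have nQ: "norm (c *\<^sub>R Q v) = c * norm v" for v
    using orthogonal_transformation_norm[OF Q(1)] c by simp
  have "onorm (\<lambda>v. c *\<^sub>R Q v) = c"
  proof (rule antisym)
    show "onorm (\<lambda>v. c *\<^sub>R Q v) \<le> c" by (rule onorm_bound) (use c nQ in auto)
    obtain b :: 'a where b: "b \<in> Basis" using nonempty_Basis by blast
    have "norm (c *\<^sub>R Q b) \<le> onorm (\<lambda>v. c *\<^sub>R Q v) * norm b"
      by (rule onorm[OF has_derivative_bounded_linear[OF Q(2)]])
    then show "c \<le> onorm (\<lambda>v. c *\<^sub>R Q v)" using nQ[of b] b by simp
  qed
  then show ?thesis unfolding deriv_norm_def using frechet_derivative_at[OF Q(2)] by simp
qed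

lemma conformal_at_le_lipschitz:
  assumes "conformal_at f y c" "open U" "y \<in> U"
    and lip: "\<And>z. z \<in> U \<Longrightarrow> norm (f z - f y) \<le> l * norm (z - y)"
  shows "c \<le> l"
proof (rule ccontr)
  assume "\<not> c \<le> l"
  then have e: "0 < (c - l) / 2" by simp
  obtain Q where Q: "orthogonal_transformation Q" "(f has_derivative (\<lambda>v. c *\<^sub>R Q v)) (at y)" and c: "0 < c"
    using assms unfolding conformal_at_def by blast
  obtain d where d: "0 < d" "\<And>z. norm (z - y) < d \<Longrightarrow> norm (f z - f y - c *\<^sub>R Q (z - y)) \<le> (c - l) / 2 * norm (z - y)"
    using Q(2) e unfolding has_derivative_at_alt by metis
  obtain d' where d': "0 < d'" "ball y d' \<subseteq> U" using assms(2,3) by (meson openE)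
  obtain b :: 'a where b: "b \<in> Basis" using nonempty_Basis by blast
  define r where "r = min d d' / 2"
  have r: "0 < r" "r < d" "r < d'" using d(1) d'(1) by (auto simp: r_def min_def)
  define z where "z = y + r *\<^sub>R b"
  have nz: "norm (z - y) = r" using r b by (simp add: z_def)
  have "z \<in> U" using d'(2) nz r by (auto simp: dist_norm norm_minus_commute)
  then have 1: "norm (f z - f y) \<le> l * r" using lip[of z] nz by simp
  have 2: "norm (f z - f y - c *\<^sub>R Q (z - y)) \<le> (c - l) / 2 * r" using d(2)[of z] nz r by simp
  have 3: "norm (c *\<^sub>R Q (z - y)) = c * r"
    using orthogonal_transformation_norm[OF Q(1), of "z - y"] c nz by simp
  have "c * r \<le> norm (f z - f y) + norm (f z - f y - c *\<^sub>R Q (z - y))"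
    using norm_triangle_ineq4[of "f z - f y" "f z - f y - c *\<^sub>R Q (z - y)"] 3 by simp
  then have "c * r \<le> l * r + (c - l) / 2 * r" using 1 2 by linarith
  then have "(c - l) / 2 * r \<le> 0" by (simp add: field_simps)
  then show False using e r mult_pos_pos[OF e r(1)] by linarith
qed

section \<open>Contracting conformal fibers\<close>

text \<open>All fibers are equal to \<open>Z\<close>. The neighborhoods \<open>U \<omega>\<close> of \<open>Z\<close> vary with \<open>\<omega>\<close> and no uniform bound on
their size is available, so all uniform estimates are made on \<open>Z\<close>; the neighborhoods only provide
derivatives at the boundary.\<close>

locale conformal_fibers =
  fixes Z :: "'a::euclidean_space set" and U :: "(nat \<Rightarrow> nat) \<Rightarrow> 'a set"
    and T :: "(nat \<Rightarrow> nat) \<Rightarrow> 'a \<Rightarrow> 'a" and l \<alpha> H :: real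
  assumes Z_compact: "compact Z" and Z_ne: "Z \<noteq> {}" and Z_regular: "closure (interior Z) = Z"
    and T_maps: "\<And>\<omega> z. \<omega> \<in> E2p \<Longrightarrow> z \<in> Z \<Longrightarrow> T \<omega> z \<in> Z"
    and U_open: "\<And>\<omega>. \<omega> \<in> E2p \<Longrightarrow> open (U \<omega>)"
    and Z_U: "\<And>\<omega>. \<omega> \<in> E2p \<Longrightarrow> Z \<subseteq> U \<omega>"
    and T_inj: "\<And>\<omega>. \<omega> \<in> E2p \<Longrightarrow> inj_on (T \<omega>) (U \<omega>)"
    and T_conformal: "\<And>\<omega> z. \<omega> \<in> E2p \<Longrightarrow> z \<in> U \<omega> \<Longrightarrow> \<exists>c. conformal_at (T \<omega>) z c"
    and l_gt_1: "1 < l"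
    and T_contracts: "\<And>\<omega> y z. \<omega> \<in> E2p \<Longrightarrow> y \<in> U \<omega> \<Longrightarrow> z \<in> U \<omega> \<Longrightarrow>
      norm (T \<omega> y - T \<omega> z) \<le> inverse l * norm (y - z)"
    and \<alpha>_pos: "0 < \<alpha>" and H_pos: "0 < H"
    and T_distortion: "\<And>\<omega> y z. \<omega> \<in> E2p \<Longrightarrow> y \<in> U \<omega> \<Longrightarrow> z \<in> U \<omega> \<Longrightarrow>
      \<bar>ln (deriv_norm (T \<omega>) y) - ln (deriv_norm (T \<omega>) z)\<bar> \<le> H * norm (y - z) powr \<alpha>"
    and T_disjoint: "\<And>\<omega> a b. a \<noteq> b \<Longrightarrow> case_nat a \<omega> \<in> E2p \<Longrightarrow> case_nat b \<omega> \<in> E2p \<Longrightarrow>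
      T (case_nat a \<omega>) ` interior Z \<inter> T (case_nat b \<omega>) ` interior Z = {}"
begin

abbreviation "pc \<equiv> past_comp T"
abbreviation "fp \<equiv> fiber_point (\<lambda>_. Z) T"

lemma T_conformal_deriv_norm:
  assumes "\<omega> \<in> E2p" "z \<in> Z"
  shows "conformal_at (T \<omega>) z (deriv_norm (T \<omega>) z)"
  using T_conformal[OF assms(1)] Z_U[OF assms(1)] assms(2) conformal_at_deriv_norm by (metis subsetD)

lemma deriv_norm_bounds:
  assumes "\<omega> \<in> E2p" "z \<in> Z"
  shows "0 < deriv_norm (T \<omega>) z" "deriv_norm (T \<omega>) z \<le> inverse l"
proof -
  show "0 < deriv_norm (T \<omega>) z" using T_conformal_deriv_norm[OF assms] by (simp add: conformal_at_def)
  show "deriv_norm (T \<omega>) z \<le> inverse l"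
    by (rule conformal_at_le_lipschitz[OF T_conformal_deriv_norm[OF assms] U_open[OF assms(1)]])
       (use assms Z_U T_contracts in blast)+
qed

lemma T_continuous: assumes "\<omega> \<in> E2p" shows "continuous_on Z (T \<omega>)"
proof (rule continuous_at_imp_continuous_on, rule ballI)
  fix z assume "z \<in> Z"
  then show "isCont (T \<omega>) z"
    using T_conformal_deriv_norm[OF assms] unfolding conformal_at_def
    by (metis has_derivative_continuous)
qed

lemma tail_shift_eq: "tail \<tau> (m - 1) = case_nat (\<tau> (m - 1)) (tail \<tau> m)"
  by (auto simp: tail_def fun_eq_iff split: nat.split)

lemma pc_maps: "\<tau> \<in> E2 \<Longrightarrow> z \<in> Z \<Longrightarrow> pc \<tau> n z \<in> Z"
  by (induction n arbitrary: z) (auto intro: T_maps tail_E2p)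

lemma pc_contracts:
  "\<tau> \<in> E2 \<Longrightarrow> y \<in> Z \<Longrightarrow> z \<in> Z \<Longrightarrow> norm (pc \<tau> n y - pc \<tau> n z) \<le> inverse l ^ n * norm (y - z)"
proof (induction n arbitrary: y z)
  case 0
  then show ?case by simp
next
  case (Suc n)
  let ?T = "T (tail \<tau> (- int (Suc n)))"
  have w: "tail \<tau> (- int (Suc n)) \<in> E2p" using Suc by (simp add: tail_E2p)
  have "norm (pc \<tau> (Suc n) y - pc \<tau> (Suc n) z) \<le> inverse l ^ n * norm (?T y - ?T z)"
    using Suc T_maps[OF w] by simp
  also have "\<dots> \<le> inverse l ^ n * (inverse l * norm (y - z))"
    using T_contracts[OF w, of y z] Z_U[OF w] Suc l_gt_1 by (intro mult_left_mono) auto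
  finally show ?case by (simp add: mult_ac)
qed

lemma pc_continuous: "\<tau> \<in> E2 \<Longrightarrow> continuous_on Z (pc \<tau> n)"
proof (induction n)
  case 0
  then show ?case by (simp add: continuous_on_id id_def)
next
  case (Suc n)
  have w: "tail \<tau> (- int (Suc n)) \<in> E2p" using Suc by (simp add: tail_E2p)
  show ?case unfolding past_comp.simps
    by (rule continuous_on_compose[OF T_continuous[OF w]], rule continuous_on_subset[OF Suc.IH])
       (use Suc T_maps[OF w] in auto)
qed

lemma pc_inj: "\<tau> \<in> E2 \<Longrightarrow> inj_on (pc \<tau> n) Z"
proof (induction n)
  case 0
  then show ?case by simp
next
  case (Suc n)
  have w: "tail \<tau> (- int (Suc n)) \<in> E2p" using Suc by (simp add: tail_E2p)
  show ?case unfolding past_comp.simps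
    by (rule comp_inj_on[OF inj_on_subset[OF T_inj[OF w] Z_U[OF w]]], rule inj_on_subset[OF Suc.IH])
       (use Suc T_maps[OF w] in auto)
qed

lemma pc_add: "pc \<tau> (n + m) = pc \<tau> n \<circ> pc (shift_by (- int n) \<tau>) m"
proof (induction m)
  case 0
  then show ?case by simp
next
  case (Suc m)
  have "- int (Suc (n + m)) = - int (Suc m) + - int n" by simp
  then show ?case using Suc by (simp only: add_Suc_right past_comp.simps tail_shift_by comp_assoc)
qed

lemma pc_cong:
  assumes "\<And>k. - int n \<le> k \<Longrightarrow> \<sigma> k = \<tau> k"
  shows "pc \<sigma> n = pc \<tau> n"
  using assms
proof (induction n)
  case 0
  then show ?case by simp
next
  case (Suc n)
  have "tail \<sigma> (- int (Suc n)) = tail \<tau> (- int (Suc n))"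
    using Suc(2) by (auto simp: tail_def fun_eq_iff)
  then show ?case using Suc by simp
qed

lemma pc_image_compact: "\<tau> \<in> E2 \<Longrightarrow> compact (pc \<tau> n ` Z)"
  by (intro compact_continuous_image pc_continuous Z_compact)

lemma pc_image_decreasing:
  assumes "\<tau> \<in> E2" "m \<le> n" shows "pc \<tau> n ` Z \<subseteq> pc \<tau> m ` Z"
proof -
  obtain k where n: "n = m + k" using assms(2) le_Suc_ex by blast
  show ?thesis unfolding n pc_add using pc_maps[of "shift_by (- int m) \<tau>"] assms(1) by auto
qed

lemma pc_image_unique:
  assumes "\<tau> \<in> E2" "\<And>n. 1 \<le> n \<Longrightarrow> x \<in> pc \<tau> n ` Z" "\<And>n. 1 \<le> n \<Longrightarrow> y \<in> pc \<tau> n ` Z"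
  shows "x = y"
proof (rule ccontr)
  assume "x \<noteq> y"
  have bd: "norm (x - y) \<le> inverse l ^ n * diameter Z" if n: "1 \<le> n" for n
  proof -
    obtain u v where uv: "u \<in> Z" "v \<in> Z" "x = pc \<tau> n u" "y = pc \<tau> n v" using assms(2,3)[OF n] by blast
    have "norm (x - y) \<le> inverse l ^ n * norm (u - v)" using pc_contracts[OF assms(1) uv(1,2)] uv by simp
    also have "\<dots> \<le> inverse l ^ n * diameter Z"
      using diameter_bounded_bound[OF compact_imp_bounded[OF Z_compact] uv(1,2)] l_gt_1
      by (intro mult_left_mono) (auto simp: dist_norm)
    finally show ?thesis .
  qed
  have "(\<lambda>n. inverse l ^ n * diameter Z) \<longlonglongrightarrow> 0 * diameter Z"
    by (intro tendsto_intros LIMSEQ_power_zero) (use l_gt_1 in \<open>simp add: inverse_less_1_iff\<close>)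
  then have "norm (x - y) \<le> 0 * diameter Z"
    by (rule LIMSEQ_le_const) (use bd in blast)
  then show False using \<open>x \<noteq> y\<close> by simp
qed

text \<open>Compactness of \<open>Z\<close> makes the nested images have a common point, and contraction makes it unique.\<close>

lemma fp_characterization:
  assumes \<tau>: "\<tau> \<in> E2"
  shows "fp \<tau> \<in> pc \<tau> n ` Z" and "(\<And>n. 1 \<le> n \<Longrightarrow> x \<in> pc \<tau> n ` Z) \<Longrightarrow> fp \<tau> = x"
proof -
  have cl: "closure (pc \<tau> n ` Z) = pc \<tau> n ` Z" for n
    using pc_image_compact[OF \<tau>] by (simp add: compact_imp_closed)
  have "(\<Inter>n. pc \<tau> n ` Z) \<noteq> {}"
  proof (rule compact_nest)
    show "compact (pc \<tau> n ` Z)" for n by (rule pc_image_compact[OF \<tau>])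
    show "pc \<tau> n ` Z \<noteq> {}" for n using Z_ne by simp
    show "pc \<tau> n ` Z \<subseteq> pc \<tau> m ` Z" if "m \<le> n" for m n by (rule pc_image_decreasing[OF \<tau> that])
  qed
  then obtain y where y: "\<And>n. y \<in> pc \<tau> n ` Z" by blast
  have fpy: "fp \<tau> = y"
    unfolding fiber_point_def cl
  proof (rule the_equality)
    show "y \<in> (\<Inter>n\<in>{1..}. pc \<tau> n ` Z)" using y by blast
    show "x = y" if "x \<in> (\<Inter>n\<in>{1..}. pc \<tau> n ` Z)" for x
      by (rule pc_image_unique[OF \<tau>]) (use that y in auto)
  qed
  show "fp \<tau> \<in> pc \<tau> n ` Z" unfolding fpy by (rule y)
  show "fp \<tau> = x" if "\<And>n. 1 \<le> n \<Longrightarrow> x \<in> pc \<tau> n ` Z"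
    unfolding fpy by (rule pc_image_unique[OF \<tau>]) (use that y in auto)
qed

lemma fp_in_Z: "\<tau> \<in> E2 \<Longrightarrow> fp \<tau> \<in> Z"
  using fp_characterization(1)[of \<tau> 0] by simp

lemma fp_past: assumes \<tau>: "\<tau> \<in> E2" shows "fp \<tau> = pc \<tau> n (fp (shift_by (- int n) \<tau>))"
proof (rule fp_characterization(2)[OF \<tau>])
  fix m :: nat
  let ?s = "shift_by (- int n) \<tau>"
  have "fp ?s \<in> pc ?s m ` Z" by (rule fp_characterization(1)) (use \<tau> in simp)
  then have "pc \<tau> n (fp ?s) \<in> pc \<tau> (n + m) ` Z" unfolding pc_add image_comp[symmetric] by blast
  then show "pc \<tau> n (fp ?s) \<in> pc \<tau> m ` Z" using pc_image_decreasing[OF \<tau>, of m "n + m"] by auto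
qed

text \<open>The last \<open>n\<close> steps of the past are common, and they contract at rate \<open>inverse l ^ n\<close>.\<close>

lemma fp_close:
  assumes "\<sigma> \<in> E2" "\<tau> \<in> E2" "\<And>k. - int n \<le> k \<Longrightarrow> \<sigma> k = \<tau> k"
  shows "norm (fp \<sigma> - fp \<tau>) \<le> inverse l ^ n * diameter Z"
proof -
  let ?u = "fp (shift_by (- int n) \<sigma>)" and ?v = "fp (shift_by (- int n) \<tau>)"
  have uv: "?u \<in> Z" "?v \<in> Z" using assms by (auto intro: fp_in_Z)
  have "norm (fp \<sigma> - fp \<tau>) = norm (pc \<tau> n ?u - pc \<tau> n ?v)"
    using fp_past[OF assms(1), of n] fp_past[OF assms(2), of n] pc_cong[of n \<sigma> \<tau>] assms(3) by simp
  also have "\<dots> \<le> inverse l ^ n * norm (?u - ?v)" by (rule pc_contracts[OF assms(2) uv])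
  also have "\<dots> \<le> inverse l ^ n * diameter Z"
    using diameter_bounded_bound[OF compact_imp_bounded[OF Z_compact] uv] l_gt_1
    by (intro mult_left_mono) (auto simp: dist_norm)
  finally show ?thesis .
qed

text \<open>The factor by which \<open>pc \<tau> n\<close> scales near \<open>z\<close>.\<close>

primrec pscale :: "(int \<Rightarrow> nat) \<Rightarrow> nat \<Rightarrow> 'a \<Rightarrow> real" where
  "pscale \<tau> 0 z = 1"
| "pscale \<tau> (Suc n) z = deriv_norm (T (tail \<tau> (- int (Suc n)))) z * pscale \<tau> n (T (tail \<tau> (- int (Suc n))) z)"

lemma pc_conformal: "\<tau> \<in> E2 \<Longrightarrow> z \<in> Z \<Longrightarrow> conformal_at (pc \<tau> n) z (pscale \<tau> n z)"
proof (induction n arbitrary: z)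
  case 0
  then show ?case by (simp add: conformal_at_id[unfolded id_def])
next
  case (Suc n)
  have w: "tail \<tau> (- int (Suc n)) \<in> E2p" using Suc by (simp add: tail_E2p)
  show ?case unfolding past_comp.simps pscale.simps
    by (rule conformal_at_comp[OF T_conformal_deriv_norm[OF w Suc.prems(2)] Suc.IH[OF Suc.prems(1) T_maps[OF w Suc.prems(2)]]])
qed

lemma pscale_pos: "\<tau> \<in> E2 \<Longrightarrow> z \<in> Z \<Longrightarrow> 0 < pscale \<tau> n z"
  using pc_conformal unfolding conformal_at_def by blast

definition distortion :: real where
  "distortion = H * diameter Z powr \<alpha> / (1 - inverse l powr \<alpha>)"

lemma ratio_lt_1: "0 < inverse l powr \<alpha>" "inverse l powr \<alpha> < 1"
  using l_gt_1 powr_less_mono2[OF \<alpha>_pos, of "inverse l" 1] by (auto simp: inverse_less_1_iff)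

text \<open>The distances between the two orbits decrease geometrically, so the distortions of the individual
maps add up to a geometric series.\<close>

lemma pscale_distortion_sum:
  "\<tau> \<in> E2 \<Longrightarrow> y \<in> Z \<Longrightarrow> z \<in> Z \<Longrightarrow>
    \<bar>ln (pscale \<tau> n y) - ln (pscale \<tau> n z)\<bar> \<le> H * norm (y - z) powr \<alpha> * (\<Sum>j<n. (inverse l powr \<alpha>) ^ j)"
proof (induction n arbitrary: y z)
  case 0
  then show ?case by simp
next
  case (Suc n)
  let ?\<theta> = "inverse l powr \<alpha>"
  let ?w = "tail \<tau> (- int (Suc n))"
  have w: "?w \<in> E2p" using Suc by (simp add: tail_E2p)
  have Ty: "T ?w y \<in> Z" "T ?w z \<in> Z" using T_maps[OF w] Suc by auto
  have S0: "0 \<le> (\<Sum>j<n. ?\<theta> ^ j)" by (intro sum_nonneg) auto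
  have "norm (T ?w y - T ?w z) powr \<alpha> \<le> (inverse l * norm (y - z)) powr \<alpha>"
    using T_contracts[OF w, of y z] Z_U[OF w] Suc \<alpha>_pos by (intro powr_mono2) auto
  also have "\<dots> = ?\<theta> * norm (y - z) powr \<alpha>" using l_gt_1 by (simp add: powr_mult)
  finally have c: "norm (T ?w y - T ?w z) powr \<alpha> \<le> ?\<theta> * norm (y - z) powr \<alpha>" .
  have "ln (pscale \<tau> (Suc n) x) = ln (deriv_norm (T ?w) x) + ln (pscale \<tau> n (T ?w x))" if "x \<in> Z" for x
    using deriv_norm_bounds(1)[OF w that] pscale_pos[OF Suc(2) T_maps[OF w that], of n]
    by (simp add: ln_mult)
  then have "\<bar>ln (pscale \<tau> (Suc n) y) - ln (pscale \<tau> (Suc n) z)\<bar>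
      \<le> \<bar>ln (deriv_norm (T ?w) y) - ln (deriv_norm (T ?w) z)\<bar> + \<bar>ln (pscale \<tau> n (T ?w y)) - ln (pscale \<tau> n (T ?w z))\<bar>"
    using Suc by simp
  also have "\<dots> \<le> H * norm (y - z) powr \<alpha> + H * norm (T ?w y - T ?w z) powr \<alpha> * (\<Sum>j<n. ?\<theta> ^ j)"
    using T_distortion[OF w, of y z] Z_U[OF w] Suc Ty by (intro add_mono) auto
  also have "\<dots> \<le> H * norm (y - z) powr \<alpha> + H * (?\<theta> * norm (y - z) powr \<alpha>) * (\<Sum>j<n. ?\<theta> ^ j)"
    using c S0 H_pos by (intro add_left_mono mult_right_mono mult_left_mono) auto
  also have "\<dots> = H * norm (y - z) powr \<alpha> * (1 + (\<Sum>j<n. ?\<theta> ^ Suc j))"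
    by (simp add: algebra_simps flip: sum_distrib_left)
  also have "1 + (\<Sum>j<n. ?\<theta> ^ Suc j) = (\<Sum>j<Suc n. ?\<theta> ^ j)"
    by (subst sum.lessThan_Suc_shift) simp
  finally show ?case .
qed

lemma pscale_distortion:
  assumes "\<tau> \<in> E2" "y \<in> Z" "z \<in> Z"
  shows "pscale \<tau> n y \<le> exp distortion * pscale \<tau> n z"
proof -
  let ?\<theta> = "inverse l powr \<alpha>"
  have "(\<Sum>j<n. ?\<theta> ^ j) \<le> 1 / (1 - ?\<theta>)"
    using ratio_lt_1 by (simp add: sum_gp_strict divide_right_mono)
  moreover have "norm (y - z) powr \<alpha> \<le> diameter Z powr \<alpha>"
    using diameter_bounded_bound[OF compact_imp_bounded[OF Z_compact] assms(2,3)] \<alpha>_pos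
    by (intro powr_mono2) (auto simp: dist_norm)
  ultimately have "H * norm (y - z) powr \<alpha> * (\<Sum>j<n. ?\<theta> ^ j) \<le> H * diameter Z powr \<alpha> * (1 / (1 - ?\<theta>))"
    using H_pos ratio_lt_1 by (intro mult_mono mult_left_mono) (auto intro!: sum_nonneg)
  then have "ln (pscale \<tau> n y) \<le> distortion + ln (pscale \<tau> n z)"
    using pscale_distortion_sum[OF assms, of n] unfolding distortion_def by simp
  then have "exp (ln (pscale \<tau> n y)) \<le> exp (distortion + ln (pscale \<tau> n z))" by simp
  then show ?thesis using pscale_pos assms by (simp add: exp_add)
qed

text \<open>As a function of the sequence, the potential whose Birkhoff sums are the logarithms of the scaling
factors at the points \<open>fp\<close>.\<close>

definition log_scale :: "(int \<Rightarrow> nat) \<Rightarrow> real" where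
  "log_scale \<tau> = ln (deriv_norm (T (tail \<tau> 0)) (fp \<tau>))"

lemma log_scale_le: assumes "\<tau> \<in> E2" shows "log_scale \<tau> \<le> - ln l"
proof -
  note b = deriv_norm_bounds[OF tail_E2p[OF assms] fp_in_Z[OF assms], of 0]
  have "log_scale \<tau> \<le> ln (inverse l)" unfolding log_scale_def using b l_gt_1 by simp
  then show ?thesis using l_gt_1 by (simp add: ln_inverse)
qed

lemma ln_pscale:
  assumes "\<tau> \<in> E2"
  shows "ln (pscale \<tau> n (fp (shift_by (- int n) \<tau>))) = (\<Sum>k<n. log_scale (shift_by (- int (Suc k)) \<tau>))"
proof (induction n)
  case 0
  then show ?case by simp
next
  case (Suc n)
  let ?s = "shift_by (- int (Suc n)) \<tau>"
  have s: "?s \<in> E2" using assms by (simp only: shift_by_E2)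
  have w: "tail ?s 0 \<in> E2p" by (rule tail_E2p[OF s])
  have t: "tail \<tau> (- int (Suc n)) = tail ?s 0" by simp
  have "fp (shift_by (- int n) \<tau>) = pc (shift_by (- int n) \<tau>) 1 (fp (shift_by (- int 1) (shift_by (- int n) \<tau>)))"
    by (rule fp_past) (use assms in simp)
  also have "\<dots> = T (tail ?s 0) (fp ?s)" by (simp add: algebra_simps)
  finally have f: "T (tail ?s 0) (fp ?s) = fp (shift_by (- int n) \<tau>)" by simp
  show ?case unfolding pscale.simps t f sum.lessThan_Suc Suc[symmetric]
    using deriv_norm_bounds(1)[OF w fp_in_Z[OF s]] pscale_pos[OF assms fp_in_Z, of "shift_by (- int n) \<tau>" n] assms
    by (simp add: ln_mult log_scale_def)
qed

lemma T_interior_open: assumes "\<omega> \<in> E2p" shows "open (T \<omega> ` interior Z)"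
proof -
  have "continuous_on (interior Z) (T \<omega>)" using T_continuous[OF assms] interior_subset by (rule continuous_on_subset)
  moreover have "inj_on (T \<omega>) (interior Z)"
    using T_inj[OF assms] by (rule inj_on_subset) (use Z_U[OF assms] interior_subset in blast)
  ultimately show ?thesis by (intro invariance_of_domain) auto
qed

lemma pc_interior: assumes "\<tau> \<in> E2" shows "pc \<tau> n ` interior Z \<subseteq> interior Z" "open (pc \<tau> n ` interior Z)"
proof -
  have "continuous_on (interior Z) (pc \<tau> n)" using pc_continuous[OF assms] interior_subset by (rule continuous_on_subset)
  moreover have "inj_on (pc \<tau> n) (interior Z)"
    using pc_inj[OF assms] interior_subset by (rule inj_on_subset)
  ultimately show o: "open (pc \<tau> n ` interior Z)" by (intro invariance_of_domain) auto
  show "pc \<tau> n ` interior Z \<subseteq> interior Z"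
    by (rule interior_maximal[OF _ o]) (use pc_maps[OF assms] interior_subset in blast)
qed

text \<open>Go back in time to the first digit at which the two pasts differ. Up to that time the same injective
maps were applied, so the open set condition there separates the open image of the interior from
the image of \<open>Z\<close>, which is in the closure of the other image of the interior.\<close>

proposition fp_in_open_image_agree:
  assumes \<tau>: "\<tau> \<in> E2" and \<sigma>: "\<sigma> \<in> E2" and tail: "tail \<tau> 0 = tail \<sigma> 0"
    and mem: "fp \<sigma> \<in> pc \<tau> n ` interior Z"
  shows "- int n \<le> k \<Longrightarrow> \<sigma> k = \<tau> k"
proof -
  have "j \<le> n \<Longrightarrow> \<forall>k\<ge>- int j. \<sigma> k = \<tau> k" for j
  proof (induction j)
    case 0
    have "\<sigma> k = \<tau> k" if "0 \<le> k" for k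
      using fun_cong[OF tail, of "nat k"] that by (simp add: tail_def)
    then show ?case by simp
  next
    case (Suc j)
    then have IH: "\<And>k. - int j \<le> k \<Longrightarrow> \<sigma> k = \<tau> k" by simp
    let ?w = "tail \<tau> (- int j)" and ?a = "\<tau> (- int j - 1)" and ?b = "\<sigma> (- int j - 1)"
    have ws: "tail \<sigma> (- int j) = ?w" using IH by (auto simp: tail_def fun_eq_iff)
    have wa: "tail \<tau> (- int j - 1) = case_nat ?a ?w" by (rule tail_shift_eq)
    have wb: "tail \<sigma> (- int j - 1) = case_nat ?b ?w" using tail_shift_eq[of \<sigma> "- int j"] ws by simp
    have Ea: "case_nat ?a ?w \<in> E2p" using tail_E2p[OF \<tau>] wa by metis
    have Eb: "case_nat ?b ?w \<in> E2p" using tail_E2p[OF \<sigma>] wb by metis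
    let ?u = "fp (shift_by (- int j) \<sigma>)"
    have "?a = ?b"
    proof (rule ccontr)
      assume ab: "?a \<noteq> ?b"
      let ?V = "T (case_nat ?a ?w) ` interior Z" and ?W = "T (case_nat ?b ?w) ` interior Z"
      have u: "?u \<in> Z" using \<sigma> by (simp add: fp_in_Z)
      obtain m where n: "n = j + Suc m" using Suc.prems by (metis add_Suc_right le_Suc_ex add_Suc)
      let ?s = "shift_by (- int j) \<tau>"
      have s: "?s \<in> E2" using \<tau> by simp
      have "tail ?s (- 1) = case_nat ?a ?w" unfolding wa[symmetric] tail_shift_by
        by (rule arg_cong[of _ _ "tail \<tau>"]) simp
      then have "pc ?s 1 = T (case_nat ?a ?w)" by (simp del: tail_shift_by)
      then have s1: "pc ?s (Suc m) = T (case_nat ?a ?w) \<circ> pc (shift_by (- 1) ?s) m"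
        using pc_add[of ?s 1 m] by (simp only: plus_1_eq_Suc of_nat_1)
      have "fp \<sigma> = pc \<tau> j ?u" using fp_past[OF \<sigma>, of j] pc_cong[of j \<sigma> \<tau>] IH by simp
      then obtain x where x: "x \<in> interior Z" "pc \<tau> j ?u = pc \<tau> j (pc ?s (Suc m) x)"
        using mem unfolding n pc_add by auto
      have "pc ?s (Suc m) x \<in> Z" using pc_maps[OF s] x(1) interior_subset by blast
      then have "?u = pc ?s (Suc m) x" using inj_onD[OF pc_inj[OF \<tau>] x(2) u] by blast
      then have "?u = T (case_nat ?a ?w) (pc (shift_by (- 1) ?s) m x)" by (simp only: s1 o_apply)
      moreover have "pc (shift_by (- 1) ?s) m x \<in> interior Z"
        using pc_interior(1)[of "shift_by (- 1) ?s" m] s x(1) by auto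
      ultimately have uV: "?u \<in> ?V" by (rule image_eqI)
      let ?t = "shift_by (- int j) \<sigma>"
      have "?u = pc ?t 1 (fp (shift_by (- int 1) ?t))" by (rule fp_past) (use \<sigma> in simp)
      also have "pc ?t 1 = T (case_nat ?b ?w)"
      proof -
        have "tail ?t (- 1) = case_nat ?b ?w" unfolding wb[symmetric] tail_shift_by
          by (rule arg_cong[of _ _ "tail \<sigma>"]) simp
        then show ?thesis by (simp del: tail_shift_by)
      qed
      finally have uW: "?u = T (case_nat ?b ?w) (fp (shift_by (- int 1) ?t))" .
      have "fp (shift_by (- int 1) ?t) \<in> closure (interior Z)"
        unfolding Z_regular by (rule fp_in_Z) (use \<sigma> in simp)
      with uW have "?u \<in> T (case_nat ?b ?w) ` closure (interior Z)" by (rule image_eqI)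
      moreover have "T (case_nat ?b ?w) ` closure (interior Z) \<subseteq> closure ?W"
        by (rule image_closure_subset[OF _ closed_closure closure_subset]) (use T_continuous[OF Eb] Z_regular in simp)
      ultimately have "?u \<in> closure ?W" by blast
      moreover have "?V \<inter> closure ?W = {}"
        using T_disjoint[OF ab Ea Eb] open_Int_closure_eq_empty[OF T_interior_open[OF Ea]] by blast
      ultimately show False using uV by blast
    qed
    have "\<sigma> k = \<tau> k" if "- int (Suc j) \<le> k" for k
    proof (cases "k = - int j - 1")
      case True
      then show ?thesis using \<open>?a = ?b\<close> by simp
    next
      case False
      then show ?thesis using IH that by auto
    qed
    then show ?case by blast
  qed
  then show "- int n \<le> k \<Longrightarrow> \<sigma> k = \<tau> k" by blast
qed

text \<open>The mean value inequality needs a convex domain, here a ball in \<open>Z\<close>.\<close>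

lemma pc_ball_lipschitz:
  assumes \<tau>: "\<tau> \<in> E2" and sub: "ball p \<delta> \<subseteq> Z" and z: "z \<in> ball p \<delta>"
  shows "norm (pc \<tau> n z - pc \<tau> n p) \<le> exp distortion * pscale \<tau> n p * norm (z - p)"
proof -
  have "0 < \<delta>" using z by (metis ball_empty empty_iff not_less)
  then have p: "p \<in> ball p \<delta>" by simp
  have "\<forall>x\<in>ball p \<delta>. \<exists>D. (pc \<tau> n has_derivative D) (at x within ball p \<delta>) \<and> onorm D \<le> exp distortion * pscale \<tau> n p"
  proof
    fix x assume x: "x \<in> ball p \<delta>"
    then have xZ: "x \<in> Z" using sub by blast
    have pZ: "p \<in> Z" using p sub by blast
    obtain Q where Q: "orthogonal_transformation Q" "(pc \<tau> n has_derivative (\<lambda>v. pscale \<tau> n x *\<^sub>R Q v)) (at x)"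
      using pc_conformal[OF \<tau> xZ] unfolding conformal_at_def by blast
    have "onorm (\<lambda>v. pscale \<tau> n x *\<^sub>R Q v) \<le> pscale \<tau> n x"
      by (rule onorm_bound) (use pscale_pos[OF \<tau> xZ, of n] orthogonal_transformation_norm[OF Q(1)] in auto)
    also have "\<dots> \<le> exp distortion * pscale \<tau> n p" by (rule pscale_distortion[OF \<tau> xZ pZ])
    finally show "\<exists>D. (pc \<tau> n has_derivative D) (at x within ball p \<delta>) \<and> onorm D \<le> exp distortion * pscale \<tau> n p"
      using has_derivative_at_withinI[OF Q(2)] by blast
  qed
  then obtain D where D: "\<And>x. x \<in> ball p \<delta> \<Longrightarrow> (pc \<tau> n has_derivative D x) (at x within ball p \<delta>)"
    "\<And>x. x \<in> ball p \<delta> \<Longrightarrow> onorm (D x) \<le> exp distortion * pscale \<tau> n p" by metis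
  show ?thesis by (rule differentiable_bound[OF convex_ball D z p])
qed

text \<open>By bounded distortion the derivative is bounded below on the ball, so \<open>ball_subset_image\<close> applies.\<close>

lemma pc_ball_covers:
  assumes \<tau>: "\<tau> \<in> E2" and sub: "ball p \<delta> \<subseteq> Z" and \<delta>: "0 < \<delta>"
  shows "ball (pc \<tau> n p) (exp (- distortion) * pscale \<tau> n p * \<delta>) \<subseteq> pc \<tau> n ` interior Z"
proof -
  have pZ: "p \<in> Z" using sub \<delta> by (meson centre_in_ball subsetD)
  have "ball (pc \<tau> n p) (exp (- distortion) * pscale \<tau> n p * \<delta>) \<subseteq> pc \<tau> n ` ball p \<delta>"
  proof (rule ball_subset_image)
    show "continuous_on (ball p \<delta>) (pc \<tau> n)" using pc_continuous[OF \<tau>] sub by (rule continuous_on_subset)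
    show "inj_on (pc \<tau> n) (ball p \<delta>)" using pc_inj[OF \<tau>] sub by (rule inj_on_subset)
    show "0 < exp (- distortion) * pscale \<tau> n p" using pscale_pos[OF \<tau> pZ] by simp
    fix x assume "x \<in> ball p \<delta>"
    then have xZ: "x \<in> Z" using sub by blast
    obtain Q where Q: "orthogonal_transformation Q" "(pc \<tau> n has_derivative (\<lambda>v. pscale \<tau> n x *\<^sub>R Q v)) (at x)"
      using pc_conformal[OF \<tau> xZ] unfolding conformal_at_def by blast
    have "exp (- distortion) * pscale \<tau> n p \<le> pscale \<tau> n x"
      using pscale_distortion[OF \<tau> pZ xZ, of n] by (simp add: exp_minus field_simps)
    then have "exp (- distortion) * pscale \<tau> n p * norm v \<le> norm (pscale \<tau> n x *\<^sub>R Q v)" for v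
      using pscale_pos[OF \<tau> xZ, of n] orthogonal_transformation_norm[OF Q(1), of v]
      by (simp add: mult_right_mono)
    then show "\<exists>D. (pc \<tau> n has_derivative D) (at x) \<and> (\<forall>v. exp (- distortion) * pscale \<tau> n p * norm v \<le> norm (D v))"
      using Q(2) by blast
  qed
  moreover have "ball p \<delta> \<subseteq> interior Z" using sub by (intro interior_maximal) auto
  ultimately show ?thesis by blast
qed

end

section \<open>Pointwise bounds from integrated bounds\<close>

lemma zero_of_mult_le:
  fixes x :: real
  assumes "b * x \<le> a * x" "a < b" "0 \<le> x"
  shows "x = 0"
proof (rule ccontr)
  assume "x \<noteq> 0"
  then have "a * x < b * x" using assms by (intro mult_strict_right_mono) auto
  then show False using assms by simp
qed

lemma (in finite_measure) AE_ge_of_integral_ge: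
  fixes f :: "'a \<Rightarrow> real"
  assumes [measurable]: "f \<in> borel_measurable M" "G \<in> sets M" and f0: "\<And>x. 0 \<le> f x"
    and le: "\<And>B. B \<in> sets M \<Longrightarrow> B \<subseteq> G \<Longrightarrow> ennreal c * emeasure M B \<le> (\<integral>\<^sup>+x. ennreal (f x) * indicator B x \<partial>M)"
  shows "AE x in M. x \<in> G \<longrightarrow> c \<le> f x"
proof (cases "c \<le> 0")
  case True
  then show ?thesis using f0 order_trans by blast
next
  case c: False
  have "AE x in M. \<forall>j::nat. x \<in> G \<longrightarrow> c - 1 / Suc j \<le> f x"
  proof (subst AE_all_countable, intro allI)
    fix j :: nat
    let ?B = "{x\<in>space M. x \<in> G \<and> f x < c - 1 / Suc j}"
    have B[measurable]: "?B \<in> sets M" by measurable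
    have "ennreal c * emeasure M ?B \<le> (\<integral>\<^sup>+x. ennreal (f x) * indicator ?B x \<partial>M)"
      by (rule le) auto
    also have "\<dots> \<le> (\<integral>\<^sup>+x. ennreal (c - 1 / Suc j) * indicator ?B x \<partial>M)"
      by (intro nn_integral_mono) (auto split: split_indicator intro!: ennreal_leI)
    also have "\<dots> = ennreal (max 0 (c - 1 / Suc j)) * emeasure M ?B"
      by (simp add: nn_integral_cmult_indicator ennreal_max_0)
    finally have "ennreal (c * measure M ?B) \<le> ennreal (max 0 (c - 1 / Suc j) * measure M ?B)"
      using c by (simp add: emeasure_eq_measure ennreal_mult)
    then have "c * measure M ?B \<le> max 0 (c - 1 / Suc j) * measure M ?B"
      by (subst (asm) ennreal_le_iff) auto
    moreover have "max 0 (c - 1 / Suc j) < c" using c by simp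
    ultimately have "measure M ?B = 0" by (rule zero_of_mult_le) simp
    then have "emeasure M ?B = 0" by (simp add: emeasure_eq_measure)
    then have "AE x in M. x \<notin> ?B" by (intro AE_not_in) (auto simp: null_sets_def)
    then show "AE x in M. x \<in> G \<longrightarrow> c - 1 / Suc j \<le> f x"
      by (rule AE_mp) (auto intro!: AE_I2)
  qed
  then show ?thesis
  proof eventually_elim
    case (elim x)
    show ?case
    proof
      assume "x \<in> G"
      then have "\<And>j::nat. c - 1 / Suc j \<le> f x" using elim by blast
      moreover have "(\<lambda>j. c - 1 / real (Suc j)) \<longlonglongrightarrow> c - 0"
        by (intro tendsto_diff tendsto_const LIMSEQ_Suc lim_1_over_n)
      ultimately show "c \<le> f x" using LIMSEQ_le_const2 by fastforce
    qed
  qed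
qed

lemma (in finite_measure) AE_le_of_integral_le:
  fixes f :: "'a \<Rightarrow> real"
  assumes [measurable]: "f \<in> borel_measurable M" and f1: "\<And>x. 0 \<le> f x" "\<And>x. f x \<le> 1" and c: "0 \<le> c"
    and le: "\<And>B. B \<in> sets M \<Longrightarrow> (\<integral>\<^sup>+x. ennreal (f x) * indicator B x \<partial>M) \<le> ennreal c * emeasure M B"
  shows "AE x in M. f x \<le> c"
proof -
  have "AE x in M. \<forall>j::nat. f x \<le> c + 1 / Suc j"
  proof (subst AE_all_countable, intro allI)
    fix j :: nat
    let ?B = "{x\<in>space M. c + 1 / Suc j < f x}"
    have B[measurable]: "?B \<in> sets M" by measurable
    have "ennreal (c + 1 / Suc j) * emeasure M ?B = (\<integral>\<^sup>+x. ennreal (c + 1 / Suc j) * indicator ?B x \<partial>M)"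
      by (simp add: nn_integral_cmult_indicator)
    also have "\<dots> \<le> (\<integral>\<^sup>+x. ennreal (f x) * indicator ?B x \<partial>M)"
      by (intro nn_integral_mono) (auto split: split_indicator intro!: ennreal_leI)
    also have "\<dots> \<le> ennreal c * emeasure M ?B" by (rule le) auto
    finally have "ennreal ((c + 1 / Suc j) * measure M ?B) \<le> ennreal (c * measure M ?B)"
      using c by (simp add: emeasure_eq_measure ennreal_mult)
    then have "(c + 1 / Suc j) * measure M ?B \<le> c * measure M ?B"
      by (subst (asm) ennreal_le_iff) (use c in auto)
    moreover have "c < c + 1 / Suc j" by simp
    ultimately have "measure M ?B = 0" by (rule zero_of_mult_le) simp
    then have "emeasure M ?B = 0" by (simp add: emeasure_eq_measure)
    then have "AE x in M. x \<notin> ?B" by (intro AE_not_in) (auto simp: null_sets_def)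
    then show "AE x in M. f x \<le> c + 1 / Suc j"
      by (rule AE_mp) (auto intro!: AE_I2)
  qed
  then show ?thesis
  proof eventually_elim
    case (elim x)
    moreover have "(\<lambda>j. c + 1 / real (Suc j)) \<longlonglongrightarrow> c + 0"
      by (intro tendsto_add tendsto_const LIMSEQ_Suc lim_1_over_n)
    ultimately show ?case using LIMSEQ_le_const by fastforce
  qed
qed

section \<open>Conditional masses of the pieces of a fiber\<close>

text \<open>The sequence with future \<open>\<omega>\<close>, whose past starts with the list \<open>ys\<close> (most recent digit first) and
continues with zeros. These are countably many pasts for each future, and they are dense, which
makes events about fibers measurable.\<close>

definition join :: "nat list \<Rightarrow> (nat \<Rightarrow> nat) \<Rightarrow> int \<Rightarrow> nat" where
  "join ys \<omega> i = (if 0 \<le> i then \<omega> (nat i) else if nat (- 1 - i) < length ys then ys ! nat (- 1 - i) else 0)"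

lemma join_measurable[measurable]: "join ys \<in> borel_measurable borel"
proof (rule measurable_coordinatewise_then_product)
  fix i
  show "(\<lambda>\<omega>. join ys \<omega> i) \<in> borel_measurable borel"
    unfolding join_def by (cases "0 \<le> i") simp_all
qed

lemma tail_join[simp]: "tail (join ys \<omega>) 0 = \<omega>"
  by (simp add: tail_def join_def fun_eq_iff)

definition recent :: "(int \<Rightarrow> nat) \<Rightarrow> nat \<Rightarrow> nat list" where
  "recent \<tau> n = map (\<lambda>k. \<tau> (- 1 - int k)) [0..<n]"

lemma length_recent[simp]: "length (recent \<tau> n) = n"
  by (simp add: recent_def)

lemma nth_recent[simp]: "k < n \<Longrightarrow> recent \<tau> n ! k = \<tau> (- 1 - int k)"
  by (simp add: recent_def)

lemma join_recent: "join (recent \<tau> n) (tail \<tau> 0) = (\<lambda>k. if k < - int n then 0 else \<tau> k)"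
proof
  fix k
  show "join (recent \<tau> n) (tail \<tau> 0) k = (if k < - int n then 0 else \<tau> k)"
    by (cases "0 \<le> k"; cases "k < - int n") (auto simp: join_def tail_def)
qed

lemma join_recent_E2: "\<tau> \<in> E2 \<Longrightarrow> join (recent \<tau> n) (tail \<tau> 0) \<in> E2"
  unfolding join_recent using glue_E2[OF zero_E2, of \<tau> "- int n"] by simp

definition past_cyl :: "nat list \<Rightarrow> (int \<Rightarrow> nat) set" where
  "past_cyl xs = {\<tau>\<in>E2. \<forall>k<length xs. \<tau> (- 1 - int k) = xs ! k}"

lemma past_cyl_agree:
  assumes "\<tau> \<in> past_cyl (recent \<sigma> n)" "tail \<tau> 0 = tail \<sigma> 0" "- int n \<le> k"
  shows "\<tau> k = \<sigma> k"
proof (cases "0 \<le> k")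
  case True
  then show ?thesis using fun_cong[OF assms(2), of "nat k"] by (simp add: tail_def)
next
  case False
  define j where "j = nat (- 1 - k)"
  have j: "j < n" "- 1 - int j = k" using assms(3) False by (auto simp: j_def)
  from assms(1) j(1) have "\<tau> (- 1 - int j) = \<sigma> (- 1 - int j)" by (simp add: past_cyl_def)
  then show ?thesis using j by simp
qed

lemma past_cyl_eq_cyl:
  assumes "\<sigma> \<in> past_cyl xs"
  shows "past_cyl xs = cyl (- int (length xs)) 0 \<sigma>"
proof -
  have "(\<forall>k<length xs. \<tau> (- 1 - int k) = xs ! k) \<longleftrightarrow> (\<forall>k. - int (length xs) \<le> k \<and> k < 0 \<longrightarrow> \<tau> k = \<sigma> k)" for \<tau>
  proof (intro iffI allI impI)
    fix k assume *: "\<forall>k<length xs. \<tau> (- 1 - int k) = xs ! k" "- int (length xs) \<le> k \<and> k < 0"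
    define j where "j = nat (- 1 - k)"
    have j: "j < length xs" "- 1 - int j = k" using *(2) by (auto simp: j_def)
    have "\<tau> k = xs ! j" using *(1) j by blast
    moreover have "\<sigma> k = xs ! j" using assms j by (auto simp: past_cyl_def)
    ultimately show "\<tau> k = \<sigma> k" by simp
  next
    fix k assume *: "\<forall>k. - int (length xs) \<le> k \<and> k < 0 \<longrightarrow> \<tau> k = \<sigma> k" "k < length xs"
    then have "\<tau> (- 1 - int k) = \<sigma> (- 1 - int k)" by simp
    with *(2) assms show "\<tau> (- 1 - int k) = xs ! k" by (simp add: past_cyl_def)
  qed
  then show ?thesis by (auto simp: past_cyl_def cyl_def)
qed

lemma recent_past_cyl: "\<tau> \<in> E2 \<Longrightarrow> \<tau> \<in> past_cyl (recent \<tau> n)"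
  by (simp add: past_cyl_def)

lemma past_cyl_measurable[measurable]: "past_cyl xs \<in> sets borel"
proof -
  have "{\<tau>\<in>space borel. \<tau> \<in> E2 \<and> (\<forall>k. k < length xs \<longrightarrow> \<tau> (- 1 - int k) = xs ! k)} \<in> sets borel" by measurable
  then show ?thesis by (simp add: past_cyl_def)
qed

text \<open>The map \<open>\<pi>\<close> is a Borel version of \<open>fp\<close>, which is specified only on admissible sequences.\<close>

locale fibered_gibbs = gibbs_measure M \<psi> C P + conformal_fibers Z U T l \<alpha> H
  for M \<psi> C P and Z :: "'a::euclidean_space set" and U T l \<alpha> H +
  fixes K :: "real \<Rightarrow> 'a measure" and \<pi> :: "(int \<Rightarrow> nat) \<Rightarrow> 'a"
  assumes \<pi>_measurable[measurable]: "\<pi> \<in> borel_measurable borel"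
    and \<pi>_fp: "\<And>\<tau>. \<tau> \<in> E2 \<Longrightarrow> \<pi> \<tau> = fp \<tau>"
    and K_conditionals: "fiber_conditionals (distr M borel (\<lambda>\<tau>. (coding (tail \<tau> 0), \<pi> \<tau>))) K"
    and interior_point: "\<And>\<omega>. \<omega> \<in> E2p \<Longrightarrow> \<exists>\<tau>\<in>E2. tail \<tau> 0 = \<omega> \<and> fp \<tau> \<in> interior Z"
begin

lemma K_measurable[measurable]: "K \<in> measurable borel (prob_algebra borel)"
  using K_conditionals by (simp add: fiber_conditionals_def)

lemma K_prob: "prob_space (K x)" and sets_K: "sets (K x) = sets borel"
  using measurable_space[OF K_measurable, of x] by (auto simp: space_prob_algebra)

definition future :: "(nat \<Rightarrow> nat) measure" where
  "future = distr M borel (\<lambda>\<tau>. tail \<tau> 0)"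

lemma sets_future[measurable_cong]: "sets future = sets borel" by (simp add: future_def)

lemma space_future[simp]: "space future = UNIV" by (simp add: future_def)

lemma future_prob: "prob_space future"
  unfolding future_def by (rule prob_space_distr) measurable

lemma AE_future: "(AE \<omega> in future. Q \<omega>) \<Longrightarrow> (AE \<tau> in M. Q (tail \<tau> 0))"
  unfolding future_def using AE_distrD[of "\<lambda>\<tau>. tail \<tau> 0" M borel Q] by simp

lemma AE_future_E2p: "AE \<omega> in future. \<omega> \<in> E2p"
proof -
  have "E2p \<in> sets borel"
  proof -
    have "{\<omega>\<in>space borel. (\<forall>n::nat. \<omega> n \<in> {0, 1::nat}) \<and> (\<forall>n. \<not> (\<omega> n = 1 \<and> \<omega> (Suc n) = 1))} \<in> sets borel"
      by measurable
    then show ?thesis by (simp add: E2p_def)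
  qed
  then show ?thesis unfolding future_def
    by (subst AE_distr_iff) (use E2_full tail_E2p in \<open>auto elim: eventually_mono\<close>)
qed

text \<open>The conditional measures over \<open>x\<close> disintegrate the joint law of future and fiber point, because
\<open>x\<close> determines the future almost surely.\<close>

proposition conditional_disintegration:
  assumes A[measurable]: "A \<in> sets (borel \<Otimes>\<^sub>M borel)"
  shows "emeasure M {\<tau>. (tail \<tau> 0, \<pi> \<tau>) \<in> A} = (\<integral>\<^sup>+\<omega>. emeasure (K (coding \<omega>)) (Pair \<omega> -` A) \<partial>future)"
proof -
  let ?A = "{p. (greedy_digits (fst p), snd p) \<in> A}"
  let ?\<mu> = "distr M borel (\<lambda>\<tau>. (coding (tail \<tau> 0), \<pi> \<tau>))"
  have "(\<lambda>p::real \<times> 'a. (greedy_digits (fst p), snd p)) \<in> measurable (borel \<Otimes>\<^sub>M borel) (borel \<Otimes>\<^sub>M borel)"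
    by measurable
  from measurable_sets[OF this A] have A2: "?A \<in> sets (borel \<Otimes>\<^sub>M borel)"
    by (simp add: vimage_def space_pair_measure)
  then have A': "?A \<in> sets (borel :: (real \<times> 'a) measure)" by (subst borel_prod[symmetric])
  have m\<mu>: "(\<lambda>\<tau>. (coding (tail \<tau> 0), \<pi> \<tau>)) \<in> measurable M borel" by measurable
  have mA: "{\<tau>. (tail \<tau> 0, \<pi> \<tau>) \<in> A} \<in> sets borel"
  proof -
    have "(\<lambda>\<tau>. (tail \<tau> 0, \<pi> \<tau>)) \<in> measurable borel (borel \<Otimes>\<^sub>M borel)" by measurable
    from measurable_sets[OF this A] show ?thesis by (simp add: vimage_def)
  qed
  have "{\<omega>\<in>space borel. \<forall>n. greedy_digits (coding \<omega>) n = \<omega> n} \<in> sets borel" by measurable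
  then have "{\<omega>. greedy_digits (coding \<omega>) = \<omega>} \<in> sets borel" by (simp add: fun_eq_iff)
  then have dec: "AE \<omega> in future. greedy_digits (coding \<omega>) = \<omega>"
    unfolding future_def by (subst AE_distr_iff) (use AE_greedy_digits in auto)
  have "emeasure M {\<tau>. (tail \<tau> 0, \<pi> \<tau>) \<in> A} = emeasure M {\<tau>. (coding (tail \<tau> 0), \<pi> \<tau>) \<in> ?A}"
  proof (rule emeasure_eq_AE)
    show "AE \<tau> in M. \<tau> \<in> {\<tau>. (tail \<tau> 0, \<pi> \<tau>) \<in> A} \<longleftrightarrow> \<tau> \<in> {\<tau>. (coding (tail \<tau> 0), \<pi> \<tau>) \<in> ?A}"
      using AE_greedy_digits by eventually_elim simp
    show "{\<tau>. (tail \<tau> 0, \<pi> \<tau>) \<in> A} \<in> sets M" using mA by (simp add: sets_M)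
    show "{\<tau>. (coding (tail \<tau> 0), \<pi> \<tau>) \<in> ?A} \<in> sets M"
      using measurable_sets[OF m\<mu> A'] by (simp add: vimage_def)
  qed
  also have "\<dots> = emeasure ?\<mu> ?A"
    by (subst emeasure_distr[OF m\<mu> A']) (simp add: vimage_def)
  also have "\<dots> = (\<integral>\<^sup>+x. emeasure (K x) (Pair x -` ?A) \<partial>(distr ?\<mu> borel fst))"
    using K_conditionals A' unfolding fiber_conditionals_def by blast
  also have "distr ?\<mu> borel fst = distr future borel coding"
    using borel_measurable_continuous_onI[OF continuous_on_fst[OF continuous_on_id]]
    unfolding future_def by (subst (1 2) distr_distr) (auto simp: comp_def)
  also have "(\<integral>\<^sup>+x. emeasure (K x) (Pair x -` ?A) \<partial>(distr future borel coding))
      = (\<integral>\<^sup>+\<omega>. emeasure (K (coding \<omega>)) (Pair (coding \<omega>) -` ?A) \<partial>future)"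
  proof (rule nn_integral_distr)
    show "coding \<in> measurable future borel" by measurable
    have "(SIGMA x:space borel. Pair x -` ?A) = ?A" by auto
    with A2 have "(SIGMA x:space borel. Pair x -` ?A) \<in> sets (borel \<Otimes>\<^sub>M borel)" by simp
    then have "(\<lambda>x. emeasure (K x) (Pair x -` ?A)) \<in> borel_measurable borel"
      by (rule emeasure_measurable_subprob_algebra2[OF _ measurable_prob_algebraD[OF K_measurable]])
    then show "(\<lambda>x. emeasure (K x) (Pair x -` ?A)) \<in> borel_measurable (distr future borel coding)"
      by simp
  qed
  also have "\<dots> = (\<integral>\<^sup>+\<omega>. emeasure (K (coding \<omega>)) (Pair \<omega> -` A) \<partial>future)"
  proof (rule nn_integral_cong_AE)
    show "AE \<omega> in future. emeasure (K (coding \<omega>)) (Pair (coding \<omega>) -` ?A) = emeasure (K (coding \<omega>)) (Pair \<omega> -` A)"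
      using dec
    proof eventually_elim
      case (elim \<omega>)
      then have "Pair (coding \<omega>) -` ?A = Pair \<omega> -` A" by auto
      then show ?case by simp
    qed
  qed
  finally show ?thesis .
qed

definition in_piece :: "nat list \<Rightarrow> nat list \<Rightarrow> (nat \<Rightarrow> nat) \<Rightarrow> bool" where
  "in_piece xs ys \<omega> \<longleftrightarrow> join ys \<omega> \<in> past_cyl xs"

text \<open>Over each \<open>\<omega>\<close>, the closure of the points of the fiber whose past starts with \<open>xs\<close>. Taking the
closure of the countable family of \<open>join\<close> points gives a Borel set.\<close>

definition piece :: "nat list \<Rightarrow> ((nat \<Rightarrow> nat) \<times> 'a) set" where
  "piece xs = {(\<omega>, z). \<forall>j::nat. \<exists>ys. in_piece xs ys \<omega> \<and> dist z (\<pi> (join ys \<omega>)) < 1 / Suc j}"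

lemma piece_measurable[measurable]: "piece xs \<in> sets (borel \<Otimes>\<^sub>M borel)"
proof -
  have [measurable]: "Measurable.pred borel (in_piece xs ys)" for ys
    unfolding in_piece_def by measurable
  have "{p\<in>space (borel \<Otimes>\<^sub>M borel). \<forall>j::nat. \<exists>ys. in_piece xs ys (fst p) \<and> dist (snd p) (\<pi> (join ys (fst p))) < 1 / Suc j}
      \<in> sets (borel \<Otimes>\<^sub>M borel)"
    by measurable
  also have "{p\<in>space (borel \<Otimes>\<^sub>M borel). \<forall>j::nat. \<exists>ys. in_piece xs ys (fst p) \<and> dist (snd p) (\<pi> (join ys (fst p))) < 1 / Suc j} = piece xs"
    by (auto simp: piece_def space_pair_measure)
  finally show ?thesis .
qed

lemma piece_approx:
  assumes "(\<omega>, z) \<in> piece xs" "open O'" "z \<in> O'"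
  shows "\<exists>ys. join ys \<omega> \<in> past_cyl xs \<and> fp (join ys \<omega>) \<in> O'"
proof -
  obtain e where e: "0 < e" "ball z e \<subseteq> O'" using assms(2,3) by (meson openE)
  obtain j :: nat where j: "1 / Suc j < e" using e(1) nat_approx_posE by blast
  obtain ys where ys: "in_piece xs ys \<omega>" "dist z (\<pi> (join ys \<omega>)) < 1 / Suc j"
    using assms(1) unfolding piece_def by blast
  have "join ys \<omega> \<in> past_cyl xs" using ys(1) by (simp add: in_piece_def)
  moreover from this have "\<pi> (join ys \<omega>) = fp (join ys \<omega>)" by (intro \<pi>_fp) (simp add: past_cyl_def)
  ultimately show ?thesis using ys(2) j e(2) by (intro exI[of _ ys]) auto
qed

lemma piece_subset_closed:
  assumes "closed F" "\<And>ys. join ys \<omega> \<in> past_cyl xs \<Longrightarrow> fp (join ys \<omega>) \<in> F"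
  shows "Pair \<omega> -` piece xs \<subseteq> F"
proof
  fix z assume "z \<in> Pair \<omega> -` piece xs"
  then have z: "(\<omega>, z) \<in> piece xs" by simp
  show "z \<in> F"
  proof (rule ccontr)
    assume "z \<notin> F"
    then show False using piece_approx[OF z, of "- F"] assms by auto
  qed
qed

lemma eventually_small_diameter:
  assumes "0 < e"
  shows "\<exists>n\<ge>N. inverse l ^ n * diameter Z < e"
proof -
  have "(\<lambda>n. inverse l ^ n * diameter Z) \<longlonglongrightarrow> 0 * diameter Z"
    by (intro tendsto_intros LIMSEQ_power_zero) (use l_gt_1 in \<open>simp add: inverse_less_1_iff\<close>)
  then have "\<forall>\<^sub>F n in sequentially. inverse l ^ n * diameter Z < e"
    using assms by (intro order_tendstoD(2)) auto
  then obtain N' where "\<And>n. N' \<le> n \<Longrightarrow> inverse l ^ n * diameter Z < e"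
    unfolding eventually_sequentially by blast
  then show ?thesis by (intro exI[of _ "max N N'"]) auto
qed

text \<open>Replacing the remote past of \<open>\<tau>\<close> by zeros moves the fiber point only slightly.\<close>

lemma fp_mem_piece:
  assumes "\<tau> \<in> past_cyl xs"
  shows "(tail \<tau> 0, \<pi> \<tau>) \<in> piece xs"
  unfolding piece_def
proof (intro CollectI case_prodI allI)
  fix j :: nat
  have \<tau>: "\<tau> \<in> E2" using assms by (simp add: past_cyl_def)
  obtain n where n: "length xs \<le> n" "inverse l ^ n * diameter Z < 1 / Suc j"
    using eventually_small_diameter[of "1 / Suc j"] by auto
  let ?\<sigma> = "join (recent \<tau> n) (tail \<tau> 0)"
  have \<sigma>: "?\<sigma> \<in> E2" by (rule join_recent_E2[OF \<tau>])
  have agree: "?\<sigma> k = \<tau> k" if "- int n \<le> k" for k using that by (simp add: join_recent)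
  have "in_piece xs (recent \<tau> n) (tail \<tau> 0)"
    unfolding in_piece_def using assms \<sigma> agree n(1) by (auto simp: past_cyl_def)
  moreover have "dist (\<pi> \<tau>) (\<pi> ?\<sigma>) < 1 / Suc j"
    using fp_close[OF \<tau> \<sigma>, of n] agree n(2) \<pi>_fp[OF \<tau>] \<pi>_fp[OF \<sigma>] by (simp add: dist_norm)
  ultimately show "\<exists>ys. in_piece xs ys (tail \<tau> 0) \<and> dist (\<pi> \<tau>) (\<pi> (join ys (tail \<tau> 0))) < 1 / Suc j"
    by blast
qed

abbreviation fiber_mass :: "((nat \<Rightarrow> nat) \<times> 'a) set \<Rightarrow> (nat \<Rightarrow> nat) \<Rightarrow> real" where
  "fiber_mass A \<omega> \<equiv> measure (K (coding \<omega>)) (Pair \<omega> -` A)"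

lemma fiber_mass_measurable:
  assumes "A \<in> sets (borel \<Otimes>\<^sub>M borel)"
  shows "fiber_mass A \<in> borel_measurable future"
proof -
  have "(SIGMA x:space borel. Pair x -` A) = A" by auto
  moreover have "(\<lambda>\<omega>. K (coding \<omega>)) \<in> measurable borel (prob_algebra borel)" by measurable
  ultimately have "fiber_mass A \<in> borel_measurable borel"
    using assms by (intro measure_measurable_prob_algebra2[of _ _ borel]) auto
  then show ?thesis by (simp cong: measurable_cong_sets add: sets_future)
qed

lemma fiber_mass_integral:
  assumes A[measurable]: "A \<in> sets (borel \<Otimes>\<^sub>M borel)" and B[measurable]: "B \<in> sets borel"
  shows "(\<integral>\<^sup>+\<omega>. ennreal (fiber_mass A \<omega>) * indicator B \<omega> \<partial>future)
    = ennreal (prob {\<tau>. (tail \<tau> 0, \<pi> \<tau>) \<in> A \<and> tail \<tau> 0 \<in> B})"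
proof -
  let ?A = "A \<inter> (B \<times> UNIV)"
  have m: "?A \<in> sets (borel \<Otimes>\<^sub>M borel)" by measurable
  have "ennreal (fiber_mass A \<omega>) * indicator B \<omega> = emeasure (K (coding \<omega>)) (Pair \<omega> -` ?A)" for \<omega>
  proof -
    interpret Kw: prob_space "K (coding \<omega>)" by (rule K_prob)
    show ?thesis by (cases "\<omega> \<in> B") (auto simp: Kw.emeasure_eq_measure intro!: arg_cong[of _ _ "measure _"])
  qed
  then have "(\<integral>\<^sup>+\<omega>. ennreal (fiber_mass A \<omega>) * indicator B \<omega> \<partial>future) = emeasure M {\<tau>. (tail \<tau> 0, \<pi> \<tau>) \<in> ?A}"
    using conditional_disintegration[OF m] by simp
  then show ?thesis by (simp add: emeasure_eq_measure)
qed

lemma emeasure_future: "B \<in> sets borel \<Longrightarrow> emeasure future B = ennreal (prob {\<tau>. tail \<tau> 0 \<in> B})"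
  unfolding future_def by (subst emeasure_distr) (auto simp: emeasure_eq_measure vimage_def)

lemma pair_event_measurable:
  assumes A[measurable]: "A \<in> sets (borel \<Otimes>\<^sub>M borel)" and B[measurable]: "B \<in> sets borel"
  shows "{\<tau>. (tail \<tau> 0, \<pi> \<tau>) \<in> A \<and> tail \<tau> 0 \<in> B} \<in> sets borel"
proof -
  have "{\<tau>\<in>space borel. (tail \<tau> 0, \<pi> \<tau>) \<in> A \<and> tail \<tau> 0 \<in> B} \<in> sets borel" by measurable
  then show ?thesis by simp
qed

lemma piece_full: "AE \<omega> in future. fiber_mass (piece []) \<omega> = 1"
proof -
  interpret F: prob_space future by (rule future_prob)
  have "AE \<omega> in future. \<omega> \<in> UNIV \<longrightarrow> 1 \<le> fiber_mass (piece []) \<omega>"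
  proof (rule F.AE_ge_of_integral_ge[OF fiber_mass_measurable[OF piece_measurable]])
    fix B assume "B \<in> sets future"
    then have B[measurable]: "B \<in> sets borel" by (simp add: sets_future)
    have "prob {\<tau>. tail \<tau> 0 \<in> B} \<le> prob {\<tau>. (tail \<tau> 0, \<pi> \<tau>) \<in> piece [] \<and> tail \<tau> 0 \<in> B}"
    proof (rule finite_measure_mono_AE)
      show "AE \<tau> in M. \<tau> \<in> {\<tau>. tail \<tau> 0 \<in> B} \<longrightarrow> \<tau> \<in> {\<tau>. (tail \<tau> 0, \<pi> \<tau>) \<in> piece [] \<and> tail \<tau> 0 \<in> B}"
        using E2_full by eventually_elim (auto intro!: fp_mem_piece simp: past_cyl_def)
    qed (use pair_event_measurable[OF piece_measurable B] in \<open>simp add: sets_M\<close>)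
    then show "ennreal 1 * emeasure future B \<le> (\<integral>\<^sup>+\<omega>. ennreal (fiber_mass (piece []) \<omega>) * indicator B \<omega> \<partial>future)"
      unfolding fiber_mass_integral[OF piece_measurable B] emeasure_future[OF B] by (simp add: ennreal_leI)
  qed (auto simp: sets_future)
  then show ?thesis
  proof eventually_elim
    case (elim \<omega>)
    then show ?case using prob_space.prob_le_1[OF K_prob] by (simp add: antisym)
  qed
qed

text \<open>The fiber point of a sequence with past \<open>xs\<close> lies in the piece, so the bound \<open>cyl_future_lower\<close> on
past cylinders transfers, for futures that may follow \<open>xs\<close>.\<close>

lemma piece_lower:
  assumes xs: "past_cyl xs \<noteq> {}" "xs \<noteq> []"
  shows "AE \<omega> in future. \<not> (xs ! 0 = 1 \<and> \<omega> 0 = 1) \<longrightarrow> prob (past_cyl xs) / C^3 \<le> fiber_mass (piece xs) \<omega>"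
proof -
  interpret F: prob_space future by (rule future_prob)
  let ?G = "{\<omega> :: nat \<Rightarrow> nat. \<not> (xs ! 0 = 1 \<and> \<omega> 0 = 1)}"
  have G: "?G \<in> sets borel"
  proof -
    have "{\<omega>\<in>space borel. \<not> (xs ! 0 = 1 \<and> \<omega> (0::nat) = (1::nat))} \<in> sets borel" by measurable
    then show ?thesis by simp
  qed
  obtain \<sigma> where \<sigma>: "\<sigma> \<in> past_cyl xs" using xs by blast
  have \<sigma>E: "\<sigma> \<in> E2" and \<sigma>1: "\<sigma> (- 1) = xs ! 0" using \<sigma> xs(2) by (auto simp: past_cyl_def)
  have c: "past_cyl xs = cyl (- int (length xs)) 0 \<sigma>" by (rule past_cyl_eq_cyl[OF \<sigma>])
  have "AE \<omega> in future. \<omega> \<in> ?G \<longrightarrow> prob (past_cyl xs) / C^3 \<le> fiber_mass (piece xs) \<omega>"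
  proof (rule F.AE_ge_of_integral_ge[OF fiber_mass_measurable[OF piece_measurable]])
    fix B assume "B \<in> sets future" and BG: "B \<subseteq> ?G"
    then have B[measurable]: "B \<in> sets borel" by (simp add: sets_future)
    have adm: "{\<omega>. tail \<omega> 0 \<in> B \<and> \<not> (\<sigma> (0 - 1) = 1 \<and> \<omega> 0 = 1)} = {\<omega>. tail \<omega> 0 \<in> B}"
      using BG \<sigma>1 by (auto simp: tail_def)
    have "prob (past_cyl xs) * prob {\<omega>. tail \<omega> 0 \<in> B} \<le> C^3 * prob (past_cyl xs \<inter> {\<omega>. tail \<omega> 0 \<in> B})"
      using cyl_future_lower[OF \<sigma>E, of "- int (length xs)" 0 B] xs(2) unfolding adm c by simp
    also have "prob (past_cyl xs \<inter> {\<omega>. tail \<omega> 0 \<in> B}) \<le> prob {\<tau>. (tail \<tau> 0, \<pi> \<tau>) \<in> piece xs \<and> tail \<tau> 0 \<in> B}"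
      using fp_mem_piece pair_event_measurable[OF piece_measurable B]
      by (intro finite_measure_mono) (auto simp: sets_M)
    finally have "prob (past_cyl xs) / C^3 * prob {\<omega>. tail \<omega> 0 \<in> B} \<le> prob {\<tau>. (tail \<tau> 0, \<pi> \<tau>) \<in> piece xs \<and> tail \<tau> 0 \<in> B}"
      using C_ge_1 by (simp add: field_simps)
    then show "ennreal (prob (past_cyl xs) / C^3) * emeasure future B \<le> (\<integral>\<^sup>+\<omega>. ennreal (fiber_mass (piece xs) \<omega>) * indicator B \<omega> \<partial>future)"
      unfolding fiber_mass_integral[OF piece_measurable B] emeasure_future[OF B]
      using C_ge_1 by (subst ennreal_mult[symmetric]) (auto intro!: ennreal_leI)
  qed (use G in \<open>auto simp: sets_future\<close>)
  then show ?thesis by simp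
qed

definition deep :: "real \<Rightarrow> (int \<Rightarrow> nat) set" where
  "deep \<delta> = {\<tau>\<in>E2. \<delta> \<le> infdist (\<pi> \<tau>) (- interior Z)}"

lemma deep_measurable[measurable]: "deep \<delta> \<in> sets borel"
proof -
  have [measurable]: "(\<lambda>z. infdist z (- interior Z)) \<in> borel_measurable borel"
    by (intro borel_measurable_continuous_onI continuous_on_infdist continuous_on_id)
  have "{\<tau>\<in>space borel. \<tau> \<in> E2 \<and> \<delta> \<le> infdist (\<pi> \<tau>) (- interior Z)} \<in> sets borel" by measurable
  then show ?thesis by (simp add: deep_def)
qed

lemma deep_ball: assumes "\<tau> \<in> deep \<delta>" shows "ball (fp \<tau>) \<delta> \<subseteq> interior Z"
proof
  fix z assume z: "z \<in> ball (fp \<tau>) \<delta>"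
  show "z \<in> interior Z"
  proof (rule ccontr)
    assume "z \<notin> interior Z"
    then have "infdist (fp \<tau>) (- interior Z) \<le> dist (fp \<tau>) z" by (intro infdist_le) simp
    then show False using z assms by (auto simp: deep_def \<pi>_fp)
  qed
qed

text \<open>Otherwise almost every conditional measure gives no mass to the interior of \<open>Z\<close>. But every fiber has
an interior point \<open>fp \<tau>\<close>, a piece of high order about it lies in the interior, and every
admissible piece has positive conditional mass.\<close>

proposition deep_positive: "\<exists>\<delta>>0. 0 < prob (deep \<delta>)"
proof (rule ccontr)
  interpret F: prob_space future by (rule future_prob)
  assume "\<not> (\<exists>\<delta>>0. 0 < prob (deep \<delta>))"
  then have null: "prob (deep (1 / Suc j)) = 0" for j :: nat
    using measure_nonneg[of M "deep (1 / Suc j)"] by (metis order_le_less zero_less_divide_1_iff of_nat_0_less_iff zero_less_Suc)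
  have "AE \<tau> in M. \<forall>j::nat. \<tau> \<notin> deep (1 / Suc j)"
    by (subst AE_all_countable) (use prob_eq_0[of "deep _"] null in \<open>simp add: sets_M\<close>)
  then have notint: "AE \<tau> in M. \<pi> \<tau> \<notin> interior Z"
    using E2_full
  proof eventually_elim
    case (elim \<tau>)
    show ?case
    proof
      assume int: "\<pi> \<tau> \<in> interior Z"
      have "interior Z \<noteq> UNIV"
        using compact_imp_bounded[OF Z_compact] by (metis bounded_interior not_bounded_UNIV)
      then have "- interior Z \<noteq> {}" by auto
      then have "0 < infdist (\<pi> \<tau>) (- interior Z)"
        using int in_closed_iff_infdist_zero[of "- interior Z" "\<pi> \<tau>"] infdist_nonneg[of "\<pi> \<tau>" "- interior Z"]
        by (auto simp: less_le)
      then obtain j :: nat where "1 / Suc j < infdist (\<pi> \<tau>) (- interior Z)" using nat_approx_posE by blast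
      then show False using elim by (auto simp: deep_def dest: less_imp_le)
    qed
  qed
  have z: "prob {\<tau>. (tail \<tau> 0, \<pi> \<tau>) \<in> UNIV \<times> interior Z \<and> tail \<tau> 0 \<in> UNIV} = 0"
  proof -
    have "{\<tau>. (tail \<tau> 0, \<pi> \<tau>) \<in> UNIV \<times> interior Z \<and> tail \<tau> 0 \<in> UNIV} \<in> sets M"
      using pair_event_measurable[of "UNIV \<times> interior Z" UNIV] by (simp add: sets_M)
    with notint show ?thesis by (subst prob_eq_0) auto
  qed
  have I: "UNIV \<times> interior Z \<in> sets (borel \<Otimes>\<^sub>M borel)" by measurable
  have "AE \<omega> in future. fiber_mass (UNIV \<times> interior Z) \<omega> \<le> 0"
  proof (rule F.AE_le_of_integral_le[OF fiber_mass_measurable[OF I]])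
    fix B assume "B \<in> sets future"
    then have B[measurable]: "B \<in> sets borel" by (simp add: sets_future)
    have "prob {\<tau>. (tail \<tau> 0, \<pi> \<tau>) \<in> UNIV \<times> interior Z \<and> tail \<tau> 0 \<in> B}
        \<le> prob {\<tau>. (tail \<tau> 0, \<pi> \<tau>) \<in> UNIV \<times> interior Z \<and> tail \<tau> 0 \<in> UNIV}"
      using pair_event_measurable[OF I, of UNIV] by (intro finite_measure_mono) (auto simp: sets_M)
    then show "(\<integral>\<^sup>+\<omega>. ennreal (fiber_mass (UNIV \<times> interior Z) \<omega>) * indicator B \<omega> \<partial>future) \<le> ennreal 0 * emeasure future B"
      unfolding fiber_mass_integral[OF I B] z by (simp add: measure_le_0_iff)
  qed (auto simp: prob_space.prob_le_1[OF K_prob])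
  moreover have "AE \<omega> in future. \<forall>xs. past_cyl xs \<noteq> {} \<longrightarrow> xs \<noteq> [] \<longrightarrow>
      \<not> (xs ! 0 = 1 \<and> \<omega> 0 = 1) \<longrightarrow> prob (past_cyl xs) / C^3 \<le> fiber_mass (piece xs) \<omega>"
    using piece_lower by (subst AE_all_countable) auto
  ultimately have "AE \<omega> in future. False" using AE_future_E2p
  proof eventually_elim
    case (elim \<omega>)
    obtain \<tau> where \<tau>: "\<tau> \<in> E2" "tail \<tau> 0 = \<omega>" "fp \<tau> \<in> interior Z" using interior_point[OF elim(3)] by blast
    obtain e where e: "0 < e" "ball (fp \<tau>) e \<subseteq> interior Z" using \<tau>(3) open_interior by (meson openE)
    obtain n where n: "1 \<le> n" "inverse l ^ n * diameter Z < e" using eventually_small_diameter[OF e(1)] by blast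
    let ?xs = "recent \<tau> n"
    have \<tau>p: "\<tau> \<in> past_cyl ?xs" by (rule recent_past_cyl[OF \<tau>(1)])
    have sub: "Pair \<omega> -` piece ?xs \<subseteq> cball (fp \<tau>) (inverse l ^ n * diameter Z)"
    proof (rule piece_subset_closed)
      fix ys assume ys: "join ys \<omega> \<in> past_cyl ?xs"
      have "norm (fp (join ys \<omega>) - fp \<tau>) \<le> inverse l ^ n * diameter Z"
        by (rule fp_close) (use ys \<tau> past_cyl_agree[OF ys] in \<open>auto simp: past_cyl_def\<close>)
      then show "fp (join ys \<omega>) \<in> cball (fp \<tau>) (inverse l ^ n * diameter Z)"
        by (simp add: dist_norm norm_minus_commute)
    qed simp
    interpret Kw: prob_space "K (coding \<omega>)" by (rule K_prob)
    have "0 < prob (past_cyl ?xs)"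
      using past_cyl_eq_cyl[OF \<tau>p] cyl_pos[OF \<tau>(1), of "- int n" 0] n(1) by simp
    then have "0 < prob (past_cyl ?xs) / C^3" using C_ge_1 by simp
    also have "\<dots> \<le> fiber_mass (piece ?xs) \<omega>"
    proof -
      have "?xs ! 0 = \<tau> (- 1)" "\<omega> 0 = \<tau> 0" using n(1) \<tau>(2) by (auto simp: tail_def)
      moreover have "\<not> (\<tau> (- 1) = 1 \<and> \<tau> (- 1 + 1) = 1)" using \<tau>(1) unfolding E2_def by blast
      moreover have "?xs \<noteq> []" using n(1) by (metis length_recent list.size(3) not_one_le_zero)
      ultimately show ?thesis using elim(2) \<tau>p by auto
    qed
    also have "\<dots> \<le> fiber_mass (UNIV \<times> interior Z) \<omega>"
    proof (rule Kw.finite_measure_mono)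
      have "cball (fp \<tau>) (inverse l ^ n * diameter Z) \<subseteq> ball (fp \<tau>) e" using n(2) by auto
      then have "Pair \<omega> -` piece ?xs \<subseteq> interior Z" using sub e(2) by blast
      then show "Pair \<omega> -` piece ?xs \<subseteq> Pair \<omega> -` (UNIV \<times> interior Z)" by auto
      show "Pair \<omega> -` (UNIV \<times> interior Z) \<in> sets (K (coding \<omega>))" by (simp add: sets_K vimage_def)
    qed
    finally show ?case using elim(1) by simp
  qed
  then show False using F.AE_False by simp
qed

text \<open>Pieces of the same order may overlap, but only in a null set: if some \<open>\<sigma>\<^sup>-\<^sup>n \<tau>\<close> is deep, then \<open>fp \<tau>\<close>
lies in an open set that pieces with another past do not meet. Hence a piece has no more mass than
its past cylinder.\<close>

lemma piece_upper:
  assumes visits: "AE \<tau> in M. \<forall>N. \<exists>n\<ge>N. shift_by (- int n) \<tau> \<in> deep \<delta>" and \<delta>: "0 < \<delta>" and xs: "xs \<noteq> []"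
  shows "AE \<omega> in future. fiber_mass (piece xs) \<omega> \<le> C^3 * prob (past_cyl xs)"
proof (cases "past_cyl xs = {}")
  case True
  then have "piece xs = {}" by (auto simp: piece_def in_piece_def)
  then show ?thesis using C_ge_1 by simp
next
  case False
  interpret F: prob_space future by (rule future_prob)
  obtain \<sigma> where \<sigma>: "\<sigma> \<in> past_cyl xs" using False by blast
  have \<sigma>E: "\<sigma> \<in> E2" using \<sigma> by (auto simp: past_cyl_def)
  have c: "past_cyl xs = cyl (- int (length xs)) 0 \<sigma>" by (rule past_cyl_eq_cyl[OF \<sigma>])
  have inj: "AE \<tau> in M. (tail \<tau> 0, \<pi> \<tau>) \<in> piece xs \<longrightarrow> \<tau> \<in> past_cyl xs"
    using visits E2_full
  proof eventually_elim
    case (elim \<tau>)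
    show ?case
    proof
      assume mem: "(tail \<tau> 0, \<pi> \<tau>) \<in> piece xs"
      obtain n where n: "length xs \<le> n" "shift_by (- int n) \<tau> \<in> deep \<delta>" using elim by blast
      have "fp (shift_by (- int n) \<tau>) \<in> interior Z"
        using deep_ball[OF n(2)] \<delta> by (meson centre_in_ball subsetD)
      then have "fp \<tau> \<in> pc \<tau> n ` interior Z" using fp_past[OF elim(2), of n] by blast
      then obtain ys where ys: "join ys (tail \<tau> 0) \<in> past_cyl xs" "fp (join ys (tail \<tau> 0)) \<in> pc \<tau> n ` interior Z"
        using piece_approx[OF mem pc_interior(2)[OF elim(2)], of n] \<pi>_fp[OF elim(2)] by auto
      have "join ys (tail \<tau> 0) k = \<tau> k" if "- int n \<le> k" for k
        by (rule fp_in_open_image_agree[OF elim(2) _ _ ys(2) that]) (use ys(1) in \<open>auto simp: past_cyl_def\<close>)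
      then show "\<tau> \<in> past_cyl xs" using ys(1) n(1) elim(2) by (auto simp: past_cyl_def)
    qed
  qed
  show ?thesis
  proof (rule F.AE_le_of_integral_le[OF fiber_mass_measurable[OF piece_measurable]])
    fix B assume "B \<in> sets future"
    then have B[measurable]: "B \<in> sets borel" by (simp add: sets_future)
    have "prob {\<tau>. (tail \<tau> 0, \<pi> \<tau>) \<in> piece xs \<and> tail \<tau> 0 \<in> B} \<le> prob (past_cyl xs \<inter> {\<tau>. tail \<tau> 0 \<in> B})"
    proof (rule finite_measure_mono_AE)
      show "AE \<tau> in M. \<tau> \<in> {\<tau>. (tail \<tau> 0, \<pi> \<tau>) \<in> piece xs \<and> tail \<tau> 0 \<in> B} \<longrightarrow> \<tau> \<in> past_cyl xs \<inter> {\<tau>. tail \<tau> 0 \<in> B}"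
        using inj by eventually_elim auto
    qed measurable
    also have "\<dots> \<le> C^3 * prob (past_cyl xs) * prob {\<tau>. tail \<tau> 0 \<in> B}"
      unfolding c by (rule cyl_future_upper[OF \<sigma>E _ B]) (use xs in simp)
    finally show "(\<integral>\<^sup>+\<omega>. ennreal (fiber_mass (piece xs) \<omega>) * indicator B \<omega> \<partial>future)
        \<le> ennreal (C^3 * prob (past_cyl xs)) * emeasure future B"
      unfolding fiber_mass_integral[OF piece_measurable B] emeasure_future[OF B]
      using C_ge_1 by (subst ennreal_mult[symmetric]) (auto intro!: ennreal_leI)
  qed (use C_ge_1 in \<open>auto simp: prob_space.prob_le_1[OF K_prob]\<close>)
qed

definition typical :: "(nat \<Rightarrow> nat) \<Rightarrow> bool" where
  "typical \<omega> \<longleftrightarrow> fiber_mass (piece []) \<omega> = 1 \<and>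
    (\<forall>xs. xs \<noteq> [] \<longrightarrow> fiber_mass (piece xs) \<omega> \<le> C^3 * prob (past_cyl xs)) \<and>
    (\<forall>xs. past_cyl xs \<noteq> {} \<longrightarrow> xs \<noteq> [] \<longrightarrow> \<not> (xs ! 0 = 1 \<and> \<omega> 0 = 1) \<longrightarrow>
      prob (past_cyl xs) / C^3 \<le> fiber_mass (piece xs) \<omega>)"

lemma AE_typical:
  assumes "AE \<tau> in M. \<forall>N. \<exists>n\<ge>N. shift_by (- int n) \<tau> \<in> deep \<delta>" "0 < \<delta>"
  shows "AE \<omega> in future. typical \<omega>"
proof -
  have "AE \<omega> in future. \<forall>xs. xs \<noteq> [] \<longrightarrow> fiber_mass (piece xs) \<omega> \<le> C^3 * prob (past_cyl xs)"
    using piece_upper[OF assms] by (subst AE_all_countable) auto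
  moreover have "AE \<omega> in future. \<forall>xs. past_cyl xs \<noteq> {} \<longrightarrow> xs \<noteq> [] \<longrightarrow>
      \<not> (xs ! 0 = 1 \<and> \<omega> 0 = 1) \<longrightarrow> prob (past_cyl xs) / C^3 \<le> fiber_mass (piece xs) \<omega>"
    using piece_lower by (subst AE_all_countable) auto
  ultimately show ?thesis using piece_full by eventually_elim (auto simp: typical_def)
qed

text \<open>Distortion gives a ball inside the open image of the interior of \<open>Z\<close>, and all fiber points in
that ball have the same recent past as \<open>\<tau>\<close>.\<close>

lemma mass_upper:
  assumes \<tau>: "\<tau> \<in> E2" and tp: "typical (tail \<tau> 0)" and deep: "shift_by (- int n) \<tau> \<in> deep \<delta>"
    and \<delta>: "0 < \<delta>" and n: "1 \<le> n"
  defines "s \<equiv> pscale \<tau> n (fp (shift_by (- int n) \<tau>))"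
  shows "measure (K (coding (tail \<tau> 0))) (ball (fp \<tau>) (exp (- distortion) * s * \<delta>)) \<le> C^3 * prob (cyl (- int n) 0 \<tau>)"
proof -
  let ?\<omega> = "tail \<tau> 0" and ?xs = "recent \<tau> n" and ?p = "fp (shift_by (- int n) \<tau>)"
  let ?B = "ball (fp \<tau>) (exp (- distortion) * s * \<delta>)"
  interpret Kw: prob_space "K (coding ?\<omega>)" by (rule K_prob)
  have "ball ?p \<delta> \<subseteq> Z" using deep_ball[OF deep] interior_subset by blast
  from pc_ball_covers[OF \<tau> this \<delta>, of n] have B: "?B \<subseteq> pc \<tau> n ` interior Z"
    using fp_past[OF \<tau>, of n] by (simp add: s_def)
  have pm: "Pair ?\<omega> -` piece xs \<in> sets (K (coding ?\<omega>))" for xs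
    using sets_Pair1[OF piece_measurable] by (simp add: sets_K)
  have sub: "?B \<inter> Pair ?\<omega> -` piece [] \<subseteq> Pair ?\<omega> -` piece ?xs"
  proof
    fix z assume z: "z \<in> ?B \<inter> Pair ?\<omega> -` piece []"
    then have z0: "(?\<omega>, z) \<in> piece []" by simp
    have "\<exists>ys. in_piece ?xs ys ?\<omega> \<and> dist z (\<pi> (join ys ?\<omega>)) < 1 / Suc j" for j :: nat
    proof -
      obtain ys where ys: "join ys ?\<omega> \<in> past_cyl []" "fp (join ys ?\<omega>) \<in> ?B \<inter> ball z (1 / Suc j)"
        using piece_approx[OF z0, of "?B \<inter> ball z (1 / Suc j)"] z by auto
      have E: "join ys ?\<omega> \<in> E2" using ys(1) by (simp add: past_cyl_def)
      have "join ys ?\<omega> k = \<tau> k" if "- int n \<le> k" for k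
        by (rule fp_in_open_image_agree[OF \<tau> E _ _ that]) (use ys(2) B in auto)
      then have "in_piece ?xs ys ?\<omega>" using E by (simp add: in_piece_def past_cyl_def)
      then show ?thesis using ys(2) \<pi>_fp[OF E] by (intro exI[of _ ys]) auto
    qed
    then show "z \<in> Pair ?\<omega> -` piece ?xs" by (simp add: piece_def)
  qed
  have full: "Kw.prob (Pair ?\<omega> -` piece []) = 1" using tp by (simp add: typical_def)
  have "Kw.prob ?B = Kw.prob (?B \<inter> Pair ?\<omega> -` piece [])"
  proof (rule measure_eq_AE)
    show "AE z in K (coding ?\<omega>). z \<in> ?B \<longleftrightarrow> z \<in> ?B \<inter> Pair ?\<omega> -` piece []"
      using Kw.prob_eq_1[OF pm[of "[]"]] full by (auto elim: eventually_mono)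
  qed (use pm in \<open>auto simp: sets_K\<close>)
  also have "\<dots> \<le> Kw.prob (Pair ?\<omega> -` piece ?xs)" by (rule Kw.finite_measure_mono[OF sub pm])
  also have "\<dots> \<le> C^3 * prob (past_cyl ?xs)"
  proof -
    have "?xs \<noteq> []" using n by (metis length_recent list.size(3) not_one_le_zero)
    then show ?thesis using tp by (simp add: typical_def)
  qed
  also have "past_cyl ?xs = cyl (- int n) 0 \<tau>" using past_cyl_eq_cyl[OF recent_past_cyl[OF \<tau>, of n]] by simp
  finally show ?thesis .
qed

text \<open>The whole \<open>n\<close>-th piece need not be in the ball, since \<open>Z\<close> need not be convex. But \<open>k\<close> more
common digits confine the fiber points of the sequences shifted back by \<open>n\<close> to a ball of radius
\<open>\<delta> / 2\<close>, on which the mean value inequality applies.\<close>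

lemma mass_lower:
  assumes \<tau>: "\<tau> \<in> E2" and tp: "typical (tail \<tau> 0)" and deep: "shift_by (- int n) \<tau> \<in> deep \<delta>"
    and \<delta>: "0 < \<delta>" and n: "1 \<le> n" and k: "inverse l ^ k * diameter Z < \<delta> / 2"
  defines "s \<equiv> pscale \<tau> n (fp (shift_by (- int n) \<tau>))"
  shows "prob (cyl (- int (n + k)) 0 \<tau>) / C^3 \<le> measure (K (coding (tail \<tau> 0))) (ball (fp \<tau>) (exp distortion * s * \<delta>))"
proof -
  let ?\<omega> = "tail \<tau> 0" and ?xs = "recent \<tau> (n + k)" and ?p = "fp (shift_by (- int n) \<tau>)"
  let ?B = "ball (fp \<tau>) (exp distortion * s * \<delta>)"
  interpret Kw: prob_space "K (coding ?\<omega>)" by (rule K_prob)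
  have sub: "ball ?p \<delta> \<subseteq> Z" using deep_ball[OF deep] interior_subset by blast
  have pZ: "?p \<in> Z" using \<tau> by (simp add: fp_in_Z)
  have s: "0 < s" unfolding s_def by (rule pscale_pos[OF \<tau> pZ])
  have "Pair ?\<omega> -` piece ?xs \<subseteq> cball (fp \<tau>) (exp distortion * s * (\<delta> / 2))"
  proof (rule piece_subset_closed)
    fix ys assume ys: "join ys ?\<omega> \<in> past_cyl ?xs"
    let ?\<rho> = "join ys ?\<omega>"
    have E: "?\<rho> \<in> E2" using ys by (simp add: past_cyl_def)
    have ag: "?\<rho> i = \<tau> i" if "- int (n + k) \<le> i" for i using past_cyl_agree[OF ys _ that] by simp
    let ?q = "fp (shift_by (- int n) ?\<rho>)"
    have "norm (?q - ?p) \<le> inverse l ^ k * diameter Z"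
      by (rule fp_close) (use E \<tau> ag in auto)
    with k have q: "norm (?q - ?p) \<le> \<delta> / 2" by simp
    then have qb: "?q \<in> ball ?p \<delta>" using \<delta> by (simp add: dist_norm norm_minus_commute)
    have "fp ?\<rho> = pc \<tau> n ?q" using fp_past[OF E, of n] pc_cong[of n ?\<rho> \<tau>] ag by simp
    then have "norm (fp ?\<rho> - fp \<tau>) = norm (pc \<tau> n ?q - pc \<tau> n ?p)" using fp_past[OF \<tau>, of n] by simp
    also have "\<dots> \<le> exp distortion * s * norm (?q - ?p)"
      unfolding s_def by (rule pc_ball_lipschitz[OF \<tau> sub qb])
    also have "\<dots> \<le> exp distortion * s * (\<delta> / 2)" using q s by (intro mult_left_mono) auto
    finally show "fp ?\<rho> \<in> cball (fp \<tau>) (exp distortion * s * (\<delta> / 2))"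
      by (simp add: dist_norm norm_minus_commute)
  qed simp
  also have "\<dots> \<subseteq> ?B"
  proof -
    have "exp distortion * s * (\<delta> / 2) < exp distortion * s * \<delta>" using s \<delta> by simp
    then show ?thesis unfolding subset_iff mem_cball mem_ball by (intro allI impI) linarith
  qed
  finally have subB: "Pair ?\<omega> -` piece ?xs \<subseteq> ?B" .
  have xs: "?xs \<noteq> []" using n by (metis add_is_0 length_recent list.size(3) not_one_le_zero)
  have "?xs ! 0 = \<tau> (- 1)" "?\<omega> 0 = \<tau> 0" using n by (auto simp: tail_def)
  moreover have "\<not> (\<tau> (- 1) = 1 \<and> \<tau> (- 1 + 1) = 1)" using \<tau> unfolding E2_def by blast
  ultimately have "prob (past_cyl ?xs) / C^3 \<le> fiber_mass (piece ?xs) ?\<omega>"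
    using tp xs recent_past_cyl[OF \<tau>, of "n + k"] unfolding typical_def by auto
  also have "\<dots> \<le> Kw.prob ?B" by (rule Kw.finite_measure_mono[OF subB]) (simp add: sets_K)
  finally show ?thesis using past_cyl_eq_cyl[OF recent_past_cyl[OF \<tau>, of "n + k"]] by simp
qed

end

section \<open>Limits along good times\<close>

text \<open>If a set of positive density skipped the window from \<open>n\<close> to \<open>(1 + \<eta>) n\<close> for arbitrarily large \<open>n\<close>,
its density up to the end of the window would be smaller by a fixed factor.\<close>

lemma eventually_visit_window:
  fixes G :: "nat set" and g \<eta> :: real
  assumes dens: "(\<lambda>n. (\<Sum>k<n. indicator G k) / real n) \<longlonglongrightarrow> g" and g: "0 < g" and \<eta>: "0 < \<eta>"
  shows "\<forall>\<^sub>F n in sequentially. \<exists>j\<in>G. n \<le> j \<and> real j \<le> (1 + \<eta>) * n"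
proof -
  define N where "N n = (\<Sum>k<n. indicator G k :: real)" for n
  define \<epsilon> where "\<epsilon> = g * \<eta> / (2 + \<eta>)"
  have \<epsilon>: "0 < \<epsilon>" "\<epsilon> * (2 + \<eta>) = g * \<eta>" using g \<eta> by (auto simp: \<epsilon>_def)
  have \<epsilon>g: "\<epsilon> < g" unfolding \<epsilon>_def using g \<eta> by (simp add: field_simps)
  obtain n0 where n0: "\<And>n. n0 \<le> n \<Longrightarrow> \<bar>N n / n - g\<bar> < \<epsilon>"
    using LIMSEQ_D[OF dens \<epsilon>(1)] unfolding N_def by auto
  have "\<exists>j\<in>G. n \<le> j \<and> real j \<le> (1 + \<eta>) * n" if n: "max 1 n0 \<le> n" for n
  proof (rule ccontr)
    assume no: "\<not> (\<exists>j\<in>G. n \<le> j \<and> real j \<le> (1 + \<eta>) * n)"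
    define n' where "n' = nat \<lfloor>(1 + \<eta>) * n\<rfloor> + 1"
    have pos: "0 \<le> (1 + \<eta>) * real n" using \<eta> by simp
    have n'1: "(1 + \<eta>) * n < n'" using pos unfolding n'_def by linarith
    have n'2: "real k \<le> (1 + \<eta>) * n" if "k < n'" for k
    proof -
      have "int k \<le> \<lfloor>(1 + \<eta>) * n\<rfloor>" using that pos unfolding n'_def by linarith
      then show ?thesis by linarith
    qed
    have "real n \<le> (1 + \<eta>) * n" using \<eta> by (simp add: algebra_simps)
    with n'1 have nn': "n \<le> n'" by linarith
    have split: "{..<n'} = {..<n} \<union> {n..<n'}" using nn' by auto
    have "N n' = sum (indicator G) ({..<n} \<union> {n..<n'})"
      unfolding N_def by (rule arg_cong[OF split])
    also have "\<dots> = sum (indicator G) {..<n} + sum (indicator G) {n..<n'}"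
      by (rule sum.union_disjoint) auto
    also have "sum (indicator G) {..<n} = N n" by (simp add: N_def)
    also have "sum (indicator G) {n..<n'} = (0::real)"
      by (rule sum.neutral) (use no n'2 in \<open>auto split: split_indicator\<close>)
    finally have eq: "N n' = N n" by simp
    have p: "0 < real n" "0 < real n'" using n nn' by auto
    have 1: "N n < (g + \<epsilon>) * n" using n0[of n] n p by (simp add: field_simps abs_less_iff)
    have "g - \<epsilon> < N n' / n'" using n0[of n'] n nn' by (simp add: abs_less_iff)
    then have 2: "(g - \<epsilon>) * n' < N n'" using p by (simp add: field_simps)
    have "(g - \<epsilon>) * ((1 + \<eta>) * n) \<le> (g - \<epsilon>) * n'" using \<epsilon>g n'1 by (intro mult_left_mono) auto
    with 1 2 eq have "(g - \<epsilon>) * ((1 + \<eta>) * n) < (g + \<epsilon>) * n" by linarith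
    then have "((g - \<epsilon>) * (1 + \<eta>)) * n < (g + \<epsilon>) * n" by (simp only: mult.assoc)
    then have "(g - \<epsilon>) * (1 + \<eta>) < g + \<epsilon>" using p(1) by (simp only: mult_less_cancel_right_pos)
    then show False using \<epsilon>(2) by (simp add: algebra_simps)
  qed
  then show ?thesis unfolding eventually_sequentially by blast
qed

lemma eventually_linear_growth:
  fixes X :: "nat \<Rightarrow> real" and c e :: real
  assumes "(\<lambda>n. X n / n) \<longlonglongrightarrow> c" "0 < e"
  shows "\<forall>\<^sub>F n in sequentially. (c - e) * n \<le> X n \<and> X n \<le> (c + e) * n"
proof -
  have "\<forall>\<^sub>F n in sequentially. \<bar>X n / n - c\<bar> < e"
    using tendstoD[OF assms] by (simp add: dist_real_def)
  then show ?thesis using eventually_gt_at_top[of 0]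
    by eventually_elim (auto simp: abs_less_iff field_simps)
qed

text \<open>For radius \<open>exp (- t)\<close>, the matching time is \<open>t / \<gamma>\<close>. A good time slightly before it bounds the mass
from above and a good time slightly after it bounds the mass from below.\<close>

proposition exponential_scaling_limit:
  fixes m :: "real \<Rightarrow> real" and S Q :: "nat \<Rightarrow> real"
  assumes mono: "\<And>r r'. r \<le> r' \<Longrightarrow> m r \<le> m r'"
    and S: "(\<lambda>n. S n / n) \<longlonglongrightarrow> \<gamma>" and \<gamma>: "0 < \<gamma>"
    and Q: "(\<lambda>n. Q n / n) \<longlonglongrightarrow> h" and h: "0 \<le> h"
    and dens: "(\<lambda>n. (\<Sum>k<n. indicator G k) / real n) \<longlonglongrightarrow> g" and g: "0 < g"
    and up: "\<And>n. n \<in> G \<Longrightarrow> 1 \<le> n \<Longrightarrow> m (a * exp (- S n)) \<le> A * exp (- Q n)"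
    and lo: "\<And>n. n \<in> G \<Longrightarrow> 1 \<le> n \<Longrightarrow> B * exp (- Q (n + k)) \<le> m (b * exp (- S n))"
    and pos: "0 < a" "0 < A" "0 < b" "0 < B"
  shows "((\<lambda>t. - ln (m (exp (- t))) / t) \<longlongrightarrow> h / \<gamma>) at_top" "\<And>r. 0 < r \<Longrightarrow> 0 < m r"
proof -
  (* the relative delay 3 \<eta> beats the error \<eta> of the rate: (1 - \<eta>) (1 + 3 \<eta>) >= 1 + \<eta> *)
  have lower: "\<forall>\<^sub>F t in at_top. 0 < m (exp (- t)) \<and>
      - ln (m (exp (- t))) \<le> (h + \<eta>) * ((1 + \<eta>) * ((1 + 3 * \<eta>) / \<gamma> * t + 1) + k) - ln B"
    if \<eta>: "0 < \<eta>" "\<eta> < 1/4" for \<eta>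
  proof -
    define n2 where "n2 t = nat \<lceil>(1 + 3 * \<eta>) / \<gamma> * t\<rceil>" for t :: real
    have "\<forall>\<^sub>F n in sequentially. (\<gamma> - \<gamma> * \<eta>) * n \<le> S n \<and> S n \<le> (\<gamma> + \<gamma> * \<eta>) * n"
      using \<eta> \<gamma> by (intro eventually_linear_growth[OF S]) simp
    moreover have "\<forall>\<^sub>F n in sequentially. (h - \<eta>) * n \<le> Q n \<and> Q n \<le> (h + \<eta>) * n"
      using \<eta> by (intro eventually_linear_growth[OF Q]) simp
    ultimately obtain n0 where n0: "\<And>n. n0 \<le> n \<Longrightarrow> (\<gamma> - \<gamma> * \<eta>) * n \<le> S n"
      "\<And>n. n0 \<le> n \<Longrightarrow> Q n \<le> (h + \<eta>) * n" unfolding eventually_sequentially by (metis nat_le_linear order_trans)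
    obtain n1 where n1: "\<And>n. n1 \<le> n \<Longrightarrow> \<exists>j\<in>G. n \<le> j \<and> real j \<le> (1 + \<eta>) * n"
      using eventually_visit_window[OF dens g \<eta>(1)] unfolding eventually_sequentially by blast
    have c2: "0 < (1 + 3 * \<eta>) / \<gamma>" using \<eta> \<gamma> by simp
    define t0 where "t0 = max (real (Max {1, n0, n1}) / ((1 + 3 * \<eta>) / \<gamma>)) (max 1 (ln b / \<eta>))"
    show ?thesis
      using eventually_ge_at_top[of t0]
    proof eventually_elim
      case (elim t)
      have e: "(real (Max {1, n0, n1})) / ((1 + 3 * \<eta>) / \<gamma>) \<le> t" "1 \<le> t" "ln b / \<eta> \<le> t"
        using elim unfolding t0_def max.bounded_iff by blast+
      have t: "1 \<le> t" "ln b \<le> \<eta> * t" "real (Max {1, n0, n1}) \<le> (1 + 3 * \<eta>) / \<gamma> * t"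
        using e(2) e(3)[unfolded pos_divide_le_eq[OF \<eta>(1)]] e(1)[unfolded pos_divide_le_eq[OF c2]]
        by (simp_all only: mult.commute)
      have n2: "(1 + 3 * \<eta>) / \<gamma> * t \<le> n2 t" "n2 t \<le> (1 + 3 * \<eta>) / \<gamma> * t + 1"
      proof -
        have "0 \<le> (1 + 3 * \<eta>) / \<gamma> * t" using c2 t(1) by (intro mult_nonneg_nonneg) auto
        then show "(1 + 3 * \<eta>) / \<gamma> * t \<le> n2 t" "n2 t \<le> (1 + 3 * \<eta>) / \<gamma> * t + 1"
          unfolding n2_def by linarith+
      qed
      have "real (Max {1, n0, n1}) \<le> real (n2 t)" using t(3) n2(1) by linarith
      then have nb: "1 \<le> n2 t" "n0 \<le> n2 t" "n1 \<le> n2 t" by auto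
      obtain j where j: "j \<in> G" "n2 t \<le> j" "real j \<le> (1 + \<eta>) * n2 t" using n1[OF nb(3)] by blast
      have "t + ln b \<le> (1 + \<eta>) * t" using t(2) by (simp add: algebra_simps)
      also have "\<dots> \<le> ((1 - \<eta>) * (1 + 3 * \<eta>)) * t"
      proof (rule mult_right_mono)
        have "\<eta> * \<eta> \<le> \<eta> * (1/4)" using \<eta> by (intro mult_left_mono) auto
        then show "1 + \<eta> \<le> (1 - \<eta>) * (1 + 3 * \<eta>)" using \<eta> by (simp add: algebra_simps)
      qed (use t in simp)
      also have "\<dots> = \<gamma> * (1 - \<eta>) * ((1 + 3 * \<eta>) / \<gamma> * t)" using \<gamma> by simp
      also have "\<dots> \<le> \<gamma> * (1 - \<eta>) * j"
        using \<gamma> \<eta> n2(1) j(2) by (intro mult_left_mono) auto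
      also have "\<dots> = (\<gamma> - \<gamma> * \<eta>) * j" by (simp add: algebra_simps)
      also have "\<dots> \<le> S j" using n0(1)[of j] j nb by simp
      finally have "ln b - S j \<le> - t" by simp
      then have "exp (ln b - S j) \<le> exp (- t)" by simp
      then have "b * exp (- S j) \<le> exp (- t)" using pos(3) by (simp add: exp_diff exp_minus divide_inverse)
      then have "m (b * exp (- S j)) \<le> m (exp (- t))" by (rule mono)
      with lo[of j] j nb have le: "B * exp (- Q (j + k)) \<le> m (exp (- t))" by force
      have p: "0 < m (exp (- t))" using le pos(4) by (meson exp_gt_zero less_le_trans mult_pos_pos)
      have "ln (B * exp (- Q (j + k))) \<le> ln (m (exp (- t)))" using le pos(4) p by simp
      then have "- ln (m (exp (- t))) \<le> Q (j + k) - ln B" using pos(4) by (simp add: ln_mult)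
      also have "Q (j + k) \<le> (h + \<eta>) * real (j + k)" using n0(2)[of "j + k"] j nb by simp
      also have "\<dots> \<le> (h + \<eta>) * ((1 + \<eta>) * ((1 + 3 * \<eta>) / \<gamma> * t + 1) + k)"
      proof (rule mult_left_mono)
        have "(1 + \<eta>) * n2 t \<le> (1 + \<eta>) * ((1 + 3 * \<eta>) / \<gamma> * t + 1)"
          using n2(2) \<eta> by (intro mult_left_mono) auto
        then show "real (j + k) \<le> (1 + \<eta>) * ((1 + 3 * \<eta>) / \<gamma> * t + 1) + k" using j(3) by simp
      qed (use h \<eta> in simp)
      finally show ?case using p by simp
    qed
  qed
  (* here j may exceed the start of its window by a factor 1 + \<eta>, and
     (1 + \<eta>)^2 (1 - 3 \<eta>) <= 1 - \<eta> still leaves room for the constant a *)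
  have upper: "\<forall>\<^sub>F t in at_top. 0 < m (exp (- t)) \<longrightarrow>
      (h - 2 * \<eta>) * ((1 - 3 * \<eta>) / \<gamma>) * t - h - ln A \<le> - ln (m (exp (- t)))"
    if \<eta>: "0 < \<eta>" "\<eta> < 1/4" for \<eta>
  proof -
    define n2 where "n2 t = nat \<lfloor>(1 - 3 * \<eta>) / \<gamma> * t\<rfloor>" for t :: real
    have "\<forall>\<^sub>F n in sequentially. (\<gamma> - \<gamma> * \<eta>) * n \<le> S n \<and> S n \<le> (\<gamma> + \<gamma> * \<eta>) * n"
      using \<eta> \<gamma> by (intro eventually_linear_growth[OF S]) simp
    moreover have "\<forall>\<^sub>F n in sequentially. (h - \<eta>) * n \<le> Q n \<and> Q n \<le> (h + \<eta>) * n"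
      using \<eta> by (intro eventually_linear_growth[OF Q]) simp
    ultimately obtain n0 where n0: "\<And>n. n0 \<le> n \<Longrightarrow> S n \<le> (\<gamma> + \<gamma> * \<eta>) * n"
      "\<And>n. n0 \<le> n \<Longrightarrow> (h - \<eta>) * n \<le> Q n" unfolding eventually_sequentially by (metis nat_le_linear order_trans)
    obtain n1 where n1: "\<And>n. n1 \<le> n \<Longrightarrow> \<exists>j\<in>G. n \<le> j \<and> real j \<le> (1 + \<eta>) * n"
      using eventually_visit_window[OF dens g \<eta>(1)] unfolding eventually_sequentially by blast
    have c2: "0 < (1 - 3 * \<eta>) / \<gamma>" using \<eta> \<gamma> by simp
    define t0 where "t0 = max ((real (Max {1, n0, n1}) + 1) / ((1 - 3 * \<eta>) / \<gamma>)) (max 1 (- ln a / \<eta>))"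
    show ?thesis
      using eventually_ge_at_top[of t0]
    proof eventually_elim
      case (elim t)
      have e: "(real (Max {1, n0, n1}) + 1) / ((1 - 3 * \<eta>) / \<gamma>) \<le> t" "1 \<le> t" "- ln a / \<eta> \<le> t"
        using elim unfolding t0_def max.bounded_iff by blast+
      have t: "1 \<le> t" "- ln a \<le> \<eta> * t" "real (Max {1, n0, n1}) + 1 \<le> (1 - 3 * \<eta>) / \<gamma> * t"
        using e(2) e(3)[unfolded pos_divide_le_eq[OF \<eta>(1)]] e(1)[unfolded pos_divide_le_eq[OF c2]]
        by (simp_all only: mult.commute)
      have n2: "(1 - 3 * \<eta>) / \<gamma> * t - 1 \<le> n2 t" "n2 t \<le> (1 - 3 * \<eta>) / \<gamma> * t"
      proof -
        have "0 \<le> (1 - 3 * \<eta>) / \<gamma> * t" using c2 t(1) by (intro mult_nonneg_nonneg) auto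
        then show "(1 - 3 * \<eta>) / \<gamma> * t - 1 \<le> n2 t" "n2 t \<le> (1 - 3 * \<eta>) / \<gamma> * t"
          unfolding n2_def by linarith+
      qed
      have "real (Max {1, n0, n1}) \<le> real (n2 t)" using t(3) n2(1) by linarith
      then have nb: "1 \<le> n2 t" "n0 \<le> n2 t" "n1 \<le> n2 t" by auto
      obtain j where j: "j \<in> G" "n2 t \<le> j" "real j \<le> (1 + \<eta>) * n2 t" using n1[OF nb(3)] by blast
      have "S j \<le> (\<gamma> + \<gamma> * \<eta>) * j" using n0(1)[of j] j nb by simp
      also have "\<dots> \<le> (\<gamma> + \<gamma> * \<eta>) * ((1 + \<eta>) * ((1 - 3 * \<eta>) / \<gamma> * t))"
      proof (rule mult_left_mono)
        have "(1 + \<eta>) * n2 t \<le> (1 + \<eta>) * ((1 - 3 * \<eta>) / \<gamma> * t)"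
          using n2(2) \<eta> by (intro mult_left_mono) auto
        then show "real j \<le> (1 + \<eta>) * ((1 - 3 * \<eta>) / \<gamma> * t)" using j(3) by simp
      qed (use \<gamma> \<eta> in simp)
      also have "\<dots> = ((1 + \<eta>) * (1 + \<eta>) * (1 - 3 * \<eta>)) * t" using \<gamma> by (simp add: field_simps)
      also have "\<dots> \<le> (1 - \<eta>) * t"
      proof (rule mult_right_mono)
        have "(1 + \<eta>) * (1 + \<eta>) * (1 - 3 * \<eta>) = 1 - \<eta> - (5 * (\<eta> * \<eta>) + 3 * (\<eta> * \<eta> * \<eta>))" by (simp add: algebra_simps)
        also have "\<dots> \<le> 1 - \<eta>"
        proof -
          have "0 \<le> \<eta> * \<eta>" "0 \<le> \<eta> * \<eta> * \<eta>" using \<eta> by simp_all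
          then show ?thesis by linarith
        qed
        finally show "(1 + \<eta>) * (1 + \<eta>) * (1 - 3 * \<eta>) \<le> 1 - \<eta>" .
      qed (use t in simp)
      also have "\<dots> \<le> t + ln a" using t(2) by (simp add: algebra_simps)
      finally have "- t \<le> ln a - S j" by simp
      then have "exp (- t) \<le> exp (ln a - S j)" by simp
      then have "exp (- t) \<le> a * exp (- S j)" using pos(1) by (simp add: exp_diff exp_minus divide_inverse)
      then have "m (exp (- t)) \<le> m (a * exp (- S j))" by (rule mono)
      with up[of j] j nb have le: "m (exp (- t)) \<le> A * exp (- Q j)" by force
      show ?case
      proof
        assume p: "0 < m (exp (- t))"
        have "ln (m (exp (- t))) \<le> ln (A * exp (- Q j))" using le pos(2) p by simp
        then have 1: "Q j - ln A \<le> - ln (m (exp (- t)))" using pos(2) by (simp add: ln_mult)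
        have "(h - 2 * \<eta>) * w * t - h = h * (w * t - 1) - 2 * \<eta> * (w * t)" for w
          by (simp add: algebra_simps)
        then have "(h - 2 * \<eta>) * ((1 - 3 * \<eta>) / \<gamma>) * t - h = h * ((1 - 3 * \<eta>) / \<gamma> * t - 1) - 2 * \<eta> * ((1 - 3 * \<eta>) / \<gamma> * t)" .
        also have "\<dots> \<le> h * n2 t - 2 * \<eta> * n2 t"
          using h \<eta> n2 by (intro diff_mono mult_left_mono) auto
        also have "\<dots> \<le> h * j - \<eta> * ((1 + \<eta>) * n2 t)"
        proof (rule diff_mono)
          show "h * real (n2 t) \<le> h * real j" using h j by (intro mult_left_mono) auto
          have "(1 + \<eta>) * real (n2 t) \<le> 2 * real (n2 t)" using \<eta> by (intro mult_right_mono) auto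
          then have "\<eta> * ((1 + \<eta>) * real (n2 t)) \<le> \<eta> * (2 * real (n2 t))" using \<eta> by (intro mult_left_mono) auto
          then show "\<eta> * ((1 + \<eta>) * real (n2 t)) \<le> 2 * \<eta> * real (n2 t)" by simp
        qed
        also have "\<dots> \<le> h * j - \<eta> * j" using h \<eta> j(3) by (intro diff_mono mult_left_mono) auto
        also have "\<dots> \<le> Q j" using n0(2)[of j] j nb by (simp add: algebra_simps)
        finally show "(h - 2 * \<eta>) * ((1 - 3 * \<eta>) / \<gamma>) * t - h - ln A \<le> - ln (m (exp (- t)))" using 1 by simp
      qed
    qed
  qed
  show "0 < m r" if r: "0 < r" for r
  proof -
    have "\<forall>\<^sub>F t in at_top. 0 < m (exp (- t)) \<and> - ln r \<le> t"
    proof (rule eventually_conj)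
      show "\<forall>\<^sub>F t in at_top. 0 < m (exp (- t))"
        by (rule eventually_mono[OF lower[of "1/8"]]) auto
    qed (rule eventually_ge_at_top)
    then obtain t where t: "0 < m (exp (- t))" "- ln r \<le> t" using eventually_happens'[of at_top] by force
    have "exp (- t) \<le> exp (ln r)" using t(2) by simp
    then have "exp (- t) \<le> r" using r by simp
    then show ?thesis using t(1) mono by (meson less_le_trans)
  qed
  show "((\<lambda>t. - ln (m (exp (- t))) / t) \<longlongrightarrow> h / \<gamma>) at_top"
  proof (rule tendstoI)
    fix \<epsilon> :: real assume \<epsilon>: "0 < \<epsilon>"
    have "((\<lambda>\<eta>. (h - 2 * \<eta>) * ((1 - 3 * \<eta>) / \<gamma>)) \<longlongrightarrow> (h - 2 * 0) * ((1 - 3 * 0) / \<gamma>)) (at_right 0)"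
      by (intro tendsto_intros) (use \<gamma> in auto)
    then have 1: "\<forall>\<^sub>F \<eta> in at_right 0. h / \<gamma> - \<epsilon> < (h - 2 * \<eta>) * ((1 - 3 * \<eta>) / \<gamma>)"
      using \<epsilon> by (intro order_tendstoD(1)) auto
    have "((\<lambda>\<eta>. (h + \<eta>) * ((1 + \<eta>) * ((1 + 3 * \<eta>) / \<gamma>))) \<longlongrightarrow> (h + 0) * ((1 + 0) * ((1 + 3 * 0) / \<gamma>))) (at_right 0)"
      by (intro tendsto_intros) (use \<gamma> in auto)
    then have 2: "\<forall>\<^sub>F \<eta> in at_right 0. (h + \<eta>) * ((1 + \<eta>) * ((1 + 3 * \<eta>) / \<gamma>)) < h / \<gamma> + \<epsilon>"
      using \<epsilon> by (intro order_tendstoD(2)) auto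
    have 3: "\<forall>\<^sub>F \<eta> in at_right (0::real). 0 < \<eta> \<and> \<eta> < 1/4"
      using eventually_at_right_real[of 0 "1/4"] by simp
    have "\<forall>\<^sub>F \<eta> in at_right 0. 0 < \<eta> \<and> \<eta> < 1/4 \<and> h / \<gamma> - \<epsilon> < (h - 2 * \<eta>) * ((1 - 3 * \<eta>) / \<gamma>) \<and>
        (h + \<eta>) * ((1 + \<eta>) * ((1 + 3 * \<eta>) / \<gamma>)) < h / \<gamma> + \<epsilon>"
      using 1 2 3 by eventually_elim auto
    then obtain \<eta> where \<eta>: "0 < \<eta>" "\<eta> < 1/4" and L: "h / \<gamma> - \<epsilon> < (h - 2 * \<eta>) * ((1 - 3 * \<eta>) / \<gamma>)"
      and R: "(h + \<eta>) * ((1 + \<eta>) * ((1 + 3 * \<eta>) / \<gamma>)) < h / \<gamma> + \<epsilon>"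
      using eventually_happens'[of "at_right (0::real)"] by force
    define l where "l = (h - 2 * \<eta>) * ((1 - 3 * \<eta>) / \<gamma>) - (h / \<gamma> - \<epsilon>)"
    define r where "r = h / \<gamma> + \<epsilon> - (h + \<eta>) * ((1 + \<eta>) * ((1 + 3 * \<eta>) / \<gamma>))"
    define cl where "cl = h + ln A"
    define cr where "cr = (h + \<eta>) * (1 + \<eta> + k) - ln B"
    have lr: "0 < l" "0 < r" using L R by (auto simp: l_def r_def)
    show "\<forall>\<^sub>F t in at_top. dist (- ln (m (exp (- t))) / t) (h / \<gamma>) < \<epsilon>"
      using lower[OF \<eta>] upper[OF \<eta>] eventually_gt_at_top[of 0] eventually_gt_at_top[of "cl / l"] eventually_gt_at_top[of "cr / r"]
    proof eventually_elim
      case (elim t)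
      have a: "cl < l * t" "cr < r * t" using elim(4,5) lr by (auto simp: divide_less_eq mult.commute)
      have "- ln (m (exp (- t))) \<le> (h / \<gamma> + \<epsilon> - r) * t + cr"
        using elim(1) unfolding r_def cr_def by (simp add: algebra_simps)
      with a have 1: "- ln (m (exp (- t))) < (h / \<gamma> + \<epsilon>) * t" by (simp add: algebra_simps)
      have "(h / \<gamma> - \<epsilon> + l) * t - cl \<le> - ln (m (exp (- t)))"
        using elim(1,2) unfolding l_def cl_def by (simp add: algebra_simps)
      with a have 2: "(h / \<gamma> - \<epsilon>) * t < - ln (m (exp (- t)))" by (simp add: algebra_simps)
      have "- ln (m (exp (- t))) / t < h / \<gamma> + \<epsilon>" using 1 elim(3) by (subst divide_less_eq) auto
      moreover have "h / \<gamma> - \<epsilon> < - ln (m (exp (- t))) / t" using 2 elim(3) by (subst less_divide_eq) auto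
      ultimately show ?case unfolding dist_real_def abs_less_iff by linarith
    qed
  qed
qed

text \<open>Countably many radii suffice for a monotone function; this makes the set of points with a given local
dimension a Borel set.\<close>

lemma tendsto_along_reals:
  fixes f :: "real \<Rightarrow> real"
  assumes mono: "\<And>s t. s \<le> t \<Longrightarrow> f s \<le> f t" and lim: "(\<lambda>j. f (real j) / real j) \<longlonglongrightarrow> D"
  shows "((\<lambda>t. f t / t) \<longlongrightarrow> D) at_top"
proof -
  have fl: "filterlim (\<lambda>t::real. nat \<lfloor>t\<rfloor>) sequentially at_top"
    unfolding filterlim_at_top by (metis (mono_tags, lifting) eventually_at_top_linorder le_nat_floor)
  have b: "\<forall>\<^sub>F t::real in at_top. 1 \<le> t" by (rule eventually_ge_at_top)
  have r0: "((\<lambda>t::real. real (nat \<lfloor>t\<rfloor>) / t) \<longlongrightarrow> 1) at_top"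
  proof (rule tendsto_sandwich)
    show "\<forall>\<^sub>F t::real in at_top. 1 - 1 / t \<le> real (nat \<lfloor>t\<rfloor>) / t"
      using b
    proof eventually_elim
      case (elim t)
      have "t - 1 \<le> real (nat \<lfloor>t\<rfloor>)" using elim by linarith
      then have "(t - 1) / t \<le> real (nat \<lfloor>t\<rfloor>) / t" using elim by (intro divide_right_mono) auto
      then show ?case using elim by (simp add: diff_divide_distrib)
    qed
    show "\<forall>\<^sub>F t::real in at_top. real (nat \<lfloor>t\<rfloor>) / t \<le> 1"
      using b by eventually_elim (simp add: divide_le_eq)
    have "((\<lambda>t::real. 1 - inverse t) \<longlongrightarrow> 1 - 0) at_top"
      by (intro tendsto_intros tendsto_inverse_0_at_top filterlim_ident)
    then show "((\<lambda>t::real. 1 - 1 / t) \<longlongrightarrow> 1) at_top" by (simp add: inverse_eq_divide)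
  qed simp
  have r1: "((\<lambda>t::real. real (Suc (nat \<lfloor>t\<rfloor>)) / t) \<longlongrightarrow> 1) at_top"
  proof -
    have "((\<lambda>t::real. real (nat \<lfloor>t\<rfloor>) / t + inverse t) \<longlongrightarrow> 1 + 0) at_top"
      by (intro tendsto_add r0 tendsto_inverse_0_at_top filterlim_ident)
    then show ?thesis by (simp add: add_divide_distrib inverse_eq_divide add.commute)
  qed
  have l0: "((\<lambda>t. f (real (nat \<lfloor>t\<rfloor>)) / real (nat \<lfloor>t\<rfloor>) * (real (nat \<lfloor>t\<rfloor>) / t)) \<longlongrightarrow> D * 1) at_top"
    by (intro tendsto_mult r0 filterlim_compose[OF lim fl])
  have l1: "((\<lambda>t. f (real (Suc (nat \<lfloor>t\<rfloor>))) / real (Suc (nat \<lfloor>t\<rfloor>)) * (real (Suc (nat \<lfloor>t\<rfloor>)) / t)) \<longlongrightarrow> D * 1) at_top"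
    by (intro tendsto_mult r1 filterlim_compose[OF LIMSEQ_Suc[OF lim] fl])
  have "((\<lambda>t. f t / t) \<longlongrightarrow> D * 1) at_top"
  proof (rule tendsto_sandwich[OF _ _ l0 l1])
    show "\<forall>\<^sub>F t in at_top. f (real (nat \<lfloor>t\<rfloor>)) / real (nat \<lfloor>t\<rfloor>) * (real (nat \<lfloor>t\<rfloor>) / t) \<le> f t / t"
      using b
    proof eventually_elim
      case (elim t)
      define j where "j = nat \<lfloor>t\<rfloor>"
      have "0 < j" "real j \<le> t" using elim unfolding j_def by linarith+
      then have "f (real j) / real j * (real j / t) \<le> f t / t"
        using mono[of "real j" t] elim by (simp add: divide_right_mono)
      then show ?case unfolding j_def .
    qed
    show "\<forall>\<^sub>F t in at_top. f t / t \<le> f (real (Suc (nat \<lfloor>t\<rfloor>))) / real (Suc (nat \<lfloor>t\<rfloor>)) * (real (Suc (nat \<lfloor>t\<rfloor>)) / t)"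
      using b
    proof eventually_elim
      case (elim t)
      have "t \<le> real (Suc (nat \<lfloor>t\<rfloor>))" using elim by linarith
      then show ?case using mono[of t "real (Suc (nat \<lfloor>t\<rfloor>))"] elim
        by (simp add: divide_right_mono del: of_nat_Suc)
    qed
  qed
  then show ?thesis by simp
qed

lemma tendsto_at_right_0_exp:
  fixes m :: "real \<Rightarrow> real"
  assumes "((\<lambda>t. - ln (m (exp (- t))) / t) \<longlongrightarrow> D) at_top"
  shows "((\<lambda>r. ln (m r) / ln r) \<longlongrightarrow> D) (at_right 0)"
proof -
  have "filterlim (\<lambda>r::real. - ln r) at_top (at_right 0)"
    using ln_at_0 by (simp add: filterlim_uminus_at_top)
  from filterlim_compose[OF assms this]
  have "((\<lambda>r. - ln (m (exp (- (- ln r)))) / - ln r) \<longlongrightarrow> D) (at_right 0)" .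
  moreover have "\<forall>\<^sub>F r::real in at_right 0. - ln (m (exp (- (- ln r)))) / - ln r = ln (m r) / ln r"
    using eventually_at_right_less[of 0] by eventually_elim simp
  ultimately show ?thesis by (rule Lim_transform_eventually)
qed

lemma LIMSEQ_iff_countable:
  fixes X :: "nat \<Rightarrow> real"
  shows "X \<longlonglongrightarrow> D \<longleftrightarrow> (\<forall>k::nat. \<exists>N. \<forall>j. N \<le> j \<longrightarrow> \<bar>X j - D\<bar> < 1 / Suc k)"
proof
  assume "X \<longlonglongrightarrow> D"
  then show "\<forall>k::nat. \<exists>N. \<forall>j. N \<le> j \<longrightarrow> \<bar>X j - D\<bar> < 1 / Suc k"
    using LIMSEQ_D[of X D] by (metis real_norm_def zero_less_divide_1_iff of_nat_0_less_iff zero_less_Suc)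
next
  assume *: "\<forall>k::nat. \<exists>N. \<forall>j. N \<le> j \<longrightarrow> \<bar>X j - D\<bar> < 1 / Suc k"
  show "X \<longlonglongrightarrow> D"
  proof (rule LIMSEQ_I)
    fix r :: real assume "0 < r"
    then obtain k :: nat where k: "1 / Suc k < r" using nat_approx_posE by blast
    obtain N where "\<And>j. N \<le> j \<Longrightarrow> \<bar>X j - D\<bar> < 1 / Suc k" using * by blast
    then show "\<exists>N. \<forall>j\<ge>N. norm (X j - D) < r" using k by (intro exI[of _ N]) force
  qed
qed

section \<open>Exact dimensionality of the conditional measures\<close>

context fibered_gibbs
begin

text \<open>The mean of \<open>log_scale\<close> is negative because the fiber maps contract uniformly, so the limit \<open>h / \<gamma>\<close>
makes sense.\<close>

theorem local_dimension:
  assumes f[measurable]: "f \<in> borel_measurable borel" "\<And>\<tau>. \<tau> \<in> E2 \<Longrightarrow> f \<tau> = \<psi> \<tau>" "\<And>\<tau>. \<bar>f \<tau>\<bar> \<le> Bf"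
    and q[measurable]: "q \<in> borel_measurable borel" "\<And>\<tau>. \<tau> \<in> E2 \<Longrightarrow> q \<tau> = log_scale \<tau>" "\<And>\<tau>. \<bar>q \<tau>\<bar> \<le> Bq"
  obtains D where "AE \<tau> in M.
      ((\<lambda>t. - ln (measure (K (coding (tail \<tau> 0))) (ball (fp \<tau>) (exp (- t)))) / t) \<longlongrightarrow> D) at_top \<and>
      (\<forall>r>0. 0 < measure (K (coding (tail \<tau> 0))) (ball (fp \<tau>) r))"
proof -
  obtain \<delta> where \<delta>: "0 < \<delta>" "0 < prob (deep \<delta>)" using deep_positive by blast
  obtain k where k: "inverse l ^ k * diameter Z < \<delta> / 2" using eventually_small_diameter[of "\<delta> / 2"] \<delta> by auto
  define \<gamma> where "\<gamma> = - (\<integral>\<tau>. q (shift_by (-1) \<tau>) \<partial>M)"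
  define h where "h = P - (\<integral>\<tau>. f (shift_by (-1) \<tau>) \<partial>M)"
  have \<gamma>: "0 < \<gamma>"
  proof -
    have "(\<integral>\<tau>. q (shift_by (-1) \<tau>) \<partial>M) \<le> (\<integral>\<tau>. - ln l \<partial>M)"
    proof (rule integral_mono_AE)
      show "integrable M (\<lambda>\<tau>. q (shift_by (-1) \<tau>))"
        by (rule integrable_const_bound[of _ Bq]) (use q(3) in auto)
      show "AE \<tau> in M. q (shift_by (-1) \<tau>) \<le> - ln l"
        using E2_full by eventually_elim (use q(2) log_scale_le in simp)
    qed simp
    then show ?thesis using l_gt_1 prob_space by (simp add: \<gamma>_def) (smt (verit) ln_gt_zero)
  qed
  have dens: "AE \<tau> in M. (\<lambda>n. birkhoff_sum (indicator (deep \<delta>)) n \<tau> / n) \<longlonglongrightarrow> prob (deep \<delta>)"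
  proof -
    have "AE \<tau> in M. (\<lambda>n. birkhoff_sum (indicator (deep \<delta>)) n \<tau> / n) \<longlonglongrightarrow> (\<integral>\<tau>. indicator (deep \<delta>) \<tau> \<partial>M)"
      by (rule birkhoff_bounded[of _ 1]) (auto split: split_indicator)
    then show ?thesis by simp
  qed
  have dens': "(\<lambda>n. (\<Sum>i<n. indicator {n. shift_by (- int n) \<tau> \<in> deep \<delta>} i) / real n) \<longlonglongrightarrow> prob (deep \<delta>)"
    if "(\<lambda>n. birkhoff_sum (indicator (deep \<delta>)) n \<tau> / n) \<longlonglongrightarrow> prob (deep \<delta>)" for \<tau>
    using that by (simp add: birkhoff_sum_shift_by indicator_def)
  have "AE \<tau> in M. \<forall>N. \<exists>n\<ge>N. shift_by (- int n) \<tau> \<in> deep \<delta>"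
    using dens
  proof eventually_elim
    case (elim \<tau>)
    show ?case
    proof
      fix N
      obtain n0 where "\<And>n. n0 \<le> n \<Longrightarrow> \<exists>j\<in>{n. shift_by (- int n) \<tau> \<in> deep \<delta>}. n \<le> j \<and> real j \<le> (1 + 1) * n"
        using eventually_visit_window[OF dens'[OF elim] \<delta>(2), of 1] unfolding eventually_sequentially by auto
      from this[of "max N n0"] show "\<exists>n\<ge>N. shift_by (- int n) \<tau> \<in> deep \<delta>" by auto
    qed
  qed
  then have tp: "AE \<tau> in M. typical (tail \<tau> 0)" by (intro AE_future AE_typical[OF _ \<delta>(1)])
  have scale: "AE \<tau> in M. (\<lambda>n. birkhoff_sum (\<lambda>\<tau>. q (shift_by (-1) \<tau>)) n \<tau> / n) \<longlonglongrightarrow> - \<gamma>"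
    using birkhoff_bounded[of "\<lambda>\<tau>. q (shift_by (-1) \<tau>)" Bq] q(3) by (simp add: \<gamma>_def)
  have decay: "AE \<tau> in M. (\<lambda>n. ln (prob (cyl (- int n) 0 \<tau>)) / n) \<longlonglongrightarrow> - h"
    using cyl_decay[OF f] by (simp add: h_def)
  show thesis
  proof (rule that[of "h / \<gamma>"])
    show "AE \<tau> in M.
      ((\<lambda>t. - ln (measure (K (coding (tail \<tau> 0))) (ball (fp \<tau>) (exp (- t)))) / t) \<longlongrightarrow> h / \<gamma>) at_top \<and>
      (\<forall>r>0. 0 < measure (K (coding (tail \<tau> 0))) (ball (fp \<tau>) r))"
      using E2_full tp dens scale decay
    proof eventually_elim
      case (elim \<tau>)
      interpret Kw: prob_space "K (coding (tail \<tau> 0))" by (rule K_prob)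
      define m where "m r = Kw.prob (ball (fp \<tau>) r)" for r
      define S where "S n = - ln (pscale \<tau> n (fp (shift_by (- int n) \<tau>)))" for n
      define Q where "Q n = - ln (prob (cyl (- int n) 0 \<tau>))" for n
      let ?G = "{n. shift_by (- int n) \<tau> \<in> deep \<delta>}"
      have sp: "0 < pscale \<tau> n (fp (shift_by (- int n) \<tau>))" for n
        using elim(1) by (intro pscale_pos fp_in_Z) auto
      have cp: "0 < prob (cyl (- int n) 0 \<tau>)" if "1 \<le> n" for n using cyl_pos[OF elim(1)] that by simp
      have S: "(\<lambda>n. S n / n) \<longlonglongrightarrow> \<gamma>"
      proof -
        have "S n / n = - (birkhoff_sum (\<lambda>\<tau>. q (shift_by (-1) \<tau>)) n \<tau> / n)" for n
        proof -
          have "ln (pscale \<tau> n (fp (shift_by (- int n) \<tau>))) = birkhoff_sum (\<lambda>\<tau>. q (shift_by (-1) \<tau>)) n \<tau>"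
            unfolding ln_pscale[OF elim(1)] birkhoff_sum_shift_by
            by (rule sum.cong) (use elim(1) q(2) in \<open>auto simp: algebra_simps\<close>)
          then show ?thesis by (simp add: S_def)
        qed
        then show ?thesis using tendsto_minus[OF elim(4)] by simp
      qed
      have Q: "(\<lambda>n. Q n / n) \<longlonglongrightarrow> h"
        using tendsto_minus[OF elim(5)] by (simp add: Q_def)
      have h: "0 \<le> h"
      proof (rule LIMSEQ_le_const[OF Q], intro exI allI impI)
        fix n :: nat assume "1 \<le> n"
        then show "0 \<le> Q n / n" using cp[of n] prob_le_1 unfolding Q_def
          by (intro divide_nonneg_nonneg) (auto intro!: ln_le_zero_iff[THEN iffD2])
      qed
      have mono: "m r \<le> m r'" if "r \<le> r'" for r r'
        unfolding m_def by (rule Kw.finite_measure_mono) (use that in \<open>auto simp: sets_K\<close>)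
      have up: "m ((exp (- distortion) * \<delta>) * exp (- S n)) \<le> C^3 * exp (- Q n)" if "n \<in> ?G" "1 \<le> n" for n
        using mass_upper[OF elim(1,2) _ \<delta>(1) that(2)] that sp[of n] cp[of n]
        by (simp add: m_def S_def Q_def mult_ac)
      have lo: "inverse (C^3) * exp (- Q (n + k)) \<le> m ((exp distortion * \<delta>) * exp (- S n))" if "n \<in> ?G" "1 \<le> n" for n
        using mass_lower[OF elim(1,2) _ \<delta>(1) that(2) k] that sp[of n] cp[of "n + k"]
        by (simp add: m_def S_def Q_def mult_ac divide_inverse)
      have p: "0 < exp (- distortion) * \<delta>" "0 < C^3" "0 < exp distortion * \<delta>" "0 < inverse (C^3)"
        using \<delta> C_ge_1 by auto
      note lim = exponential_scaling_limit[OF mono S \<gamma> Q h dens'[OF elim(3)] \<delta>(2) up lo p]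
      show ?case using lim unfolding m_def by auto
    qed
  qed
qed

text \<open>The local dimension is \<open>D\<close> for almost every sequence. That transfers to almost every \<open>x\<close> and almost
every point of the conditional measure over \<open>x\<close>, since the exceptional set of pairs is Borel.\<close>

theorem conditionals_exact_dimensional:
  assumes f: "f \<in> borel_measurable borel" "\<And>\<tau>. \<tau> \<in> E2 \<Longrightarrow> f \<tau> = \<psi> \<tau>" "\<And>\<tau>. \<bar>f \<tau>\<bar> \<le> Bf"
    and q: "q \<in> borel_measurable borel" "\<And>\<tau>. \<tau> \<in> E2 \<Longrightarrow> q \<tau> = log_scale \<tau>" "\<And>\<tau>. \<bar>q \<tau>\<bar> \<le> Bq"
  shows "AE x in distr (distr M borel (\<lambda>\<tau>. (coding (tail \<tau> 0), \<pi> \<tau>))) borel fst. exact_dimensional (K x)"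
proof -
  let ?\<mu> = "distr M borel (\<lambda>\<tau>. (coding (tail \<tau> 0), \<pi> \<tau>))"
  obtain D where D: "AE \<tau> in M.
      ((\<lambda>t. - ln (measure (K (coding (tail \<tau> 0))) (ball (fp \<tau>) (exp (- t)))) / t) \<longlongrightarrow> D) at_top \<and>
      (\<forall>r>0. 0 < measure (K (coding (tail \<tau> 0))) (ball (fp \<tau>) r))"
    using local_dimension[OF f q] by blast
  define u where "u j p = measure (K (fst p)) (ball (snd p) (exp (- real j)))" for j :: nat and p :: "real \<times> 'a"
  have u[measurable]: "u j \<in> borel_measurable (borel \<Otimes>\<^sub>M borel)" for j
  proof -
    have "{w\<in>space ((borel \<Otimes>\<^sub>M borel) \<Otimes>\<^sub>M borel). dist (snd (fst w)) (snd w) < exp (- real j)}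
        \<in> sets (((borel :: real measure) \<Otimes>\<^sub>M (borel :: 'a measure)) \<Otimes>\<^sub>M (borel :: 'a measure))" by measurable
    also have "{w\<in>space ((borel \<Otimes>\<^sub>M borel) \<Otimes>\<^sub>M borel). dist (snd (fst w)) (snd w) < exp (- real j)}
        = (SIGMA p:space ((borel :: real measure) \<Otimes>\<^sub>M (borel :: 'a measure)). ball (snd p) (exp (- real j)))"
      by (auto simp: space_pair_measure)
    finally show ?thesis unfolding u_def[abs_def]
      by (rule measure_measurable_prob_algebra2) measurable
  qed
  (* positivity of the masses is included because the logarithm of 0 is 0 by convention,
     which would destroy monotonicity in the radius *)
  define R where "R = {p. (\<forall>j. 0 < u j p) \<and> (\<lambda>j. - ln (u j p) / real j) \<longlonglongrightarrow> D}"
  have R: "R \<in> sets (borel \<Otimes>\<^sub>M borel)"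
  proof -
    have "{p\<in>space (borel \<Otimes>\<^sub>M borel). (\<forall>j. 0 < u j p) \<and>
        (\<forall>k::nat. \<exists>N. \<forall>j. N \<le> j \<longrightarrow> \<bar>- ln (u j p) / real j - D\<bar> < 1 / Suc k)} \<in> sets (borel \<Otimes>\<^sub>M borel)"
      by measurable
    then show ?thesis unfolding R_def LIMSEQ_iff_countable by (simp add: space_pair_measure)
  qed
  then have R2: "- R \<in> sets (borel \<Otimes>\<^sub>M borel)"
    using sets.compl_sets[OF R] by (simp add: space_pair_measure Compl_eq_Diff_UNIV)
  then have Rb: "- R \<in> sets (borel :: (real \<times> 'a) measure)" by (subst borel_prod[symmetric])
  have inR: "AE \<tau> in M. (coding (tail \<tau> 0), \<pi> \<tau>) \<in> R"
    using D E2_full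
  proof eventually_elim
    case (elim \<tau>)
    have "(\<lambda>j. - ln (measure (K (coding (tail \<tau> 0))) (ball (fp \<tau>) (exp (- real j)))) / real j) \<longlonglongrightarrow> D"
      using filterlim_compose[OF conjunct1[OF elim(1)] filterlim_real_sequentially] .
    then show ?case using elim by (simp add: R_def u_def \<pi>_fp)
  qed
  have m\<mu>: "(\<lambda>\<tau>. (coding (tail \<tau> 0), \<pi> \<tau>)) \<in> measurable M borel" by measurable
  have "emeasure ?\<mu> (- R) = emeasure M {\<tau>. (coding (tail \<tau> 0), \<pi> \<tau>) \<notin> R}"
    by (subst emeasure_distr[OF m\<mu> Rb]) (simp add: vimage_def)
  also have "\<dots> = 0"
  proof -
    have "{\<tau>. (coding (tail \<tau> 0), \<pi> \<tau>) \<notin> R} \<in> sets M"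
      using measurable_sets[OF m\<mu> Rb] by (simp add: vimage_def)
    with inR show ?thesis by (subst AE_iff_measurable[symmetric]) auto
  qed
  finally have null: "emeasure ?\<mu> (- R) = 0" .
  have "emeasure ?\<mu> (- R) = (\<integral>\<^sup>+x. emeasure (K x) (Pair x -` (- R)) \<partial>(distr ?\<mu> borel fst))"
    by (rule K_conditionals[unfolded fiber_conditionals_def, THEN conjunct2, rule_format, OF Rb])
  from trans[OF sym[OF this] null]
  have "(\<integral>\<^sup>+x. emeasure (K x) (Pair x -` (- R)) \<partial>(distr ?\<mu> borel fst)) = 0" .
  moreover have em: "(\<lambda>x. emeasure (K x) (Pair x -` (- R))) \<in> borel_measurable borel"
  proof -
    have "(SIGMA x:space borel. Pair x -` (- R)) = - R" by auto
    with R2 have "(SIGMA x:space borel. Pair x -` (- R)) \<in> sets (borel \<Otimes>\<^sub>M borel)" by simp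
    then show ?thesis
      by (rule emeasure_measurable_subprob_algebra2[OF _ measurable_prob_algebraD[OF K_measurable]])
  qed
  ultimately have "AE x in distr ?\<mu> borel fst. emeasure (K x) (Pair x -` (- R)) = 0"
    by (subst (asm) nn_integral_0_iff_AE) auto
  then show ?thesis
  proof eventually_elim
    case (elim x)
    have "AE y in K x. (x, y) \<in> R"
    proof (rule AE_I[of _ _ "Pair x -` (- R)"])
      show "Pair x -` (- R) \<in> sets (K x)"
        using sets_Pair1[OF R2, of x] by (simp add: sets_K)
    qed (use elim in auto)
    then have "AE y in K x. ((\<lambda>r. ln (measure (K x) (ball y r)) / ln r) \<longlongrightarrow> D) (at_right 0)"
    proof eventually_elim
      case (elim y)
      interpret Kx: prob_space "K x" by (rule K_prob)
      have pos: "0 < Kx.prob (ball y (exp (- t)))" for t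
      proof -
        obtain j :: nat where "t \<le> real j" using real_arch_simple by blast
        then have "ball y (exp (- real j)) \<subseteq> ball y (exp (- t))" by (intro subset_ball) simp
        then have "Kx.prob (ball y (exp (- real j))) \<le> Kx.prob (ball y (exp (- t)))"
          by (intro Kx.finite_measure_mono) (auto simp: sets_K)
        moreover have "0 < Kx.prob (ball y (exp (- real j)))" using elim by (simp add: R_def u_def)
        ultimately show ?thesis by linarith
      qed
      have "((\<lambda>t. - ln (Kx.prob (ball y (exp (- t)))) / t) \<longlongrightarrow> D) at_top"
      proof (rule tendsto_along_reals)
        fix s t :: real assume "s \<le> t"
        then have "ball y (exp (- t)) \<subseteq> ball y (exp (- s))" by (intro subset_ball) simp
        then have "Kx.prob (ball y (exp (- t))) \<le> Kx.prob (ball y (exp (- s)))"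
          by (intro Kx.finite_measure_mono) (auto simp: sets_K)
        then show "- ln (Kx.prob (ball y (exp (- s)))) \<le> - ln (Kx.prob (ball y (exp (- t))))"
          using pos by simp
      next
        show "(\<lambda>j. - ln (Kx.prob (ball y (exp (- real j)))) / real j) \<longlonglongrightarrow> D"
          using elim by (simp add: R_def u_def)
      qed
      then show ?case by (rule tendsto_at_right_0_exp)
    qed
    then show ?case unfolding exact_dimensional_def by blast
  qed
qed

end

section \<open>Hoelder functions and image measures\<close>

lemma hoelder_E2_bounded:
  assumes "hoelder_E2 f"
  obtains B where "\<And>\<tau>. \<tau> \<in> E2 \<Longrightarrow> \<bar>f \<tau>\<bar> \<le> B"
proof -
  obtain \<kappa> a L where \<kappa>: "0 < \<kappa>" "0 < a"
    and L: "\<And>\<omega> \<tau>. \<omega> \<in> E2 \<Longrightarrow> \<tau> \<in> E2 \<Longrightarrow> \<bar>f \<omega> - f \<tau>\<bar> \<le> L * dist_E2 \<kappa> \<omega> \<tau> powr a"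
    using assms unfolding hoelder_E2_def by blast
  have "\<bar>f \<tau>\<bar> \<le> \<bar>L\<bar> + \<bar>f (\<lambda>_. 0)\<bar>" if \<tau>: "\<tau> \<in> E2" for \<tau>
  proof -
    have d: "0 \<le> dist_E2 \<kappa> \<tau> (\<lambda>_. 0)" "dist_E2 \<kappa> \<tau> (\<lambda>_. 0) \<le> 1" using \<kappa>(1) by (auto simp: dist_E2_def)
    then have "dist_E2 \<kappa> \<tau> (\<lambda>_. 0) powr a \<le> 1 powr a" using \<kappa>(2) by (intro powr_mono2) auto
    then have "\<bar>L\<bar> * dist_E2 \<kappa> \<tau> (\<lambda>_. 0) powr a \<le> \<bar>L\<bar> * 1" by (intro mult_left_mono) auto
    moreover have "L * dist_E2 \<kappa> \<tau> (\<lambda>_. 0) powr a \<le> \<bar>L\<bar> * dist_E2 \<kappa> \<tau> (\<lambda>_. 0) powr a" by (intro mult_right_mono) auto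
    ultimately have "\<bar>f \<tau> - f (\<lambda>_. 0)\<bar> \<le> \<bar>L\<bar>" using L[OF \<tau> zero_E2] by linarith
    then show ?thesis by linarith
  qed
  then show ?thesis by (rule that)
qed

lemma dist_E2_le:
  assumes "\<And>k. \<bar>k\<bar> \<le> int n \<Longrightarrow> \<omega> k = \<tau> k" "0 < \<kappa>"
  shows "0 \<le> dist_E2 \<kappa> \<omega> \<tau>" "dist_E2 \<kappa> \<omega> \<tau> \<le> exp (- \<kappa> * real n)"
proof -
  show "0 \<le> dist_E2 \<kappa> \<omega> \<tau>" by (simp add: dist_E2_def)
  show "dist_E2 \<kappa> \<omega> \<tau> \<le> exp (- \<kappa> * real n)"
  proof (cases "\<omega> = \<tau>")
    case True
    then show ?thesis by (simp add: dist_E2_def)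
  next
    case False
    then obtain i where i: "\<omega> i \<noteq> \<tau> i" by blast
    let ?S = "{n::nat. \<forall>k::int. \<bar>k\<bar> \<le> int n \<longrightarrow> \<omega> k = \<tau> k}"
    have "?S \<subseteq> {..nat \<bar>i\<bar>}" using i by (auto simp: not_le) (metis nat_le_linear nat_0_le abs_ge_zero of_nat_le_iff int_nat_eq)
    then have "finite ?S" by (rule finite_subset) simp
    then have "n \<le> Max ?S" using assms(1) by (intro Max_ge) auto
    then have "exp (- \<kappa> * real (Max ?S)) \<le> exp (- \<kappa> * real n)" using assms(2) by simp
    moreover have "\<omega> 0 = \<tau> 0" by (rule assms(1)) simp
    ultimately show ?thesis using False by (simp add: dist_E2_def)
  qed
qed

text \<open>Sequences that agree on a long window are close, and agreement on a window is an open condition.\<close>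

lemma hoelder_E2_measurable:
  assumes "hoelder_E2 f"
  shows "f \<in> borel_measurable borel_E2"
proof -
  obtain \<kappa> a L where \<kappa>: "0 < \<kappa>" "0 < a"
    and L: "\<And>\<omega> \<tau>. \<omega> \<in> E2 \<Longrightarrow> \<tau> \<in> E2 \<Longrightarrow> \<bar>f \<omega> - f \<tau>\<bar> \<le> L * dist_E2 \<kappa> \<omega> \<tau> powr a"
    using assms unfolding hoelder_E2_def by blast
  have "continuous_on E2 f"
    unfolding continuous_on
  proof (intro ballI tendstoI)
    fix \<tau> :: "int \<Rightarrow> nat" and e :: real assume \<tau>: "\<tau> \<in> E2" and e: "0 < e"
    have "filterlim (\<lambda>n. \<kappa> * a * real n) at_top sequentially"
      using \<kappa> by (intro filterlim_tendsto_pos_mult_at_top[OF tendsto_const] filterlim_real_sequentially) simp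
    then have "(\<lambda>n. exp (- (\<kappa> * a * real n))) \<longlonglongrightarrow> 0"
      by (intro filterlim_compose[OF exp_at_bot]) (simp add: filterlim_uminus_at_bot)
    then have "(\<lambda>n. \<bar>L\<bar> * exp (- (\<kappa> * a * real n))) \<longlonglongrightarrow> \<bar>L\<bar> * 0" by (intro tendsto_intros)
    then have "\<forall>\<^sub>F n in sequentially. \<bar>L\<bar> * exp (- (\<kappa> * a * real n)) < e"
      using e by (intro order_tendstoD(2)) auto
    then obtain n where n: "\<bar>L\<bar> * exp (- (\<kappa> * a * real n)) < e"
      unfolding eventually_sequentially by blast
    let ?O = "\<Inter>k\<in>{- int n..int n}. (\<lambda>\<omega>. \<omega> k) -` {\<tau> k}"
    have "open ((\<lambda>\<omega>::int \<Rightarrow> nat. \<omega> k) -` {\<tau> k})" for k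
      by (rule open_vimage[OF Topological_Spaces.open_discrete]) simp
    then have "open ?O" by (intro open_INT) auto
    moreover have "\<tau> \<in> ?O" by auto
    moreover have "dist (f \<omega>) (f \<tau>) < e" if "\<omega> \<in> ?O" "\<omega> \<in> E2" for \<omega>
    proof -
      have ag: "\<omega> k = \<tau> k" if "\<bar>k\<bar> \<le> int n" for k using \<open>\<omega> \<in> ?O\<close> that by (auto simp: abs_le_iff)
      note d = dist_E2_le[OF ag \<kappa>(1)]
      have "\<bar>f \<omega> - f \<tau>\<bar> \<le> L * dist_E2 \<kappa> \<omega> \<tau> powr a" by (rule L[OF that(2) \<tau>])
      also have "\<dots> \<le> \<bar>L\<bar> * dist_E2 \<kappa> \<omega> \<tau> powr a" by (intro mult_right_mono) auto
      also have "\<dots> \<le> \<bar>L\<bar> * exp (- \<kappa> * real n) powr a"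
        using d \<kappa>(2) by (intro mult_left_mono powr_mono2) auto
      also have "exp (- \<kappa> * real n) powr a = exp (- (\<kappa> * a * real n))"
        by (simp add: powr_def mult_ac)
      finally show ?thesis using n by (simp add: dist_real_def)
    qed
    ultimately show "\<forall>\<^sub>F \<omega> in at \<tau> within E2. dist (f \<omega>) (f \<tau>) < e"
      unfolding eventually_at_topological by blast
  qed
  then show ?thesis by (rule borel_measurable_continuous_on_restrict)
qed

text \<open>Assigning \<open>0\<close> to events with non-measurable preimage is not additive: such an event and its complement
would both get \<open>0\<close>. An image measure that is not a measure is null by convention.\<close>

lemma emeasure_distr_not_measurable:
  assumes "prob_space M" "f \<notin> borel_measurable M"
  shows "emeasure (distr M borel f) A = 0"
proof (rule ccontr)
  interpret prob_space M by fact
  assume "emeasure (distr M borel f) A \<noteq> 0"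
  then have em: "emeasure (distr M borel f) B = emeasure M (f -` B \<inter> space M)" if "B \<in> sets borel" for B
    using that unfolding distr_def emeasure_measure_of_conv
    by (auto split: if_splits simp: sets.sigma_sets_eq[of borel, simplified])
  obtain B where B: "B \<in> sets borel" "f -` B \<inter> space M \<notin> sets M"
    using assms(2) unfolding measurable_def by auto
  have "f -` (- B) \<inter> space M \<notin> sets M"
  proof
    assume "f -` (- B) \<inter> space M \<in> sets M"
    then have "space M - (f -` (- B) \<inter> space M) \<in> sets M" by blast
    moreover have "space M - (f -` (- B) \<inter> space M) = f -` B \<inter> space M" by auto
    ultimately show False using B(2) by simp
  qed
  then have "emeasure (distr M borel f) (- B) = 0" using em[of "- B"] B(1) by (simp add: emeasure_notin_sets)
  moreover have "emeasure (distr M borel f) B = 0" using em[of B] B by (simp add: emeasure_notin_sets)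
  moreover have "emeasure (distr M borel f) B + emeasure (distr M borel f) (- B) = emeasure (distr M borel f) (B \<union> - B)"
    by (rule plus_emeasure) (use B(1) in auto)
  moreover have "emeasure (distr M borel f) (B \<union> - B) = 1"
    using em[of UNIV] emeasure_space_1 by simp
  ultimately show False by simp
qed

section \<open>The skew product\<close>

theorem theorem6p1:
  fixes Y :: "'a::euclidean_space set"
    and F :: "real \<times> 'a \<Rightarrow> real \<times> 'a"
    and g :: "real \<Rightarrow> 'a \<Rightarrow> 'a"
    and T :: "(nat \<Rightarrow> nat) \<Rightarrow> 'a \<Rightarrow> 'a"
    and Ystar :: "(nat \<Rightarrow> nat) \<Rightarrow> 'a set"
    and \<phi> :: "real \<times> 'a \<Rightarrow> real"
    and \<mu>hat :: "(int \<Rightarrow> nat) measure"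
    and \<mu> :: "(real \<times> 'a) measure"
    and K :: "real \<Rightarrow> 'a measure"
  defines "Yfib \<equiv> (\<lambda>\<omega>::nat \<Rightarrow> nat. closure Y)"
  assumes "open Y" and "bounded Y"
    and "\<And>x y. x \<in> {0..<1} \<Longrightarrow> y \<in> Y \<Longrightarrow> F (x, y) = (T_beta x, g x y)"
    and "F ` ({0..<1} \<times> Y) \<subseteq> {0..<1} \<times> Y"
    and "\<And>x. x \<in> {0..<1} \<Longrightarrow> C1_conformal_on (g x) Y"
    and "\<And>x x'. x \<in> {0..<1} \<Longrightarrow> x' \<in> {0..<1} \<Longrightarrow> x \<noteq> x' \<Longrightarrow> T_beta x = T_beta x' \<Longrightarrow>
           g x ` Y \<inter> g x' ` Y = {}"
    and "\<And>\<omega> y. \<omega> \<in> E2p \<Longrightarrow> y \<in> Y \<Longrightarrow> T \<omega> y = g (coding \<omega>) y"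
    and "fiber_maps Yfib T"
    and "cond_a Yfib"
    and "cond_b Yfib Ystar T"
    and "cond_c Ystar T"
    and "cond_d Ystar T"
    and "cond_e Yfib T"
    and "cond_f Yfib T"
    and "cond_g Yfib T"
    and "hoelder_E2 (\<phi> \<circ> skew_coding Yfib T)"
    and "equilibrium_state (\<phi> \<circ> skew_coding Yfib T) \<mu>hat"
    and "gibbs_state (\<phi> \<circ> skew_coding Yfib T) \<mu>hat"
    and "\<mu> = distr \<mu>hat borel (skew_coding Yfib T)"
    and "fiber_conditionals \<mu> K"
  shows "AE x in distr \<mu> borel fst. exact_dimensional (K x)"
proof (cases "skew_coding Yfib T \<in> borel_measurable \<mu>hat")
  case False
  (* the image measure is null, so there is nothing to prove *)
  have "prob_space \<mu>hat" using assms(19) unfolding gibbs_state_def invariant_prob_E2_def by blast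
  then have zero: "emeasure \<mu> A = 0" for A
    unfolding assms(20) using False by (rule emeasure_distr_not_measurable)
  have sets\<mu>: "sets \<mu> = sets borel" unfolding assms(20) by simp
  have "(fst :: real \<times> 'a \<Rightarrow> real) \<in> borel_measurable borel"
    by (rule borel_measurable_continuous_onI[OF continuous_on_fst[OF continuous_on_id]])
  then have fst: "fst \<in> borel_measurable \<mu>" by (simp cong: measurable_cong_sets add: sets\<mu>)
  show ?thesis
    by (rule AE_I[of _ _ UNIV]) (auto simp: emeasure_distr[OF fst] zero)
next
  case True
  let ?fp = "fiber_point Yfib T"
  let ?\<psi> = "\<phi> \<circ> skew_coding Yfib T"
  define Z where "Z = closure Y"
  have Yfib: "Yfib = (\<lambda>_. Z)" unfolding Yfib_def Z_def ..
  define \<pi> where "\<pi> \<tau> = (if \<tau> \<in> E2 then ?fp \<tau> else 0)" for \<tau>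
  define M where "M = distr \<mu>hat borel (\<lambda>\<tau>. \<tau>)"
  have inv: "prob_space \<mu>hat" "sets \<mu>hat = sets borel_E2" "measure_preserving_map \<mu>hat shift"
    using assms(19) unfolding gibbs_state_def invariant_prob_E2_def by blast+
  interpret \<mu>hat: prob_space \<mu>hat by (rule inv(1))
  have space_hat: "space \<mu>hat = E2"
    using sets_eq_imp_space_eq[OF inv(2)] by (simp add: space_restrict_space)
  have id_hat: "(\<lambda>\<tau>. \<tau>) \<in> borel_measurable \<mu>hat"
    by (subst measurable_cong_sets[OF inv(2) refl]) (rule measurable_restrict_space1, simp)
  have em: "emeasure M A = emeasure \<mu>hat (A \<inter> E2)" if "A \<in> sets borel" for A
    unfolding M_def using emeasure_distr[OF id_hat that] by (simp add: space_hat vimage_def)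
  have sM: "sets M = sets borel" by (simp add: M_def)
  obtain C P where C: "1 \<le> C" and gibbs: "\<And>\<tau> n. \<tau> \<in> E2 \<Longrightarrow> 1 \<le> n \<Longrightarrow>
      inverse C \<le> measure \<mu>hat {\<omega>\<in>E2. \<forall>k<n. \<omega> (int k) = \<tau> (int k)} / exp ((\<Sum>k<n. ?\<psi> ((shift ^^ k) \<tau>)) - real n * P) \<and>
      measure \<mu>hat {\<omega>\<in>E2. \<forall>k<n. \<omega> (int k) = \<tau> (int k)} / exp ((\<Sum>k<n. ?\<psi> ((shift ^^ k) \<tau>)) - real n * P) \<le> C"
    using assms(19) unfolding gibbs_state_def Let_def by blast
  interpret gibbs_measure M ?\<psi> C P
  proof (intro gibbs_measure.intro gibbs_measure_axioms.intro prob_spaceI)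
    show "emeasure M (space M) = 1"
      using em[of UNIV] \<mu>hat.emeasure_space_1 sets_eq_imp_space_eq[OF sM] by (simp add: space_hat)
    show "sets M = sets borel" by (rule sM)
    show "AE \<tau> in M. \<tau> \<in> E2"
      unfolding M_def by (subst AE_distr_iff[OF id_hat]) (auto simp: space_hat)
    show "1 \<le> C" by (rule C)
    show "distr M M shift = M"
    proof (rule measure_eqI)
      fix A assume "A \<in> sets (distr M M shift)"
      then have A: "A \<in> sets borel" by (simp add: sM)
      have sh: "shift \<in> measurable M M" unfolding shift_eq by (simp cong: measurable_cong_sets add: sM)
      have shA: "shift -` A \<in> sets borel" using measurable_sets[OF shift_by_measurable A, of 1] by (simp add: shift_eq)
      have AE2: "A \<inter> E2 \<in> sets \<mu>hat" using A E2_measurable by (auto simp: inv(2) sets_restrict_space)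
      have "emeasure (distr M M shift) A = emeasure M (shift -` A)"
        using emeasure_distr[OF sh, of A] A sets_eq_imp_space_eq[OF sM] by (simp add: sM)
      also have "\<dots> = emeasure \<mu>hat (shift -` (A \<inter> E2) \<inter> space \<mu>hat)"
        unfolding em[OF shA] space_hat by (rule arg_cong[of _ _ "emeasure \<mu>hat"]) (auto simp: shift_eq)
      also have "\<dots> = emeasure (distr \<mu>hat \<mu>hat shift) (A \<inter> E2)"
        using inv(3) AE2 unfolding measure_preserving_map_def by (intro emeasure_distr[symmetric]) auto
      also have "\<dots> = emeasure \<mu>hat (A \<inter> E2)" using inv(3) unfolding measure_preserving_map_def by simp
      also have "\<dots> = emeasure M A" by (rule em[OF A, symmetric])
      finally show "emeasure (distr M M shift) A = emeasure M A" .
    qed simp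
    fix \<tau> :: "int \<Rightarrow> nat" and n :: nat assume a: "\<tau> \<in> E2" "1 \<le> n"
    have "(\<forall>k. 0 \<le> k \<and> k < int n \<longrightarrow> \<omega> k = \<tau> k) \<longleftrightarrow> (\<forall>k<n. \<omega> (int k) = \<tau> (int k))" for \<omega> :: "int \<Rightarrow> nat"
    proof (intro iffI allI impI)
      fix k assume *: "\<forall>k<n. \<omega> (int k) = \<tau> (int k)" "0 \<le> k \<and> k < int n"
      then show "\<omega> k = \<tau> k" using *(1)[rule_format, of "nat k"] by auto
    qed auto
    then have "cyl 0 (int n) \<tau> \<inter> E2 = {\<omega>\<in>E2. \<forall>k<n. \<omega> (int k) = \<tau> (int k)}"
      by (auto simp: cyl_def)
    then have "measure M (cyl 0 (int n) \<tau>) = measure \<mu>hat {\<omega>\<in>E2. \<forall>k<n. \<omega> (int k) = \<tau> (int k)}"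
      using em[OF cyl_measurable[of 0 "int n" \<tau>]] by (simp add: measure_def)
    then show "inverse C \<le> measure M (cyl 0 (int n) \<tau>) / exp ((\<Sum>k<n. ?\<psi> ((shift ^^ k) \<tau>)) - real n * P) \<and>
      measure M (cyl 0 (int n) \<tau>) / exp ((\<Sum>k<n. ?\<psi> ((shift ^^ k) \<tau>)) - real n * P) \<le> C"
      using gibbs[OF a] by (simp only:)
  qed
  obtain l where l: "1 < l" "\<And>\<omega> y z. \<omega> \<in> E2p \<Longrightarrow> y \<in> Ystar \<omega> \<Longrightarrow> z \<in> Ystar \<omega> \<Longrightarrow>
      norm (T \<omega> y - T \<omega> z) \<le> inverse l * norm (y - z)"
    using assms(12) unfolding cond_c_def by blast
  obtain \<alpha> H where aH: "0 < \<alpha>" "0 < H" "\<And>\<omega> y z. \<omega> \<in> E2p \<Longrightarrow> y \<in> Ystar \<omega> \<Longrightarrow> z \<in> Ystar \<omega> \<Longrightarrow>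
      \<bar>ln (deriv_norm (T \<omega>) y) - ln (deriv_norm (T \<omega>) z)\<bar> \<le> H * norm (y - z) powr \<alpha>"
    using assms(13) unfolding cond_d_def by blast
  have zero_E2p: "(\<lambda>_. 0) \<in> E2p" by (simp add: E2p_def)
  have int_pt: "\<exists>\<tau>\<in>E2. tail \<tau> 0 = \<omega> \<and> ?fp \<tau> \<in> interior Z" if \<omega>: "\<omega> \<in> E2p" for \<omega>
  proof -
    obtain \<delta> :: real and y where \<delta>: "0 < \<delta>" "y \<in> fiber_limit_set Yfib T \<omega>" "y \<notin> closed_nbhd (- Yfib \<omega>) \<delta>"
      using assms(16) \<omega> unfolding cond_g_def by blast
    obtain \<tau> where \<tau>: "\<tau> \<in> E2" "tail \<tau> 0 = \<omega>" "y = ?fp \<tau>" using \<delta>(2) unfolding fiber_limit_set_def by blast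
    have d: "0 < infdist y (- Z)" using \<delta>(1,3) by (simp add: closed_nbhd_def Yfib)
    then have "- Z \<noteq> {}" by (auto simp: infdist_def)
    then have "y \<notin> closure (- Z)" using d in_closure_iff_infdist_zero[of "- Z" y] by simp
    then have "y \<in> interior Z" by (simp add: closure_complement)
    then show ?thesis using \<tau> by blast
  qed
  have emb: "C1_conformal_embedding (T \<omega>) (Ystar \<omega>) (Ystar (shiftp \<omega>))" "open (Ystar \<omega>)" "Z \<subseteq> Ystar \<omega>" if "\<omega> \<in> E2p" for \<omega>
    using assms(11) that unfolding cond_b_def Yfib by blast+
  interpret conformal_fibers Z Ystar T l \<alpha> H
  proof
    show "compact Z" unfolding Z_def using assms(3) by (simp add: compact_eq_bounded_closed bounded_closure)
    show "Z \<noteq> {}" using int_pt[OF zero_E2p] interior_subset by blast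
    show "closure (interior Z) = Z" using assms(10) zero_E2p unfolding cond_a_def Yfib by blast
    show "T \<omega> z \<in> Z" if "\<omega> \<in> E2p" "z \<in> Z" for \<omega> z using assms(9) that unfolding fiber_maps_def Yfib by blast
    show "open (Ystar \<omega>)" if "\<omega> \<in> E2p" for \<omega> by (rule emb(2)[OF that])
    show "Z \<subseteq> Ystar \<omega>" if "\<omega> \<in> E2p" for \<omega> by (rule emb(3)[OF that])
    show "inj_on (T \<omega>) (Ystar \<omega>)" if "\<omega> \<in> E2p" for \<omega>
      using emb(1)[OF that] unfolding C1_conformal_embedding_def homeomorphism_def by (metis inj_on_inverseI)
    show "\<exists>c. conformal_at (T \<omega>) z c" if w: "\<omega> \<in> E2p" "z \<in> Ystar \<omega>" for \<omega> z
    proof -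
      obtain D where D: "\<forall>y\<in>Ystar \<omega>. (T \<omega> has_derivative blinfun_apply (D y)) (at y) \<and>
          (\<exists>c>0. \<exists>Q. orthogonal_transformation Q \<and> blinfun_apply (D y) = (\<lambda>v. c *\<^sub>R Q v))"
        using emb(1)[OF w(1)] unfolding C1_conformal_embedding_def C1_conformal_on_def by blast
      then obtain c Q where "0 < c" "orthogonal_transformation Q" "blinfun_apply (D z) = (\<lambda>v. c *\<^sub>R Q v)"
        using w(2) by blast
      moreover have "(T \<omega> has_derivative blinfun_apply (D z)) (at z)" using D w(2) by blast
      ultimately have "conformal_at (T \<omega>) z c" unfolding conformal_at_def by auto
      then show ?thesis by blast
    qed
    show "1 < l" by (rule l(1))
    show "norm (T \<omega> y - T \<omega> z) \<le> inverse l * norm (y - z)" if "\<omega> \<in> E2p" "y \<in> Ystar \<omega>" "z \<in> Ystar \<omega>" for \<omega> y z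
      by (rule l(2)[OF that])
    show "0 < \<alpha>" "0 < H" by (rule aH)+
    show "\<bar>ln (deriv_norm (T \<omega>) y) - ln (deriv_norm (T \<omega>) z)\<bar> \<le> H * norm (y - z) powr \<alpha>"
      if "\<omega> \<in> E2p" "y \<in> Ystar \<omega>" "z \<in> Ystar \<omega>" for \<omega> y z by (rule aH(3)[OF that])
    show "T (case_nat a \<omega>) ` interior Z \<inter> T (case_nat b \<omega>) ` interior Z = {}"
      if ab: "a \<noteq> b" "case_nat a \<omega> \<in> E2p" "case_nat b \<omega> \<in> E2p" for a b \<omega>
    proof -
      have "\<omega> \<in> E2p" using shiftp_E2p[OF ab(2)] by (simp add: shiftp_def)
      moreover have "a \<in> {0, 1}" "b \<in> {0, 1}" using E2p_digit[OF ab(2), of 0] E2p_digit[OF ab(3), of 0] by auto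
      ultimately show ?thesis using assms(15) ab unfolding cond_f_def Yfib by blast
    qed
  qed
  have skew: "skew_coding Yfib T \<tau> = (coding (tail \<tau> 0), \<pi> \<tau>)" if "\<tau> \<in> E2" for \<tau>
    using that by (simp add: skew_coding_def \<pi>_def)
  have ext: "(\<lambda>\<tau>. if \<tau> \<in> E2 then f \<tau> else 0) \<in> borel_measurable borel"
    if "f \<in> borel_measurable borel_E2" for f :: "(int \<Rightarrow> nat) \<Rightarrow> 'b::real_normed_vector"
    using that E2_measurable by (subst measurable_If_restrict_space_iff) auto
  have "(snd :: real \<times> 'a \<Rightarrow> 'a) \<in> borel_measurable borel"
    by (rule borel_measurable_continuous_onI[OF continuous_on_snd[OF continuous_on_id]])
  from measurable_compose[OF True this] have "?fp \<in> borel_measurable \<mu>hat" by (simp add: skew_coding_def)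
  then have "?fp \<in> borel_measurable borel_E2" by (subst measurable_cong_sets[OF inv(2)[symmetric] refl])
  then have \<pi>m: "\<pi> \<in> borel_measurable borel" unfolding \<pi>_def by (rule ext)
  have pm: "(\<lambda>\<tau>. (coding (tail \<tau> 0), \<pi> \<tau>)) \<in> borel_measurable borel"
    using \<pi>m by measurable
  have \<mu>: "\<mu> = distr M borel (\<lambda>\<tau>. (coding (tail \<tau> 0), \<pi> \<tau>))"
  proof -
    have "distr M borel (\<lambda>\<tau>. (coding (tail \<tau> 0), \<pi> \<tau>)) = distr \<mu>hat borel (\<lambda>\<tau>. (coding (tail \<tau> 0), \<pi> \<tau>))"
      unfolding M_def by (subst distr_distr[OF pm id_hat]) (simp add: comp_def)
    also have "\<dots> = \<mu>" unfolding assms(20) by (rule distr_cong) (auto simp: space_hat skew)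
    finally show ?thesis by simp
  qed
  interpret fibered_gibbs M ?\<psi> C P Z Ystar T l \<alpha> H K \<pi>
  proof
    show "\<pi> \<in> borel_measurable borel" by (rule \<pi>m)
    show "\<pi> \<tau> = fiber_point (\<lambda>_. Z) T \<tau>" if "\<tau> \<in> E2" for \<tau> using that by (simp add: \<pi>_def Yfib)
    show "fiber_conditionals (distr M borel (\<lambda>\<tau>. (coding (tail \<tau> 0), \<pi> \<tau>))) K"
      using assms(21) unfolding \<mu> .
    show "\<exists>\<tau>\<in>E2. tail \<tau> 0 = \<omega> \<and> fiber_point (\<lambda>_. Z) T \<tau> \<in> interior Z" if "\<omega> \<in> E2p" for \<omega>
      using int_pt[OF that] unfolding Yfib .
  qed
  have ls: "hoelder_E2 log_scale"
    using assms(14) unfolding cond_e_def Yfib log_scale_def[abs_def] .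
  obtain Bf where Bf: "\<And>\<tau>. \<tau> \<in> E2 \<Longrightarrow> \<bar>?\<psi> \<tau>\<bar> \<le> Bf" using hoelder_E2_bounded[OF assms(17)] by blast
  obtain Bq where Bq: "\<And>\<tau>. \<tau> \<in> E2 \<Longrightarrow> \<bar>log_scale \<tau>\<bar> \<le> Bq" using hoelder_E2_bounded[OF ls] by blast
  have B0: "0 \<le> Bf" "0 \<le> Bq" using Bf[OF zero_E2] Bq[OF zero_E2] by linarith+
  show ?thesis unfolding \<mu>
    by (rule conditionals_exact_dimensional[OF ext[OF hoelder_E2_measurable[OF assms(17)]] _ _
          ext[OF hoelder_E2_measurable[OF ls]], of Bf Bq])
       (use Bf Bq B0 in auto)
qed

end
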